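(* Suppose prices are bounded: there are constants $0<p_-\le p_+$ with $p_-\le P^i_t\le p_+$ a.s. for all $i,t$. Suppose both $U^a$ and $U^p$ are constructed by pasting optimized certainty equivalents with loss functions $H^a_t$, resp. $H^p_t$, i.e. on one-step variables $U^l_t(X)=\operatorname*{ess\,sup}_{s\in\mathbb{R}}\{s-\mathbb{E}[H^l_t(s-X)\mid\mathcal{F}_t]\}$, $l=a,p$, and that for each $t$: $1\in int(dom((H^a_t)^* ))\cap int(dom((H^p_t)^* ))$ and $H^a_t,H^p_t$ are bounded from below. Assume $\lim_{|a|\to\infty}c_t(a)/|a|=\infty$ for every $t$. Then for every $t\in\mathbb{T}$ the Principal's one-step problem $h_t=\operatorname*{ess\,sup}_{\beta,(A,\Gamma)\in\mathbb{C}_t(\beta)}\{U^a_t(\Gamma)-c_t(A)+U^p_t(h_{t+1}+A\Delta\tilde P_{t+1}-\Gamma)\}$ (with $h_T=0$) is attained with $\beta_t=1$, and the dynamic Principal–Agent problem has a solution in which $\beta_t=1$ for all $t$: the Agent keeps the generated wealth and the Principal receives a (possibly path-dependent) derivative on the price path.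
   Context: Setting: $T\in\mathbb{N}$, $\mathbb{T}:=\{0,\dots,T-1\}$; a probability space carrying an $\mathbb{R}^N$-valued strictly positive price process $P=(P_t)_{t=0}^T$ with generated filtration $(\mathcal{F}_t)$; $\Delta\tilde P_{t+1}:=diag(P_t)^{-1}(P_{t+1}-P_t)$; $c_t:\mathbb{R}^N\to\mathbb{R}$ strictly convex. The Agent chooses efforts $A_t\in L^0(\mathcal{F}_t)^N$ with cost $c_t(A_t)$; wealth increments are $\Delta W^A_{t+1}=A_t\Delta\tilde P_{t+1}$. Contracts pay $\Theta+\sum_t\beta_t\Delta W^A_{t+1}$, $\Theta$ $\mathcal{F}_T$-measurable, $\beta_t\in L^0(\mathcal{F}_t)$. Optimized certainty equivalent (OCE): $H_t:\mathbb{R}\to\mathbb{R}\cup\{+\infty\}$ convex, lower semicontinuous, nondecreasing with $H_t^*(1):=\sup_s[s-H_t(s)]=0$ (here $H^*$ denotes the convex conjugate $H^*(x)=\sup_s[xs-H(s)]$). The one-step functional $\tilde U_t(X):=\operatorname*{ess\,sup}_{s\in\mathbb{R}}\{s-\mathbb{E}[H_t(s-X)\mid\mathcal{F}_t]\}$ for bounded $\mathcal{F}_{t+1}$-measurable $X$ is extended to $\mathcal{F}_{t+1}$-measurable $X$ with values in $\mathbb{R}\cup\{-\infty\}$ by $X\mapsto\lim_{n\to\infty}\lim_{m\to-\infty}\tilde U_t((X\wedge n)\vee m)$; the pasted family is $U_t:=\tilde U_t\circ\tilde U_{t+1}\circ\dots\circ\tilde U_{T-1}$. $\mathbb{C}_t(\beta)$: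 set of $(A,\Gamma)\in L^0(\mathcal{F}_t)^N\times L^0(\mathcal{F}_{t+1})$ with $U^a_t(\Gamma)-c_t(A)\ge U^a_t(\Gamma+\beta(\bar A-A)\Delta\tilde P_{t+1})-c_t(\bar A)$ for all $\bar A\in L^0(\mathcal{F}_t)^N$. A solution of the dynamic problem is a contract maximizing the Principal's time-0 utility $U^p_0(W^A_T-\text{payment})$ among incentive compatible (the Agent's recursive optima $H_t=\operatorname*{ess\,sup}_A\{U^a_t(H_{t+1}+\beta_tA\Delta\tilde P_{t+1})-c_t(A)\}$, $H_T=\Theta$, are attained) and individually rational (Agent's optimal utility $\ge R\in\mathbb{R}$) contracts. *)

theory Defs
  imports "HOL-Probability.Probability"
begin

definition Filt :: "'a measure \<Rightarrow> (nat \<Rightarrow> 'a \<Rightarrow> real^'n) \<Rightarrow> nat \<Rightarrow> 'a measure" where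
  "Filt M P t = sigma (space M) {P s -` B \<inter> space M | s B. s \<le> t \<and> B \<in> sets borel}"

definition dPrel :: "(nat \<Rightarrow> 'a \<Rightarrow> real^'n) \<Rightarrow> nat \<Rightarrow> 'a \<Rightarrow> real^'n" where
  "dPrel P t \<omega> = (\<chi> i. (P (Suc t) \<omega> $ i - P t \<omega> $ i) / P t \<omega> $ i)"

definition strictly_convex :: "(real^'n \<Rightarrow> real) \<Rightarrow> bool" where
  "strictly_convex f \<longleftrightarrow> (\<forall>x y u. x \<noteq> y \<and> 0 < u \<and> u < 1 \<longrightarrow>
      f (u *\<^sub>R x + (1 - u) *\<^sub>R y) < u * f x + (1 - u) * f y)"

definition ereal_convex :: "(real \<Rightarrow> ereal) \<Rightarrow> bool" where
  "ereal_convex H \<longleftrightarrow> (\<forall>x y u. 0 \<le> u \<and> u \<le> 1 \<longrightarrow>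
      H (u * x + (1 - u) * y) \<le> ereal u * H x + ereal (1 - u) * H y)"

definition ereal_lsc :: "(real \<Rightarrow> ereal) \<Rightarrow> bool" where
  "ereal_lsc H \<longleftrightarrow> (\<forall>a. closed {x. H x \<le> a})"

definition conjugate :: "(real \<Rightarrow> ereal) \<Rightarrow> real \<Rightarrow> ereal" where
  "conjugate H x = (SUP s. ereal (x * s) - H s)"

definition OCE_loss :: "(real \<Rightarrow> ereal) \<Rightarrow> bool" where
  "OCE_loss H \<longleftrightarrow> (\<forall>s. H s \<noteq> -\<infinity>) \<and> ereal_convex H \<and> ereal_lsc H \<and> mono H
     \<and> conjugate H 1 = 0"

definition ecexp :: "'a measure \<Rightarrow> 'a measure \<Rightarrow> ('a \<Rightarrow> ereal) \<Rightarrow> 'a \<Rightarrow> ereal" where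
  "ecexp M F Y \<omega> =
     enn2ereal (nn_cond_exp M F (\<lambda>x. e2ennreal (Y x)) \<omega>)
     - enn2ereal (nn_cond_exp M F (\<lambda>x. e2ennreal (- Y x)) \<omega>)"

definition is_ess_sup :: "'a measure \<Rightarrow> 'a measure \<Rightarrow> ('a \<Rightarrow> ereal) set \<Rightarrow> ('a \<Rightarrow> ereal) \<Rightarrow> bool" where
  "is_ess_sup M F S Y \<longleftrightarrow> Y \<in> borel_measurable F
     \<and> (\<forall>X\<in>S. AE \<omega> in M. X \<omega> \<le> Y \<omega>)
     \<and> (\<forall>Z\<in>borel_measurable F. (\<forall>X\<in>S. AE \<omega> in M. X \<omega> \<le> Z \<omega>) \<longrightarrow> (AE \<omega> in M. Y \<omega> \<le> Z \<omega>))"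

definition oce1 :: "'a measure \<Rightarrow> 'a measure \<Rightarrow> (real \<Rightarrow> ereal) \<Rightarrow> ('a \<Rightarrow> real) \<Rightarrow> ('a \<Rightarrow> ereal) \<Rightarrow> bool" where
  "oce1 M F H X Y \<longleftrightarrow>
     is_ess_sup M F {(\<lambda>\<omega>. ereal s - ecexp M F (\<lambda>\<omega>'. H (s - X \<omega>')) \<omega>) | s. True} Y"

text \<open>Extension to extended-real X: lim_{n\<rightarrow>\<infinity>} lim_{m\<rightarrow>-\<infinity>} tilde U_t((X \<and> n) \<or> m),
  limits taken a.s. along integer sequences n = 0,1,2,... and m = -k, k = 0,1,2,...\<close>
definition oce :: "'a measure \<Rightarrow> 'a measure \<Rightarrow> (real \<Rightarrow> ereal) \<Rightarrow> ('a \<Rightarrow> ereal) \<Rightarrow> ('a \<Rightarrow> ereal) \<Rightarrow> bool" where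
  "oce M F H X Y \<longleftrightarrow> Y \<in> borel_measurable F \<and>
     (\<exists>Yd :: nat \<Rightarrow> nat \<Rightarrow> 'a \<Rightarrow> ereal. \<exists>Z :: nat \<Rightarrow> 'a \<Rightarrow> ereal.
        (\<forall>n k. oce1 M F H (\<lambda>\<omega>. real_of_ereal (max (min (X \<omega>) (ereal (real n))) (ereal (- real k)))) (Yd n k))
      \<and> (\<forall>n. AE \<omega> in M. (\<lambda>k. Yd n k \<omega>) \<longlonglongrightarrow> Z n \<omega>)
      \<and> (AE \<omega> in M. (\<lambda>n. Z n \<omega>) \<longlonglongrightarrow> Y \<omega>))"

definition pasted :: "'a measure \<Rightarrow> (nat \<Rightarrow> 'a measure) \<Rightarrow> (nat \<Rightarrow> real \<Rightarrow> ereal) \<Rightarrow> nat \<Rightarrow> nat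
     \<Rightarrow> ('a \<Rightarrow> ereal) \<Rightarrow> ('a \<Rightarrow> ereal) \<Rightarrow> bool" where
  "pasted M F H T t X Y \<longleftrightarrow> (\<exists>V :: nat \<Rightarrow> 'a \<Rightarrow> ereal. V T = X
     \<and> (\<forall>s. t \<le> s \<and> s < T \<longrightarrow> oce M (F s) (H s) (V (Suc s)) (V s)) \<and> V t = Y)"

definition inC :: "'a measure \<Rightarrow> (nat \<Rightarrow> 'a \<Rightarrow> real^'n) \<Rightarrow> nat \<Rightarrow> (nat \<Rightarrow> real \<Rightarrow> ereal)
     \<Rightarrow> (nat \<Rightarrow> real^'n \<Rightarrow> real) \<Rightarrow> nat \<Rightarrow> ('a \<Rightarrow> real) \<Rightarrow> ('a \<Rightarrow> real^'n) \<Rightarrow> ('a \<Rightarrow> real) \<Rightarrow> bool" where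
  "inC M P T Ha c t \<beta> A \<Gamma> \<longleftrightarrow>
     A \<in> borel_measurable (Filt M P t) \<and> \<Gamma> \<in> borel_measurable (Filt M P (Suc t)) \<and>
     (\<forall>Ab \<in> borel_measurable (Filt M P t). \<forall>Y1 Y2.
        pasted M (Filt M P) Ha T t (\<lambda>\<omega>. ereal (\<Gamma> \<omega>)) Y1 \<longrightarrow>
        pasted M (Filt M P) Ha T t (\<lambda>\<omega>. ereal (\<Gamma> \<omega> + \<beta> \<omega> * ((Ab \<omega> - A \<omega>) \<bullet> dPrel P t \<omega>))) Y2 \<longrightarrow>
        (AE \<omega> in M. Y2 \<omega> - ereal (c t (Ab \<omega>)) \<le> Y1 \<omega> - ereal (c t (A \<omega>))))"

definition prin_val :: "'a measure \<Rightarrow> (nat \<Rightarrow> 'a \<Rightarrow> real^'n) \<Rightarrow> nat \<Rightarrow> (nat \<Rightarrow> real \<Rightarrow> ereal)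
     \<Rightarrow> (nat \<Rightarrow> real \<Rightarrow> ereal) \<Rightarrow> (nat \<Rightarrow> real^'n \<Rightarrow> real) \<Rightarrow> nat \<Rightarrow> ('a \<Rightarrow> ereal)
     \<Rightarrow> ('a \<Rightarrow> real^'n) \<Rightarrow> ('a \<Rightarrow> real) \<Rightarrow> ('a \<Rightarrow> ereal) \<Rightarrow> bool" where
  "prin_val M P T Ha Hp c t h' A \<Gamma> V \<longleftrightarrow> (\<exists>Ya Yp.
     pasted M (Filt M P) Ha T t (\<lambda>\<omega>. ereal (\<Gamma> \<omega>)) Ya \<and>
     pasted M (Filt M P) Hp T t (\<lambda>\<omega>. h' \<omega> + ereal (A \<omega> \<bullet> dPrel P t \<omega> - \<Gamma> \<omega>)) Yp \<and>
     V = (\<lambda>\<omega>. Ya \<omega> - ereal (c t (A \<omega>)) + Yp \<omega>))"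

definition prin_family :: "'a measure \<Rightarrow> (nat \<Rightarrow> 'a \<Rightarrow> real^'n) \<Rightarrow> nat \<Rightarrow> (nat \<Rightarrow> real \<Rightarrow> ereal)
     \<Rightarrow> (nat \<Rightarrow> real \<Rightarrow> ereal) \<Rightarrow> (nat \<Rightarrow> real^'n \<Rightarrow> real) \<Rightarrow> nat \<Rightarrow> ('a \<Rightarrow> ereal) \<Rightarrow> ('a \<Rightarrow> ereal) set" where
  "prin_family M P T Ha Hp c t h' = {V. \<exists>\<beta> A \<Gamma>. \<beta> \<in> borel_measurable (Filt M P t)
      \<and> inC M P T Ha c t \<beta> A \<Gamma> \<and> prin_val M P T Ha Hp c t h' A \<Gamma> V}"

definition prin_recursion :: "'a measure \<Rightarrow> (nat \<Rightarrow> 'a \<Rightarrow> real^'n) \<Rightarrow> nat \<Rightarrow> (nat \<Rightarrow> real \<Rightarrow> ereal)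
     \<Rightarrow> (nat \<Rightarrow> real \<Rightarrow> ereal) \<Rightarrow> (nat \<Rightarrow> real^'n \<Rightarrow> real) \<Rightarrow> (nat \<Rightarrow> 'a \<Rightarrow> ereal) \<Rightarrow> bool" where
  "prin_recursion M P T Ha Hp c h \<longleftrightarrow> h T = (\<lambda>\<omega>. 0) \<and>
     (\<forall>t<T. is_ess_sup M (Filt M P t) (prin_family M P T Ha Hp c t (h (Suc t))) (h t))"

text \<open>Contract (Theta, beta) is incentive compatible with Agent's optimal effort A (the
  Agent's recursive optima are attained by A) and individually rational at level R.\<close>
definition admissible :: "'a measure \<Rightarrow> (nat \<Rightarrow> 'a \<Rightarrow> real^'n) \<Rightarrow> nat \<Rightarrow> (nat \<Rightarrow> real \<Rightarrow> ereal)
     \<Rightarrow> (nat \<Rightarrow> real^'n \<Rightarrow> real) \<Rightarrow> real \<Rightarrow> ('a \<Rightarrow> real) \<Rightarrow> (nat \<Rightarrow> 'a \<Rightarrow> real)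
     \<Rightarrow> (nat \<Rightarrow> 'a \<Rightarrow> real^'n) \<Rightarrow> bool" where
  "admissible M P T Ha c R \<Theta> \<beta> A \<longleftrightarrow>
     \<Theta> \<in> borel_measurable (Filt M P T) \<and>
     (\<forall>t<T. \<beta> t \<in> borel_measurable (Filt M P t) \<and> A t \<in> borel_measurable (Filt M P t)) \<and>
     (\<exists>Hs :: nat \<Rightarrow> 'a \<Rightarrow> ereal. Hs T = (\<lambda>\<omega>. ereal (\<Theta> \<omega>)) \<and>
        (\<forall>t<T.
           is_ess_sup M (Filt M P t)
             {V. \<exists>Ab Y. Ab \<in> borel_measurable (Filt M P t) \<and>
                 pasted M (Filt M P) Ha T t (\<lambda>\<omega>. Hs (Suc t) \<omega> + ereal (\<beta> t \<omega> * (Ab \<omega> \<bullet> dPrel P t \<omega>))) Y \<and>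
                 V = (\<lambda>\<omega>. Y \<omega> - ereal (c t (Ab \<omega>)))} (Hs t)
         \<and> (\<exists>Y. pasted M (Filt M P) Ha T t (\<lambda>\<omega>. Hs (Suc t) \<omega> + ereal (\<beta> t \<omega> * (A t \<omega> \<bullet> dPrel P t \<omega>))) Y
               \<and> (AE \<omega> in M. Hs t \<omega> = Y \<omega> - ereal (c t (A t \<omega>))))) \<and>
        (AE \<omega> in M. ereal R \<le> Hs 0 \<omega>))"

text \<open>Principal's terminal position W^A_T - (Theta + sum_t beta_t Delta W^A_{t+1}), with W_0 = 0.\<close>
definition prin_terminal :: "(nat \<Rightarrow> 'a \<Rightarrow> real^'n) \<Rightarrow> nat \<Rightarrow> ('a \<Rightarrow> real) \<Rightarrow> (nat \<Rightarrow> 'a \<Rightarrow> real)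
     \<Rightarrow> (nat \<Rightarrow> 'a \<Rightarrow> real^'n) \<Rightarrow> 'a \<Rightarrow> real" where
  "prin_terminal P T \<Theta> \<beta> A \<omega> =
     (\<Sum>t<T. A t \<omega> \<bullet> dPrel P t \<omega>) - (\<Theta> \<omega> + (\<Sum>t<T. \<beta> t \<omega> * (A t \<omega> \<bullet> dPrel P t \<omega>)))"

definition PA_solution :: "'a measure \<Rightarrow> (nat \<Rightarrow> 'a \<Rightarrow> real^'n) \<Rightarrow> nat \<Rightarrow> (nat \<Rightarrow> real \<Rightarrow> ereal)
     \<Rightarrow> (nat \<Rightarrow> real \<Rightarrow> ereal) \<Rightarrow> (nat \<Rightarrow> real^'n \<Rightarrow> real) \<Rightarrow> real \<Rightarrow> ('a \<Rightarrow> real) \<Rightarrow> (nat \<Rightarrow> 'a \<Rightarrow> real)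
     \<Rightarrow> (nat \<Rightarrow> 'a \<Rightarrow> real^'n) \<Rightarrow> bool" where
  "PA_solution M P T Ha Hp c R \<Theta> \<beta> A \<longleftrightarrow> admissible M P T Ha c R \<Theta> \<beta> A \<and>
     (\<forall>\<Theta>' \<beta>' A'. admissible M P T Ha c R \<Theta>' \<beta>' A' \<longrightarrow>
        (\<forall>Y Y'. pasted M (Filt M P) Hp T 0 (\<lambda>\<omega>. ereal (prin_terminal P T \<Theta> \<beta> A \<omega>)) Y \<longrightarrow>
                pasted M (Filt M P) Hp T 0 (\<lambda>\<omega>. ereal (prin_terminal P T \<Theta>' \<beta>' A' \<omega>)) Y' \<longrightarrow>
                (AE \<omega> in M. Y' \<omega> \<le> Y \<omega>)))"

end

theory Submission
  imports Defs
begin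

text \<open>
  Write \<open>X\<close> for the part of the position that the Agent keeps when \<open>\<beta> = 1\<close>, so that \<open>\<Gamma> = X + A \<Delta>P\<close>. The
  Principal's one-step objective becomes \<open>U\<^sup>a(X + A \<Delta>P) - c(A) + U\<^sup>p(h - X)\<close>, and the incentive
  constraint says that \<open>A\<close> maximises it for fixed \<open>X\<close>. An unconstrained maximiser is therefore
  automatically incentive compatible, and no contract with another \<open>\<beta>\<close> can do better.

  With the levels \<open>s\<close> of the two certainty equivalents as additional variables, maximisation is the
  minimisation of the expectation of the pointwise convex cost
  \<open>c(A) - s + H\<^sup>a(r) + H\<^sup>p(s - h - A \<Delta>P - r)\<close>
  over \<open>F t\<close>-measurable \<open>s, A\<close> and \<open>F (t+1)\<close>-measurable \<open>r\<close>, with \<open>\<Gamma> = - r\<close>. Interiority of 1 in the domains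
  of the conjugates and superlinearity of \<open>c\<close> make this cost coercive in \<open>(s, A)\<close>. In \<open>r\<close>, clipping to the
  interval between a fixed point \<open>xa\<close> of \<open>H\<^sup>a\<close> and the point where the argument of \<open>H\<^sup>p\<close> is a fixed point of
  \<open>H\<^sup>p\<close> never increases the cost. So bounded strategies suffice, and a minimiser exists among them by a
  Hilbert space argument.

  Since the one-step bound allows an additional \<open>F t\<close>-measurable cash amount, it compares the sum of the
  Agent's and the Principal's values under an arbitrary admissible contract with the optimal value, by
  backward induction.
\<close>

subsection \<open>Loss functions\<close>

text \<open>The obstacle is that each certainty equivalent is an essential supremum over
  deterministic levels, extended by a double truncation limit, whereas the contract variables are
  random and unbounded. The proof therefore never computes a certainty equivalent; it uses
  inequalities of two kinds. Lower bounds come from exhibiting one, possibly random, level for a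
  bounded position. Upper bounds come from a single joint inequality for the sum of the two
  certainty equivalents, obtained by comparison with the minimal conditional cost. The two kinds
  meet at the minimiser. Only the sum of the two levels enters the cost, since cash moved from one
  party to the other changes their levels by opposite amounts; hence the single variable
  \<open>s\<close>, with the Agent's level normalised to 0. Boundedness of the minimiser matters
  twice: it lets the lower bounds survive truncation, and it keeps the value \<open>h t\<close>
  bounded, which is what the same step requires one period earlier. As cash passes between the
  parties without loss, granting the Agent the level \<open>R\<close> costs the Principal exactly
  \<open>R\<close>.\<close>

locale coercive_loss =
  fixes H :: "real \<Rightarrow> ereal"
  assumes OCE: "OCE_loss H"
    and dom: "1 \<in> interior {x. conjugate H x < \<infinity>}"
    and bdd: "\<exists>b. \<forall>s. ereal b \<le> H s"
begin

lemma not_MInf: "H s \<noteq> -\<infinity>"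
  using OCE unfolding OCE_loss_def by blast

lemma mono_H: "x \<le> y \<Longrightarrow> H x \<le> H y"
  using OCE unfolding OCE_loss_def by (auto dest: monoD)

lemma convex_H: "0 \<le> u \<Longrightarrow> u \<le> 1 \<Longrightarrow> H (u * x + (1 - u) * y) \<le> ereal u * H x + ereal (1 - u) * H y"
  using OCE unfolding OCE_loss_def ereal_convex_def by blast

lemma closed_sublevel: "closed {x. H x \<le> a}"
  using OCE unfolding OCE_loss_def ereal_lsc_def by blast

lemma measurable_H [measurable]: "H \<in> borel_measurable borel"
  unfolding borel_measurable_iff_Iic_ereal
proof
  fix a
  have "H -` {..a} = {x. H x \<le> a}" by auto
  then show "H -` {..a} \<inter> space borel \<in> sets borel"
    using closed_sublevel[of a] by (simp add: borel_closed)
qed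

lemma lsc_sequentially:
  assumes "X \<longlonglongrightarrow> x"
  shows "H x \<le> liminf (\<lambda>n. H (X n))"
  unfolding le_Liminf_iff
proof (intro allI impI)
  fix y assume "y < H x"
  then have "x \<in> - {x. H x \<le> y}" by auto
  moreover have "open (- {x. H x \<le> y})" using closed_sublevel by (simp add: open_Compl)
  ultimately have "\<forall>\<^sub>F n in sequentially. X n \<in> - {x. H x \<le> y}"
    using assms topological_tendstoD by blast
  then show "\<forall>\<^sub>F n in sequentially. y < H (X n)" by eventually_elim auto
qed

lemma conjugate_one: "conjugate H 1 = 0"
  using OCE unfolding OCE_loss_def by blast

text \<open>The Fenchel-Young inequality at slope 1, where the conjugate is normalised to 0.\<close>

lemma ge_self: "ereal x \<le> H x"
proof -
  have "ereal (1 * x) - H x \<le> 0"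
    unfolding conjugate_one[symmetric] conjugate_def by (rule SUP_upper) auto
  then show ?thesis by (cases "H x") auto
qed

lemma conjugate_bound:
  assumes "conjugate H y < \<infinity>"
  obtains C where "\<And>x. ereal (y * x - C) \<le> H x"
proof -
  obtain n :: nat where n: "conjugate H y < ereal (real n)"
    using assms less_PInf_Ex_of_nat by auto
  have "ereal (y * x - real n) \<le> H x" for x
  proof -
    have "ereal (y * x) - H x \<le> conjugate H y"
      unfolding conjugate_def by (rule SUP_upper) auto
    with n have "ereal (y * x) - H x \<le> ereal (real n)" by order
    then show ?thesis using not_MInf[of x] by (cases "H x") auto
  qed
  then show thesis by (rule that)
qed

text \<open>Since 1 is interior to the domain of the conjugate, there are affine minorants of slopes
  1 + e and 1 - e. The steeper one serves x \<ge> 0 and the flatter one x < 0, so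
  \<open>H x - x\<close> grows linearly in both directions.\<close>

lemma growth:
  obtains e C where "0 < e" "\<And>x. ereal (x + e * \<bar>x\<bar> - C) \<le> H x"
proof -
  obtain r where r: "0 < r" "ball 1 r \<subseteq> {x. conjugate H x < \<infinity>}"
    using dom unfolding mem_interior by auto
  define e where "e = r / 2"
  have "1 + e \<in> ball 1 r" "1 - e \<in> ball 1 r" using r by (auto simp: e_def dist_real_def)
  then obtain C1 C2 where C: "\<And>x. ereal ((1 + e) * x - C1) \<le> H x" "\<And>x. ereal ((1 - e) * x - C2) \<le> H x"
    using conjugate_bound r(2) by (metis mem_Collect_eq subsetD)
  have "ereal (x + e * \<bar>x\<bar> - max C1 C2) \<le> H x" for x
  proof (cases "0 \<le> x")
    case True
    then have "x + e * \<bar>x\<bar> - max C1 C2 \<le> (1 + e) * x - C1" by (simp add: algebra_simps)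
    then show ?thesis using C(1)[of x] by (meson ereal_less_eq(3) order_trans)
  next
    case False
    then have "x + e * \<bar>x\<bar> - max C1 C2 \<le> (1 - e) * x - C2" by (simp add: algebra_simps)
    then show ?thesis using C(2)[of x] by (meson ereal_less_eq(3) order_trans)
  qed
  moreover have "0 < e" using r by (simp add: e_def)
  ultimately show thesis using that by blast
qed

text \<open>By \<open>ge_self\<close>, \<open>H x - x\<close> is nonnegative; it is coercive because 1 is interior to the domain of
  the conjugate, so its infimum 0 is attained.\<close>

lemma fixed_point: obtains x0 where "H x0 = ereal x0"
proof -
  obtain e C where eC: "0 < e" "\<And>x. ereal (x + e * \<bar>x\<bar> - C) \<le> H x" using growth by blast
  have "\<exists>x. H x \<le> ereal (x + 1 / Suc n)" for n
  proof -
    have "ereal (- 1 / Suc n) < conjugate H 1" unfolding conjugate_one by simp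
    then obtain x where "ereal (- 1 / Suc n) < ereal (1 * x) - H x"
      unfolding conjugate_def less_SUP_iff by auto
    then show ?thesis by (cases "H x") (auto intro!: exI[of _ x])
  qed
  then obtain X where X: "\<And>n. H (X n) \<le> ereal (X n + 1 / Suc n)" by metis
  have "\<bar>X n\<bar> \<le> (C + 1) / e" for n
  proof -
    have "ereal (X n + e * \<bar>X n\<bar> - C) \<le> ereal (X n + 1 / Suc n)"
      using X[of n] eC(2)[of "X n"] by order
    then have "e * \<bar>X n\<bar> \<le> C + 1 / Suc n" by simp
    also have "\<dots> \<le> C + 1" by simp
    finally show ?thesis using eC(1) by (simp add: field_simps)
  qed
  then have "\<forall>n. X n \<in> cball 0 ((C + 1) / e)" by simp
  then obtain x0 r where r: "strict_mono r" "(X \<circ> r) \<longlonglongrightarrow> x0"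
    using compact_cball[unfolded compact_def] by metis
  have "(\<lambda>n. 1 / real (Suc (r n))) \<longlonglongrightarrow> 0"
    using LIMSEQ_subseq_LIMSEQ[OF LIMSEQ_inverse_real_of_nat r(1)] by (simp add: o_def inverse_eq_divide)
  then have "(\<lambda>n. X (r n) + 1 / real (Suc (r n))) \<longlonglongrightarrow> x0 + 0"
    using r(2) by (intro tendsto_add) (auto simp: o_def)
  then have "liminf (\<lambda>n. ereal (X (r n) + 1 / real (Suc (r n)))) = ereal x0"
    by (intro lim_imp_Liminf) auto
  moreover have "liminf (\<lambda>n. H ((X \<circ> r) n)) \<le> liminf (\<lambda>n. ereal (X (r n) + 1 / real (Suc (r n))))"
    using X by (intro Liminf_mono) (auto simp: o_def)
  ultimately have "H x0 \<le> ereal x0" using lsc_sequentially[OF r(2)] by simp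
  then have "H x0 = ereal x0" using ge_self[of x0] by order
  then show thesis by (rule that)
qed

text \<open>\<open>H x - x\<close> is convex and minimal at a fixed point, hence monotone on either side of it.\<close>

lemma towards_fixed_point:
  assumes x0: "H x0 = ereal x0" and x: "x0 \<le> x \<and> x \<le> y \<or> y \<le> x \<and> x \<le> x0"
  shows "H x \<le> H y + ereal (x - y)"
proof (cases "H y")
  case (real hy)
  have hy: "y \<le> hy" using ge_self[of y] real by simp
  show ?thesis
  proof (cases "y = x0")
    case True then show ?thesis using x x0 by auto
  next
    case False
    \<comment> \<open>\<open>u\<close> is the weight of \<open>x0\<close> when \<open>x\<close> is
      written as a convex combination of \<open>x0\<close> and \<open>y\<close>. Since
      \<open>y \<le> hy\<close> by \<open>ge_self\<close>, the slope \<open>x0 - hy\<close> from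
      convexity may be replaced by \<open>x0 - y\<close>.\<close>
    define u where "u = (x - y) / (x0 - y)"
    have u: "0 \<le> u" "u \<le> 1" using x False by (auto simp: u_def divide_simps)
    have xy: "x - y = u * (x0 - y)" using False by (simp add: u_def)
    then have "x = u * x0 + (1 - u) * y" by (simp add: algebra_simps)
    then have "H x \<le> ereal u * H x0 + ereal (1 - u) * H y" using convex_H[OF u, of x0 y] by simp
    also have "\<dots> = ereal (hy + u * (x0 - hy))" using x0 real by (simp add: algebra_simps)
    also have "\<dots> \<le> ereal (hy + (x - y))" unfolding xy using u hy by (simp add: mult_left_mono)
    finally show ?thesis using real by simp
  qed
qed (use not_MInf in auto)

end

subsection \<open>Conditional expectations\<close>

context finite_measure_subalgebra
begin

lemma sets_F_sets [measurable_dest]: "E \<in> sets F \<Longrightarrow> E \<in> sets M"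
  using subalg unfolding subalgebra_def by blast

lemma measurable_F_M: "f \<in> borel_measurable F \<Longrightarrow> f \<in> borel_measurable M"
  using measurable_from_subalg[OF subalg] .

lemma space_F: "space F = space M"
  using subalg unfolding subalgebra_def by blast

text \<open>Multiplication by the indicator of an \<open>F\<close>-set commutes with conditioning,
  so comparisons can be localised to such sets. This is what later makes random levels accessible
  through constant ones.\<close>

lemma nn_cond_exp_mono_on:
  assumes E: "E \<in> sets F" and le: "AE w in M. w \<in> E \<longrightarrow> f w \<le> g w"
    and f [measurable]: "f \<in> borel_measurable M" and g [measurable]: "g \<in> borel_measurable M"
  shows "AE w in M. w \<in> E \<longrightarrow> nn_cond_exp M F f w \<le> nn_cond_exp M F g w"
proof -
  have E' [measurable]: "E \<in> sets M" using sets_F_sets[OF E] .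
  have "AE w in M. indicator E w * f w \<le> indicator E w * g w"
    using le by eventually_elim (auto simp: indicator_def)
  then have "AE w in M. nn_cond_exp M F (\<lambda>w. indicator E w * f w) w \<le> nn_cond_exp M F (\<lambda>w. indicator E w * g w) w"
    by (rule nn_cond_exp_mono) auto
  moreover have "AE w in M. indicator E w * nn_cond_exp M F f w = nn_cond_exp M F (\<lambda>w. indicator E w * f w) w"
    by (rule nn_cond_exp_prod) (use E in auto)
  moreover have "AE w in M. indicator E w * nn_cond_exp M F g w = nn_cond_exp M F (\<lambda>w. indicator E w * g w) w"
    by (rule nn_cond_exp_prod) (use E in auto)
  ultimately show ?thesis by eventually_elim (auto simp: indicator_def)
qed

lemma measurable_ecexp [measurable]: "ecexp M F f \<in> borel_measurable F"
proof -
  have "(\<lambda>w. enn2ereal (nn_cond_exp M F (\<lambda>x. e2ennreal (f x)) w)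
     - enn2ereal (nn_cond_exp M F (\<lambda>x. e2ennreal (- f x)) w)) \<in> borel_measurable F"
    by measurable
  then show ?thesis unfolding ecexp_def[abs_def] .
qed

lemma ecexp_mono_on:
  assumes E: "E \<in> sets F" and le: "AE w in M. w \<in> E \<longrightarrow> f w \<le> g w"
    and f [measurable]: "f \<in> borel_measurable M" and g [measurable]: "g \<in> borel_measurable M"
  shows "AE w in M. w \<in> E \<longrightarrow> ecexp M F f w \<le> ecexp M F g w"
proof -
  have "AE w in M. w \<in> E \<longrightarrow> nn_cond_exp M F (\<lambda>x. e2ennreal (f x)) w \<le> nn_cond_exp M F (\<lambda>x. e2ennreal (g x)) w"
    by (rule nn_cond_exp_mono_on[OF E]) (use le in \<open>auto elim!: eventually_mono intro: e2ennreal_mono\<close>)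
  moreover have "AE w in M. w \<in> E \<longrightarrow> nn_cond_exp M F (\<lambda>x. e2ennreal (- g x)) w \<le> nn_cond_exp M F (\<lambda>x. e2ennreal (- f x)) w"
    by (rule nn_cond_exp_mono_on[OF E]) (use le in \<open>auto elim!: eventually_mono intro: e2ennreal_mono\<close>)
  ultimately show ?thesis
    unfolding ecexp_def by eventually_elim (auto intro!: ereal_minus_mono simp: less_eq_ennreal.rep_eq)
qed

lemma ecexp_mono:
  assumes "AE w in M. f w \<le> g w" "f \<in> borel_measurable M" "g \<in> borel_measurable M"
  shows "AE w in M. ecexp M F f w \<le> ecexp M F g w"
  using ecexp_mono_on[of "space M" f g] assms sets.top[of F] by (auto simp: space_F)

lemma ecexp_F_meas:
  assumes [measurable]: "f \<in> borel_measurable F"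
  shows "AE w in M. ecexp M F f w = f w"
proof -
  have "AE w in M. e2ennreal (f w) = nn_cond_exp M F (\<lambda>x. e2ennreal (f x)) w"
    by (rule nn_cond_exp_F_meas) measurable
  moreover have "AE w in M. e2ennreal (- f w) = nn_cond_exp M F (\<lambda>x. e2ennreal (- f x)) w"
    by (rule nn_cond_exp_F_meas) measurable
  ultimately show ?thesis
  proof eventually_elim
    case (elim w)
    have "enn2ereal (e2ennreal (f w)) - enn2ereal (e2ennreal (- f w)) = f w"
      by (cases "0 \<le> f w") (auto simp: enn2ereal_e2ennreal e2ennreal_neg zero_ennreal.rep_eq)
    then show ?case unfolding ecexp_def elim[symmetric] .
  qed
qed

text \<open>For a variable bounded below the difference in \<open>ecexp\<close> is harmless, because
  its negative part has a finite conditional expectation. The variable can then be handled as a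
  nonnegative one, for which additivity holds even with infinite values.\<close>

lemma ecexp_shift:
  assumes f [measurable]: "f \<in> borel_measurable M" and b: "b \<le> 0" "\<And>w. ereal b \<le> f w"
  shows "AE w in M. ecexp M F f w = enn2ereal (nn_cond_exp M F (\<lambda>x. e2ennreal (f x - ereal b)) w) + ereal b"
proof -
  let ?N = "nn_cond_exp M F"
  \<comment> \<open>A subtraction-free form of \<open>f = (f - b) + b\<close>: both sides contain
    nonnegative terms only, so conditional expectations in \<open>ennreal\<close> can be added on
    each side.\<close>
  have eq: "e2ennreal (f x) + ennreal (- b) = e2ennreal (f x - ereal b) + e2ennreal (- f x)" for x
  proof (cases "f x")
    case (real r)
    then show ?thesis using b(1) b(2)[of x]
      by (cases "0 \<le> r") (auto simp: ennreal_plus[symmetric] ennreal_neg simp del: ennreal_plus)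
  next
    case MInf then show ?thesis using b(2)[of x] by auto
  qed (auto simp: e2ennreal_neg)
  have "AE w in M. ?N (\<lambda>x. e2ennreal (f x)) w + ?N (\<lambda>x. ennreal (- b)) w = ?N (\<lambda>x. e2ennreal (f x) + ennreal (- b)) w"
    by (rule nn_cond_exp_sum) auto
  moreover have "AE w in M. ?N (\<lambda>x. e2ennreal (f x - ereal b)) w + ?N (\<lambda>x. e2ennreal (- f x)) w = ?N (\<lambda>x. e2ennreal (f x) + ennreal (- b)) w"
    unfolding eq by (rule nn_cond_exp_sum) auto
  moreover have "AE w in M. ennreal (- b) = ?N (\<lambda>x. ennreal (- b)) w"
    by (rule nn_cond_exp_F_meas) auto
  moreover have "AE w in M. ?N (\<lambda>x. e2ennreal (- f x)) w \<le> ?N (\<lambda>x. ennreal (- b)) w"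
  proof (rule nn_cond_exp_mono)
    show "AE x in M. e2ennreal (- f x) \<le> ennreal (- b)"
    proof (rule AE_I2)
      fix x
      have "- f x \<le> ereal (- b)" using b(2)[of x] by (cases "f x") auto
      then show "e2ennreal (- f x) \<le> ennreal (- b)" using e2ennreal_mono by fastforce
    qed
  qed auto
  ultimately show ?thesis
  proof eventually_elim
    case (elim w)
    define p n q where "p = ?N (\<lambda>x. e2ennreal (f x)) w" and "n = ?N (\<lambda>x. e2ennreal (- f x)) w"
      and "q = ?N (\<lambda>x. e2ennreal (f x - ereal b)) w"
    have 1: "p + ennreal (- b) = q + n" and 2: "n \<le> ennreal (- b)"
      using elim unfolding p_def n_def q_def by auto
    have "enn2ereal p - enn2ereal n = enn2ereal q + ereal b"
    proof (cases "p = top")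
      case True
      then have "q = top" using 1 2 by (metis ennreal_add_eq_top ennreal_neq_top neq_top_trans)
      then show ?thesis using True 2 by (cases n) (auto simp: top_unique)
    next
      case False
      then obtain p' where p: "p = ennreal p'" "0 \<le> p'" by (cases p) auto
      obtain n' where n: "n = ennreal n'" "0 \<le> n'" using 2 by (cases n) (auto simp: top_unique)
      have "q \<noteq> top" using 1 p b(1) by (metis ennreal_add_eq_top ennreal_neq_top)
      then obtain q' where q: "q = ennreal q'" "0 \<le> q'" by (cases q) auto
      have "p' + - b = q' + n'" using 1 b(1) p n q
        by (metis ennreal_inj ennreal_plus add_nonneg_nonneg neg_0_le_iff_le)
      then show ?thesis using p n q by simp
    qed
    then show ?case unfolding ecexp_def p_def n_def q_def .
  qed
qed

end

subsection \<open>Certainty equivalents\<close>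

definition trunc :: "nat \<Rightarrow> nat \<Rightarrow> ereal \<Rightarrow> real" where
  "trunc n k x = real_of_ereal (max (min x (ereal (real n))) (ereal (- real k)))"

lemma ereal_trunc: "ereal (trunc n k x) = max (min x (ereal (real n))) (ereal (- real k))"
  unfolding trunc_def by (cases x) (auto simp: max_def min_def)

lemma measurable_trunc [measurable]: "trunc n k \<in> borel_measurable borel"
  unfolding trunc_def[abs_def] by measurable

lemma trunc_le: "ereal (trunc n k x) \<le> max x 0"
  unfolding ereal_trunc by (intro max.mono) auto

lemma tendsto_trunc_lower: "(\<lambda>k. ereal (trunc n k x)) \<longlonglongrightarrow> min x (ereal (real n))"
proof -
  have "(\<lambda>k. ereal (- real k)) \<longlonglongrightarrow> -\<infinity>"
    using tendsto_uminus_ereal[OF id_nat_ereal_tendsto_PInf] by simp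
  then have "(\<lambda>k. max (min x (ereal (real n))) (ereal (- real k))) \<longlonglongrightarrow> max (min x (ereal (real n))) (-\<infinity>)"
    by (intro tendsto_max tendsto_const)
  then show ?thesis unfolding ereal_trunc by (simp add: max_def)
qed

lemma tendsto_trunc_upper: "(\<lambda>n. min x (ereal (real n))) \<longlonglongrightarrow> x"
proof -
  have "(\<lambda>n. min x (ereal (real n))) \<longlonglongrightarrow> min x \<infinity>"
    by (intro tendsto_min tendsto_const) (simp add: id_nat_ereal_tendsto_PInf)
  then show ?thesis by (simp add: min_def)
qed

lemma oce_alt:
  "oce M F H X Y \<longleftrightarrow> Y \<in> borel_measurable F \<and>
     (\<exists>Yd :: nat \<Rightarrow> nat \<Rightarrow> 'a \<Rightarrow> ereal. \<exists>Z :: nat \<Rightarrow> 'a \<Rightarrow> ereal.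
        (\<forall>n k. oce1 M F H (\<lambda>w. trunc n k (X w)) (Yd n k))
      \<and> (\<forall>n. AE w in M. (\<lambda>k. Yd n k w) \<longlonglongrightarrow> Z n w)
      \<and> (AE w in M. (\<lambda>n. Z n w) \<longlonglongrightarrow> Y w))"
  unfolding oce_def trunc_def ..

locale one_step_oce = prob_space M + coercive_loss H for M :: "'a measure" and H +
  fixes F :: "'a measure"
  assumes subalg: "subalgebra M F"
begin

sublocale finite_measure_subalgebra M F
  by unfold_locales (rule subalg)

definition payoff :: "real \<Rightarrow> ('a \<Rightarrow> real) \<Rightarrow> 'a \<Rightarrow> ereal" where
  "payoff s X = (\<lambda>w. ereal s - ecexp M F (\<lambda>w'. H (s - X w')) w)"

lemma measurable_payoff [measurable]: "payoff s X \<in> borel_measurable F"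
  unfolding payoff_def by measurable

lemma oce1_alt: "oce1 M F H X Y \<longleftrightarrow> Y \<in> borel_measurable F \<and> (\<forall>s. AE w in M. payoff s X w \<le> Y w)
     \<and> (\<forall>Z\<in>borel_measurable F. (\<forall>s. AE w in M. payoff s X w \<le> Z w) \<longrightarrow> (AE w in M. Y w \<le> Z w))"
  unfolding oce1_def is_ess_sup_def payoff_def by auto

text \<open>Essential suprema are local: a bound known only on \<open>E\<close> becomes a global one
  when it is set to \<infinity> off \<open>E\<close>, and it stays
  \<open>F\<close>-measurable.\<close>

lemma oce1_le_on:
  assumes Y: "oce1 M F H X Y" and E [measurable]: "E \<in> sets F" and Z [measurable]: "Z \<in> borel_measurable F"
    and le: "\<And>s. AE w in M. w \<in> E \<longrightarrow> payoff s X w \<le> Z w"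
  shows "AE w in M. w \<in> E \<longrightarrow> Y w \<le> Z w"
proof -
  define Z' where "Z' = (\<lambda>w. if w \<in> E then Z w else \<infinity>)"
  have "Z' \<in> borel_measurable F" unfolding Z'_def by measurable
  moreover have "AE w in M. payoff s X w \<le> Z' w" for s
    using le[of s] by eventually_elim (simp add: Z'_def)
  ultimately have "AE w in M. Y w \<le> Z' w" using Y unfolding oce1_alt by blast
  then show ?thesis by eventually_elim (auto simp: Z'_def split: if_splits)
qed

lemma oce1_le:
  assumes "oce1 M F H X Y" "Z \<in> borel_measurable F" "\<And>s. AE w in M. payoff s X w \<le> Z w"
  shows "AE w in M. Y w \<le> Z w"
  using assms unfolding oce1_alt by blast

text \<open>Inequalities that hold almost everywhere for each level can be collected for countably
  many levels only; with \<open>e\<close> fixed, the rational levels below \<open>s\<close>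
  suffice.\<close>

lemma le_minus_dense:
  fixes e Y :: ereal and s :: real
  assumes "\<And>q. q \<in> \<rat> \<Longrightarrow> q \<le> s \<Longrightarrow> ereal q - e \<le> Y"
  shows "ereal s - e \<le> Y"
proof (cases e)
  case (real r)
  have "Y \<ge> ereal (s - r)"
  proof (rule dense_le)
    fix y assume "y < ereal (s - r)"
    show "y \<le> Y"
    proof (cases y)
      case (real y')
      then have "y' + r < s" using \<open>y < ereal (s - r)\<close> by simp
      then obtain q where q: "q \<in> \<rat>" "y' + r < q" "q < s" using Rats_dense_in_real by blast
      have "ereal q - e \<le> Y" using assms q by simp
      moreover have "y \<le> ereal q - e" using q \<open>e = ereal r\<close> real by simp
      ultimately show ?thesis by order
    qed (use \<open>y < ereal (s - r)\<close> in auto)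
  qed
  then show ?thesis using real by simp
next
  case MInf
  obtain q where "q \<in> \<rat>" "q < s" using Rats_no_bot_less by blast
  then show ?thesis using assms[of q] MInf by simp
qed simp

text \<open>The definition only has deterministic levels. A random level is approximated from below by rational
  ones, by locality of the conditional expectation and monotonicity of the loss function.\<close>

lemma oce1_ge:
  assumes Y: "oce1 M F H X Y" and X [measurable]: "X \<in> borel_measurable M"
    and L [measurable]: "L \<in> borel_measurable M" and s: "s \<in> borel_measurable F"
    and le: "AE w in M. L w \<le> X w"
  shows "AE w in M. ereal (s w) - ecexp M F (\<lambda>w'. H (s w' - L w')) w \<le> Y w"
proof -
  note s [measurable]
  have sM [measurable]: "s \<in> borel_measurable M" using measurable_F_M[OF s] .
  have "AE w in M. q \<le> s w \<longrightarrow> ereal q - ecexp M F (\<lambda>w'. H (s w' - L w')) w \<le> Y w" for q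
  proof -
    let ?E = "{w \<in> space F. q \<le> s w}"
    have "AE w in M. w \<in> ?E \<longrightarrow> ecexp M F (\<lambda>w'. H (q - X w')) w \<le> ecexp M F (\<lambda>w'. H (s w' - L w')) w"
    proof (rule ecexp_mono_on)
      show "?E \<in> sets F" by measurable
      show "AE w in M. w \<in> ?E \<longrightarrow> H (q - X w) \<le> H (s w - L w)"
        using le by eventually_elim (auto intro!: mono_H)
    qed measurable
    moreover have "AE w in M. payoff q X w \<le> Y w" using Y unfolding oce1_alt by blast
    ultimately show ?thesis using AE_space
    proof eventually_elim
      case (elim w)
      show ?case
      proof
        assume "q \<le> s w"
        then have "ereal q - ecexp M F (\<lambda>w'. H (s w' - L w')) w \<le> payoff q X w"
          unfolding payoff_def using elim by (intro ereal_minus_mono) (auto simp: space_F)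
        also note elim(2)
        finally show "ereal q - ecexp M F (\<lambda>w'. H (s w' - L w')) w \<le> Y w" .
      qed
    qed
  qed
  then have "AE w in M. \<forall>q\<in>\<rat>. q \<le> s w \<longrightarrow> ereal q - ecexp M F (\<lambda>w'. H (s w' - L w')) w \<le> Y w"
    by (subst AE_ball_countable) (auto simp: countable_rat)
  then show ?thesis by eventually_elim (auto intro: le_minus_dense)
qed

text \<open>As \<open>L\<close> is bounded, all sufficiently wide truncations of \<open>X\<close>
  still lie above \<open>L\<close>. The one-step estimate therefore holds for them with the same
  left-hand side and passes through both limits.\<close>

lemma oce_ge:
  assumes Y: "oce M F H X Y" and X [measurable]: "X \<in> borel_measurable M"
    and L [measurable]: "L \<in> borel_measurable M" and s: "s \<in> borel_measurable F"
    and le: "AE w in M. ereal (L w) \<le> X w" and bd: "AE w in M. \<bar>L w\<bar> \<le> l"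
  shows "AE w in M. ereal (s w) - ecexp M F (\<lambda>w'. H (s w' - L w')) w \<le> Y w"
proof -
  obtain Yd Z where Yd: "\<And>n k. oce1 M F H (\<lambda>w. trunc n k (X w)) (Yd n k)"
    and Z: "\<And>n. AE w in M. (\<lambda>k. Yd n k w) \<longlonglongrightarrow> Z n w" and Y: "AE w in M. (\<lambda>n. Z n w) \<longlonglongrightarrow> Y w"
    using Y unfolding oce_alt by blast
  define W where "W = (\<lambda>w. ereal (s w) - ecexp M F (\<lambda>w'. H (s w' - L w')) w)"
  have "AE w in M. l \<le> real n \<longrightarrow> l \<le> real k \<longrightarrow> W w \<le> Yd n k w" for n k
  proof (cases "l \<le> real n \<and> l \<le> real k")
    case True
    have "AE w in M. L w \<le> trunc n k (X w)" using le bd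
    proof eventually_elim
      case (elim w)
      then have "ereal (L w) \<le> max (min (X w) (ereal (real n))) (ereal (- real k))"
        using True by (auto simp: le_max_iff_disj)
      then show ?case unfolding ereal_trunc[symmetric] by simp
    qed
    then have "AE w in M. W w \<le> Yd n k w" unfolding W_def using s by (intro oce1_ge[OF Yd]) auto
    then show ?thesis by eventually_elim auto
  qed auto
  then have "AE w in M. \<forall>n k. l \<le> real n \<longrightarrow> l \<le> real k \<longrightarrow> W w \<le> Yd n k w"
    by (simp add: AE_all_countable)
  moreover have "AE w in M. \<forall>n. (\<lambda>k. Yd n k w) \<longlonglongrightarrow> Z n w" using Z by (simp add: AE_all_countable)
  ultimately have "AE w in M. W w \<le> Y w" using Y
  proof eventually_elim
    case (elim w)
    obtain N :: nat where N: "l \<le> real N" using real_arch_simple by blast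
    have "W w \<le> Z n w" if "n \<ge> N" for n
      using elim(2)[rule_format, of n]
      by (rule LIMSEQ_le_const) (use elim(1) N that in \<open>auto intro!: exI[of _ N]\<close>)
    then show "W w \<le> Y w" by (intro LIMSEQ_le_const[OF elim(3)]) auto
  qed
  then show ?thesis unfolding W_def .
qed

lemma loss_bound: obtains b where "b \<le> 0" "\<And>x. ereal b \<le> H x"
proof -
  obtain b where "\<And>x. ereal b \<le> H x" using bdd by blast
  then have "\<And>x. ereal (min b 0) \<le> H x" by (meson ereal_less_eq(3) min.cobounded1 order_trans)
  then show thesis using that by (meson min.cobounded2)
qed

text \<open>A bound that does not depend on the level \<open>s\<close>: the loss grows with slope
  \<open>1 + e\<close> on an event of conditional probability at least \<open>1 / (1 + e)\<close>,
  so the expected loss absorbs \<open>s\<close> completely. Elsewhere the lower bound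
  \<open>b\<close> of the loss is enough.\<close>

lemma payoff_le_on:
  assumes X [measurable]: "X \<in> borel_measurable M" and le: "AE w in M. ereal (X w) \<le> max (W w) 0"
    and W [measurable]: "W \<in> borel_measurable M"
    and b: "b \<le> 0" "\<And>x. ereal b \<le> H x" and e: "0 < e" "\<And>x. ereal ((1 + e) * x - C) \<le> H x" and k: "0 \<le> k"
  shows "AE w in M. ennreal (1 / (1 + e)) \<le> nn_cond_exp M F (indicator {w \<in> space M. W w \<le> ereal k}) w
           \<longrightarrow> payoff s X w \<le> ereal (k - b + (C + b) / (1 + e))"
proof -
  define D where "D = {w \<in> space M. W w \<le> ereal k}"
  have D [measurable]: "D \<in> sets M" unfolding D_def by measurable
  \<comment> \<open>The value of the growth bound at \<open>s - k\<close>, raised by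
    \<open>- b\<close> so that it is compared with the nonnegative variable
    \<open>H (s - X w) - b\<close>.\<close>
  define v where "v = (1 + e) * (s - k) - C - b"
  have cancel: "x + ereal b - ereal b = x" for x by (cases x) auto
  have "AE w in M. ecexp M F (\<lambda>w'. H (s - X w')) w
        = enn2ereal (nn_cond_exp M F (\<lambda>x. e2ennreal (H (s - X x) - ereal b)) w) + ereal b"
    by (rule ecexp_shift) (use b in auto)
  moreover have "AE w in M. nn_cond_exp M F (\<lambda>w. ennreal v * indicator D w) w \<le> nn_cond_exp M F (\<lambda>x. e2ennreal (H (s - X x) - ereal b)) w"
  proof (rule nn_cond_exp_mono)
    show "AE w in M. ennreal v * indicator D w \<le> e2ennreal (H (s - X w) - ereal b)"
      using le
    proof eventually_elim
      case (elim w)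
      show ?case
      proof (cases "w \<in> D")
        case True
        then have "W w \<le> ereal k" by (simp add: D_def)
        then have "max (W w) 0 \<le> ereal k" using k by simp
        then have "ereal (X w) \<le> ereal k" using elim by order
        then have "(1 + e) * (s - k) - C \<le> (1 + e) * (s - X w) - C" using e(1) by (simp add: mult_left_mono)
        then have "ereal ((1 + e) * (s - k) - C) \<le> H (s - X w)"
          using e(2)[of "s - X w"] by (meson ereal_less_eq(3) order_trans)
        then have "ereal v \<le> H (s - X w) - ereal b" unfolding v_def
          by (cases "H (s - X w)") auto
        then show ?thesis using True e2ennreal_mono by fastforce
      qed auto
    qed
  qed auto
  moreover have "AE w in M. ennreal v * nn_cond_exp M F (indicator D) w = nn_cond_exp M F (\<lambda>w. ennreal v * indicator D w) w"
    by (rule nn_cond_exp_prod) auto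
  ultimately show ?thesis unfolding D_def[symmetric]
  proof eventually_elim
    case (elim w)
    show ?case
    proof
      assume p: "ennreal (1 / (1 + e)) \<le> nn_cond_exp M F (indicator D) w"
      have "ennreal (v / (1 + e)) = ennreal v * ennreal (1 / (1 + e))"
        using e(1) by (cases "0 \<le> v") (auto simp: ennreal_mult[symmetric] ennreal_neg divide_nonpos_pos)
      also have "\<dots> \<le> ennreal v * nn_cond_exp M F (indicator D) w" by (rule mult_left_mono[OF p]) simp
      also have "\<dots> \<le> nn_cond_exp M F (\<lambda>x. e2ennreal (H (s - X x) - ereal b)) w" using elim by simp
      finally have "enn2ereal (ennreal (v / (1 + e))) \<le> ecexp M F (\<lambda>w'. H (s - X w')) w - ereal b"
        unfolding elim(1) cancel by (simp add: less_eq_ennreal.rep_eq)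
      moreover have "ereal (v / (1 + e)) \<le> enn2ereal (ennreal (v / (1 + e)))"
        by (cases "0 \<le> v / (1 + e)") (auto simp: ennreal_neg zero_ennreal.rep_eq)
      ultimately have "ereal (v / (1 + e)) \<le> ecexp M F (\<lambda>w'. H (s - X w')) w - ereal b" by order
      moreover have "v / (1 + e) = s - k - (C + b) / (1 + e)"
        using e(1) by (simp add: v_def field_simps)
      ultimately show "payoff s X w \<le> ereal (k - b + (C + b) / (1 + e))"
        unfolding payoff_def by (cases "ecexp M F (\<lambda>w'. H (s - X w')) w") auto
    qed
  qed
qed

text \<open>The events {W \<le> k} increase to an event of full measure. If all their conditional
  probabilities stayed below \<open>c\<close> on an \<open>F\<close>-set \<open>N\<close>, the limit
  would give \<open>measure M N \<le> c * measure M N\<close>, so \<open>N\<close> is null.\<close>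

lemma cond_prob_eventually_large:
  assumes W [measurable]: "W \<in> borel_measurable M" and fin: "AE w in M. W w < (\<infinity>::ereal)" and c: "0 \<le> c" "c < 1"
  shows "AE w in M. \<exists>k::nat. ennreal c \<le> nn_cond_exp M F (indicator {w \<in> space M. W w \<le> ereal k}) w"
proof -
  let ?D = "\<lambda>k::nat. {w \<in> space M. W w \<le> ereal k}"
  let ?p = "\<lambda>k. nn_cond_exp M F (indicator (?D k))"
  define N where "N = {w \<in> space F. \<forall>k. ?p k w < ennreal c}"
  have NF [measurable]: "N \<in> sets F" unfolding N_def by measurable
  have NM [measurable]: "N \<in> sets M" using sets_F_sets[OF NF] .
  have "measure M (N \<inter> ?D k) \<le> c * measure M N" for k
  proof -
    have "emeasure M (N \<inter> ?D k) = (\<integral>\<^sup>+w. indicator N w * indicator (?D k) w \<partial>M)"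
      unfolding indicator_inter_arith[symmetric] by simp
    also have "\<dots> = (\<integral>\<^sup>+w. indicator N w * ?p k w \<partial>M)"
      by (rule nn_cond_exp_intg[symmetric]) auto
    also have "\<dots> \<le> (\<integral>\<^sup>+w. ennreal c * indicator N w \<partial>M)"
      by (intro nn_integral_mono) (auto simp: N_def indicator_def less_imp_le)
    also have "\<dots> = ennreal (c * measure M N)"
      by (simp add: nn_integral_cmult emeasure_eq_measure ennreal_mult c)
    finally show ?thesis by (simp add: emeasure_eq_measure c)
  qed
  moreover have "(\<lambda>k. measure M (N \<inter> ?D k)) \<longlonglongrightarrow> measure M (\<Union>k. N \<inter> ?D k)"
    by (rule finite_Lim_measure_incseq) (auto simp: incseq_def intro: order_trans)
  ultimately have "measure M (\<Union>k. N \<inter> ?D k) \<le> c * measure M N"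
    by (intro LIMSEQ_le_const2) auto
  moreover have "measure M (\<Union>k. N \<inter> ?D k) = measure M N"
  proof (rule finite_measure_eq_AE)
    show "AE x in M. (x \<in> (\<Union>k. N \<inter> ?D k)) = (x \<in> N)" using fin AE_space
    proof eventually_elim
      case (elim w)
      then obtain k :: nat where "W w < ereal (real k)" using less_PInf_Ex_of_nat by auto
      then show ?case using elim by (auto intro: less_imp_le)
    qed
  qed auto
  ultimately have "(1 - c) * measure M N \<le> 0" by (simp add: algebra_simps)
  then have "measure M N = 0" using c by (smt (verit) measure_nonneg mult_pos_pos)
  then have "N \<in> null_sets M" by (intro null_setsI) (simp_all add: emeasure_eq_measure)
  then have "AE w in M. w \<notin> N" by (rule AE_not_in)
  then show ?thesis using AE_space by eventually_elim (auto simp: N_def space_F not_less)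
qed

text \<open>The sum of two extended reals with opposite infinite values is \<open>\<infinity>\<close> in Isabelle, so it matters
  that the certainty equivalent of a variable with values below \<open>\<infinity>\<close> is itself below \<open>\<infinity>\<close>.\<close>

lemma oce1_uniform_bound:
  assumes W: "W \<in> borel_measurable M" and fin: "AE w in M. W w < \<infinity>"
  shows "\<exists>B\<in>borel_measurable F. (AE w in M. B w < \<infinity>) \<and>
    (\<forall>X Y. X \<in> borel_measurable M \<longrightarrow> (AE w in M. ereal (X w) \<le> max (W w) 0) \<longrightarrow> oce1 M F H X Y
       \<longrightarrow> (AE w in M. Y w \<le> B w))"
proof -
  obtain b where b: "b \<le> 0" "\<And>x. ereal b \<le> H x" using loss_bound by blast
  obtain e C where eC: "0 < e" "\<And>x. ereal (x + e * \<bar>x\<bar> - C) \<le> H x" using growth by blast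
  have growth': "ereal ((1 + e) * x - C) \<le> H x" for x
  proof -
    have "(1 + e) * x - C \<le> x + e * \<bar>x\<bar> - C" using eC(1) by (simp add: algebra_simps)
    then show ?thesis using eC(2)[of x] by (meson ereal_less_eq(3) order_trans)
  qed
  let ?p = "\<lambda>k::nat. nn_cond_exp M F (indicator {w \<in> space M. W w \<le> ereal (real k)})"
  \<comment> \<open>Only those \<open>k\<close> count whose conditional probability passes the
    threshold of \<open>payoff_le_on\<close>; the value \<infinity> switches the others off.
    \<open>B\<close> depends on \<open>W\<close> alone and so bounds all truncations of one variable
    at once.\<close>
  define B where "B = (\<lambda>w. INF k::nat. if ennreal (1 / (1 + e)) \<le> ?p k w then ereal (real k - b + (C + b) / (1 + e)) else \<infinity>)"
  have B [measurable]: "B \<in> borel_measurable F" unfolding B_def by measurable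
  have "AE w in M. \<exists>k::nat. ennreal (1 / (1 + e)) \<le> ?p k w"
    using eC(1) by (intro cond_prob_eventually_large[OF W fin]) auto
  then have "AE w in M. B w < \<infinity>"
  proof eventually_elim
    case (elim w)
    then obtain k where "ennreal (1 / (1 + e)) \<le> ?p k w" by blast
    then show ?case unfolding B_def INF_less_iff by (intro bexI[of _ k]) auto
  qed
  moreover have "AE w in M. Y w \<le> B w"
    if "X \<in> borel_measurable M" "AE w in M. ereal (X w) \<le> max (W w) 0" "oce1 M F H X Y" for X Y
  proof (rule oce1_le[OF that(3) B])
    fix s
    have "AE w in M. \<forall>k::nat. ennreal (1 / (1 + e)) \<le> ?p k w
           \<longrightarrow> payoff s X w \<le> ereal (real k - b + (C + b) / (1 + e))"
      unfolding AE_all_countable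
      by (intro allI payoff_le_on[OF that(1,2) W b eC(1) growth']) auto
    then show "AE w in M. payoff s X w \<le> B w"
      unfolding B_def by eventually_elim (rule INF_greatest, simp)
  qed
  ultimately show ?thesis using B by blast
qed

lemma oce_finite:
  assumes Y: "oce M F H X Y" and X [measurable]: "X \<in> borel_measurable M" and fin: "AE w in M. X w < \<infinity>"
  shows "AE w in M. Y w < \<infinity>"
proof -
  obtain Yd Z where Yd: "\<And>n k. oce1 M F H (\<lambda>w. trunc n k (X w)) (Yd n k)"
    and Z: "\<And>n. AE w in M. (\<lambda>k. Yd n k w) \<longlonglongrightarrow> Z n w" and Y: "AE w in M. (\<lambda>n. Z n w) \<longlonglongrightarrow> Y w"
    using Y unfolding oce_alt by blast
  obtain B where B: "AE w in M. B w < \<infinity>"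
    "\<forall>A Y. A \<in> borel_measurable M \<longrightarrow> (AE w in M. ereal (A w) \<le> max (X w) 0) \<longrightarrow> oce1 M F H A Y
       \<longrightarrow> (AE w in M. Y w \<le> B w)"
    using oce1_uniform_bound[OF X fin] by (elim bexE conjE)
  have "AE w in M. Yd n k w \<le> B w" for n k
    by (rule B(2)[rule_format, OF _ _ Yd]) (auto simp: trunc_le)
  then have "AE w in M. \<forall>n k. Yd n k w \<le> B w" by (simp add: AE_all_countable)
  moreover have "AE w in M. \<forall>n. (\<lambda>k. Yd n k w) \<longlonglongrightarrow> Z n w" using Z by (simp add: AE_all_countable)
  ultimately show ?thesis using Y B(1)
  proof eventually_elim
    case (elim w)
    have "Z n w \<le> B w" for n
      by (rule LIMSEQ_le_const2[OF elim(2)[rule_format, of n]]) (use elim(1) in auto)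
    then have "Y w \<le> B w" by (intro LIMSEQ_le_const2[OF elim(3)]) auto
    then show ?case using elim(4) by order
  qed
qed

text \<open>The random level \<open>x0 + X\<close>, with \<open>x0\<close> a fixed point of
  \<open>H\<close>, yields at least \<open>X\<close>; no level yields more, because \<open>H\<close>
  dominates the identity.\<close>

lemma oce1_F_meas:
  assumes Y: "oce1 M F H X Y" and X: "X \<in> borel_measurable F"
  shows "AE w in M. Y w = ereal (X w)"
proof -
  note X [measurable]
  have XM [measurable]: "X \<in> borel_measurable M" using measurable_F_M[OF X] .
  obtain x0 where x0: "H x0 = ereal x0" using fixed_point by blast
  have "AE w in M. ereal (x0 + X w) - ecexp M F (\<lambda>w'. H ((x0 + X w') - X w')) w \<le> Y w"
    by (rule oce1_ge[OF Y]) auto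
  moreover have "AE w in M. ecexp M F (\<lambda>w'. H ((x0 + X w') - X w')) w = ereal x0"
    using ecexp_F_meas[of "\<lambda>_. ereal x0"] x0 by simp
  moreover have "AE w in M. Y w \<le> ereal (X w)"
  proof (rule oce1_le[OF Y])
    fix s
    have "AE w in M. ecexp M F (\<lambda>w. ereal (s - X w)) w \<le> ecexp M F (\<lambda>w. H (s - X w)) w"
      by (rule ecexp_mono) (auto simp: ge_self)
    moreover have "AE w in M. ecexp M F (\<lambda>w. ereal (s - X w)) w = ereal (s - X w)"
      by (rule ecexp_F_meas) measurable
    ultimately show "AE w in M. payoff s X w \<le> ereal (X w)" unfolding payoff_def
    proof eventually_elim
      case (elim w)
      then show ?case by (cases "ecexp M F (\<lambda>w. H (s - X w)) w") auto
    qed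
  qed auto
  ultimately show ?thesis by eventually_elim auto
qed

lemma oce_F_meas:
  assumes Y: "oce M F H X Y" and X: "X \<in> borel_measurable F"
  shows "AE w in M. Y w = X w"
proof -
  note X [measurable]
  obtain Yd Z where Yd: "\<And>n k. oce1 M F H (\<lambda>w. trunc n k (X w)) (Yd n k)"
    and Z: "\<And>n. AE w in M. (\<lambda>k. Yd n k w) \<longlonglongrightarrow> Z n w" and Y: "AE w in M. (\<lambda>n. Z n w) \<longlonglongrightarrow> Y w"
    using Y unfolding oce_alt by blast
  have "AE w in M. \<forall>n k. Yd n k w = ereal (trunc n k (X w))"
    unfolding AE_all_countable by (intro allI oce1_F_meas[OF Yd]) auto
  moreover have "AE w in M. \<forall>n. (\<lambda>k. Yd n k w) \<longlonglongrightarrow> Z n w" using Z by (simp add: AE_all_countable)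
  ultimately show ?thesis using Y
  proof eventually_elim
    case (elim w)
    have "Z n w = min (X w) (ereal (real n))" for n
      using elim(1,2) tendsto_trunc_lower[of n "X w"] by (auto intro: LIMSEQ_unique)
    then show ?case using elim(3) tendsto_trunc_upper[of "X w"] by (auto intro: LIMSEQ_unique)
  qed
qed

text \<open>The supremum over rational levels is measurable because it is countable. It also
  dominates each real level, since the expected loss is monotone in the level and rationals
  approximate from below.\<close>

lemma oce1_exists:
  assumes X [measurable]: "X \<in> borel_measurable M"
  shows "oce1 M F H X (\<lambda>w. SUP q\<in>\<rat>. payoff q X w)"
  unfolding oce1_alt
proof (intro conjI allI ballI impI)
  show "(\<lambda>w. SUP q\<in>\<rat>. payoff q X w) \<in> borel_measurable F"
    by (rule borel_measurable_SUP) (auto simp: countable_rat)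
next
  fix s
  have "AE w in M. q \<le> s \<longrightarrow> ecexp M F (\<lambda>w. H (q - X w)) w \<le> ecexp M F (\<lambda>w. H (s - X w)) w" for q
  proof (cases "q \<le> s")
    case True
    have "AE w in M. ecexp M F (\<lambda>w. H (q - X w)) w \<le> ecexp M F (\<lambda>w. H (s - X w)) w"
      by (rule ecexp_mono) (auto intro!: mono_H True)
    then show ?thesis by eventually_elim auto
  qed auto
  then have "AE w in M. \<forall>q\<in>\<rat>. q \<le> s \<longrightarrow> ecexp M F (\<lambda>w. H (q - X w)) w \<le> ecexp M F (\<lambda>w. H (s - X w)) w"
    by (subst AE_ball_countable) (auto simp: countable_rat)
  then show "AE w in M. payoff s X w \<le> (SUP q\<in>\<rat>. payoff q X w)"
  proof eventually_elim
    case (elim w)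
    show ?case unfolding payoff_def[of s]
    proof (rule le_minus_dense)
      fix q assume q: "q \<in> \<rat>" "q \<le> s"
      have "ereal q - ecexp M F (\<lambda>w'. H (s - X w')) w \<le> payoff q X w"
        unfolding payoff_def using elim q by (intro ereal_minus_mono) auto
      also have "\<dots> \<le> (SUP q\<in>\<rat>. payoff q X w)" by (rule SUP_upper[OF q(1)])
      finally show "ereal q - ecexp M F (\<lambda>w'. H (s - X w')) w \<le> (SUP q\<in>\<rat>. payoff q X w)" .
    qed
  qed
next
  fix Z assume "\<forall>s. AE w in M. payoff s X w \<le> Z w"
  then have "AE w in M. \<forall>q\<in>\<rat>. payoff q X w \<le> Z w"
    by (subst AE_ball_countable) (auto simp: countable_rat)
  then show "AE w in M. (SUP q\<in>\<rat>. payoff q X w) \<le> Z w"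
    by eventually_elim (auto intro: SUP_least)
qed

lemma oce1_mono:
  assumes "oce1 M F H X Y" "oce1 M F H X' Y'" and le: "AE w in M. X w \<le> X' w"
    and [measurable]: "X \<in> borel_measurable M" "X' \<in> borel_measurable M"
  shows "AE w in M. Y w \<le> Y' w"
proof (rule oce1_le[OF assms(1)])
  show "Y' \<in> borel_measurable F" using assms(2) unfolding oce1_alt by blast
  show "AE w in M. payoff s X w \<le> Y' w" for s
    unfolding payoff_def by (rule oce1_ge[OF assms(2) _ _ _ le]) auto
qed

text \<open>The one-step values are monotone in each truncation level, so the two limits are an
  infimum over the lower level and a supremum over the upper one. This gives measurability and
  convergence almost everywhere.\<close>

lemma oce_exists:
  assumes X [measurable]: "X \<in> borel_measurable M"
  obtains Y where "oce M F H X Y"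
proof -
  define Yd where "Yd n k = (\<lambda>w. SUP q\<in>\<rat>. payoff q (\<lambda>w. trunc n k (X w)) w)" for n k
  have Yd: "oce1 M F H (\<lambda>w. trunc n k (X w)) (Yd n k)" for n k
    unfolding Yd_def by (rule oce1_exists) measurable
  have [measurable]: "Yd n k \<in> borel_measurable F" for n k using Yd unfolding oce1_alt by blast
  define Z where "Z n w = (INF k. Yd n k w)" for n w
  define Y where "Y w = (SUP n. Z n w)" for w
  have mono: "AE w in M. Yd n k w \<le> Yd n' k' w" if "n \<le> n'" "k' \<le> k" for n n' k k'
  proof (rule oce1_mono[OF Yd Yd])
    have "ereal (trunc n k x) \<le> ereal (trunc n' k' x)" for x
      unfolding ereal_trunc using that by (intro max.mono min.mono) auto
    then show "AE w in M. trunc n k (X w) \<le> trunc n' k' (X w)" by simp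
  qed auto
  have dec: "AE w in M. \<forall>n k. Yd n (Suc k) w \<le> Yd n k w"
    unfolding AE_all_countable by (intro allI mono) auto
  have inc: "AE w in M. \<forall>n k. Yd n k w \<le> Yd (Suc n) k w"
    unfolding AE_all_countable by (intro allI mono) auto
  have "AE w in M. (\<lambda>k. Yd n k w) \<longlonglongrightarrow> Z n w" for n
    using dec by eventually_elim (auto simp: Z_def intro!: LIMSEQ_INF decseq_SucI)
  moreover have "AE w in M. (\<lambda>n. Z n w) \<longlonglongrightarrow> Y w"
    using inc by eventually_elim (auto simp: Y_def Z_def intro!: LIMSEQ_SUP incseq_SucI INF_mono')
  moreover have "Y \<in> borel_measurable F" unfolding Y_def Z_def by measurable
  ultimately have "oce M F H X Y" unfolding oce_alt using Yd by blast
  then show thesis by (rule that)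
qed

end

subsection \<open>Minimisers of convex functionals\<close>

text \<open>Near-minimisers of smallest second moment form a Cauchy sequence in mean square, by the
  parallelogram identity. This replaces weak compactness of bounded convex sets.\<close>

lemma (in prob_space) convex_minimizer:
  fixes K :: "('a \<Rightarrow> 'e::euclidean_space) set" and I :: "('a \<Rightarrow> 'e) \<Rightarrow> ennreal"
  assumes ne: "K \<noteq> {}"
    and meas: "\<And>x. x \<in> K \<Longrightarrow> x \<in> borel_measurable M"
    and bd: "\<And>x w. x \<in> K \<Longrightarrow> norm (x w) \<le> b"
    and mid: "\<And>x y. x \<in> K \<Longrightarrow> y \<in> K \<Longrightarrow> (\<lambda>w. (1/2) *\<^sub>R (x w + y w)) \<in> K"
    and quasi: "\<And>x y. x \<in> K \<Longrightarrow> y \<in> K \<Longrightarrow> I (\<lambda>w. (1/2) *\<^sub>R (x w + y w)) \<le> max (I x) (I y)"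
    and lsc: "\<And>X. (\<And>n::nat. X n \<in> K) \<Longrightarrow> AE w in M. Cauchy (\<lambda>n. X n w) \<Longrightarrow> \<exists>x\<in>K. I x \<le> liminf (\<lambda>n. I (X n))"
  shows "\<exists>x\<in>K. \<forall>y\<in>K. I x \<le> I y"
proof -
  define m where "m = (INF y\<in>K. I y)"
  show ?thesis
  proof (cases "m = top")
    case True
    then have "I y = top" if "y \<in> K" for y
      using INF_lower[OF that, of I] unfolding m_def by (simp add: top_unique)
    then show ?thesis using ne by auto
  next
    case False
    define q where "q x = (\<integral>w. (norm (x w :: 'e))\<^sup>2 \<partial>M)" for x
    define \<epsilon> where "\<epsilon> n = 1 / real (Suc n)" for n
    \<comment> \<open>The near-minimisers form a decreasing family that is stable under midpoints;
      \<open>quasi\<close> is needed for exactly this stability.\<close>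
    define L where "L n = {x \<in> K. I x \<le> m + ennreal (\<epsilon> n)}" for n
    have \<epsilon>: "0 < \<epsilon> n" for n by (simp add: \<epsilon>_def)
    have \<epsilon>_mono: "\<epsilon> k \<le> \<epsilon> n" if "n \<le> k" for n k using that by (simp add: \<epsilon>_def field_simps)
    have \<epsilon>_lim: "\<epsilon> \<longlonglongrightarrow> 0"
      using LIMSEQ_inverse_real_of_nat by (simp add: \<epsilon>_def[abs_def] inverse_eq_divide)
    have L_ne: "L n \<noteq> {}" for n
    proof -
      have "m < m + ennreal (\<epsilon> n)" using False \<epsilon>[of n] by (cases m) (auto simp: ennreal_plus[symmetric] ennreal_less_iff simp del: ennreal_plus)
      then obtain y where "y \<in> K" "I y < m + ennreal (\<epsilon> n)" unfolding m_def INF_less_iff by blast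
      then show ?thesis unfolding L_def by (auto intro: less_imp_le)
    qed
    have L_mono: "L k \<subseteq> L n" if "n \<le> k" for n k
      using \<epsilon>_mono[OF that] unfolding L_def by (auto intro: order_trans add_left_mono ennreal_leI)
    have LK: "L n \<subseteq> K" for n unfolding L_def by auto
    have L_mid: "(\<lambda>w. (1/2) *\<^sub>R (x w + y w)) \<in> L n" if "x \<in> L n" "y \<in> L n" for x y n
      using that mid quasi[of x y] unfolding L_def by (auto simp: max_def split: if_splits intro: order_trans)
    have int: "integrable M (\<lambda>w. (norm (x w))\<^sup>2)" if "x \<in> borel_measurable M" "\<And>w. norm (x w) \<le> B" for x :: "'a \<Rightarrow> 'e" and B
    proof (rule integrable_const_bound[of _ "B\<^sup>2"])
      show "AE w in M. norm ((norm (x w))\<^sup>2) \<le> B\<^sup>2" using that(2) by (auto intro!: power_mono)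
    qed (use that in measurable)
    have q0: "0 \<le> q x" for x unfolding q_def by simp
    have qb: "q x \<le> b\<^sup>2" if "x \<in> K" for x
    proof -
      have "q x \<le> (\<integral>w. b\<^sup>2 \<partial>M)" unfolding q_def
        using bd[OF that] by (intro integral_mono int[OF meas[OF that] bd[OF that]]) (auto intro!: power_mono)
      then show ?thesis by (simp add: prob_space)
    qed
    \<comment> \<open>The smallest second moment among near-minimisers increases with
      \<open>n\<close> and stays below \<open>b\<^sup>2\<close>, so \<open>d\<close> converges. Its
      increments will control the mean-square distances.\<close>
    define d where "d n = (INF x\<in>L n. q x)" for n
    have bdd: "bdd_below (q ` L n)" for n using q0 by (auto intro!: bdd_belowI[of _ 0])
    have d_le: "d n \<le> q x" if "x \<in> L n" for n x unfolding d_def by (rule cINF_lower[OF bdd that])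
    have d_mono: "d n \<le> d k" if "n \<le> k" for n k
      unfolding d_def by (rule cINF_superset_mono[OF L_ne bdd L_mono[OF that]]) auto
    have d0: "0 \<le> d n" for n unfolding d_def by (intro cINF_greatest L_ne q0)
    have "d n \<le> b\<^sup>2" for n
    proof -
      obtain x where "x \<in> L n" using L_ne by blast
      then show ?thesis using d_le qb LK by (meson order_trans subsetD)
    qed
    then have "convergent d"
      using d_mono d0 by (intro Bseq_mono_convergent BseqI'[of d "b\<^sup>2"]) auto
    then have Cd: "Cauchy d" by (rule convergent_Cauchy)
    have "\<exists>x. x \<in> L n \<and> q x < d n + \<epsilon> n" for n
    proof -
      have "d n < d n + \<epsilon> n" using \<epsilon>[of n] by simp
      then show ?thesis unfolding d_def cINF_less_iff[OF L_ne bdd] by blast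
    qed
    then obtain X where X: "\<And>n. X n \<in> L n" "\<And>n. q (X n) < d n + \<epsilon> n" by metis
    have XK: "X n \<in> K" for n using X(1) LK by blast
    note XM [measurable] = meas[OF XK]
    have close: "q (\<lambda>w. X n w - X k w) \<le> 2 * (d k - d n) + 2 * \<epsilon> n + 2 * \<epsilon> k" if "n \<le> k" for n k
    proof -
      let ?m = "\<lambda>w. (1/2) *\<^sub>R (X n w + X k w)"
      \<comment> \<open>The midpoint belongs to the larger set \<open>L n\<close>, so its second
        moment is at least \<open>d n\<close>; this is the lower bound to be inserted into the
        parallelogram identity.\<close>
      have mL: "?m \<in> L n" using L_mid X(1)[of n] X(1)[of k] L_mono[OF that] by blast
      then have mK: "?m \<in> K" using LK by blast
      have par: "(norm (X n w - X k w))\<^sup>2 = 2 * (norm (X n w))\<^sup>2 + 2 * (norm (X k w))\<^sup>2 - 4 * (norm (?m w))\<^sup>2" for w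
        by (simp add: power2_norm_eq_inner algebra_simps inner_commute)
      have "q (\<lambda>w. X n w - X k w) = 2 * q (X n) + 2 * q (X k) - 4 * q ?m"
        unfolding q_def par
        using int[OF meas[OF XK] bd[OF XK]] int[OF meas[OF mK] bd[OF mK]] by simp
      then show ?thesis using d_le[OF mL] X(2)[of n] X(2)[of k] by argo
    qed
    \<comment> \<open>Nonnegativity of the variance turns mean-square closeness into closeness in
      mean, from which an almost everywhere Cauchy subsequence is extracted.\<close>
    have L1: "(LINT w|M. norm (X n w - X k w))\<^sup>2 \<le> q (\<lambda>w. X n w - X k w)" for n k
    proof -
      let ?Y = "\<lambda>w. norm (X n w - X k w)"
      have bY: "norm (X n w - X k w) \<le> b + b" for w
        using bd[OF XK, of n w] bd[OF XK, of k w] norm_triangle_ineq4[of "X n w" "X k w"] by linarith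
      have "integrable M ?Y" by (rule integrable_const_bound[of _ "b + b"]) (use bY in auto)
      moreover have "integrable M (\<lambda>w. (?Y w)\<^sup>2)" by (rule int[OF _ bY]) measurable
      ultimately have "variance ?Y = expectation (\<lambda>w. (?Y w)\<^sup>2) - (expectation ?Y)\<^sup>2"
        by (rule variance_eq)
      then show ?thesis using variance_positive[of ?Y] unfolding q_def by simp
    qed
    obtain r where r: "strict_mono r" "AE w in M. Cauchy (\<lambda>i. X (r i) w)"
    proof (rule cauchy_L1_AE_cauchy_subseq[of M X])
      show "integrable M (X n)" for n
        by (rule integrable_const_bound[of _ b]) (use bd[OF XK] in auto)
    next
      fix e :: real assume e: "0 < e"
      \<comment> \<open>Three quantities below \<eta> enter with factor 2, so their total stays
        below 8 \<eta>.\<close>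
      define \<eta> where "\<eta> = e\<^sup>2 / 8"
      have \<eta>: "0 < \<eta>" "e\<^sup>2 = 8 * \<eta>" using e by (auto simp: \<eta>_def)
      obtain N1 where N1: "\<And>i j. i \<ge> N1 \<Longrightarrow> j \<ge> N1 \<Longrightarrow> dist (d i) (d j) < \<eta>"
        using Cd \<eta>(1) unfolding Cauchy_def by blast
      obtain N2 where N2: "\<And>i. i \<ge> N2 \<Longrightarrow> \<epsilon> i < \<eta>"
        using order_tendstoD(2)[OF \<epsilon>_lim \<eta>(1)] unfolding eventually_sequentially by blast
      have *: "LINT w|M. norm (X i w - X j w) < e" if "i \<le> j" "i \<ge> max N1 N2" for i j
      proof -
        have "\<bar>d j - d i\<bar> < \<eta>" using N1[of j i] that by (simp add: dist_real_def)
        moreover have "\<epsilon> i < \<eta>" "\<epsilon> j < \<eta>" using N2 that by auto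
        ultimately have "(d j - d i) + \<epsilon> i + \<epsilon> j < \<eta> + \<eta> + \<eta>"
          by (intro add_strict_mono) auto
        also have "\<dots> < 4 * \<eta>" using \<eta>(1) by simp
        finally have "2 * (d j - d i) + 2 * \<epsilon> i + 2 * \<epsilon> j < e\<^sup>2"
          unfolding \<eta>(2) by (simp add: algebra_simps)
        with close[OF that(1)] have "q (\<lambda>w. X i w - X j w) < e\<^sup>2" by (rule order_le_less_trans)
        then have "(LINT w|M. norm (X i w - X j w))\<^sup>2 < e\<^sup>2" using L1[of i j] by linarith
        then show ?thesis by (rule power2_less_imp_less) (use e in simp)
      qed
      have "LINT w|M. norm (X i w - X j w) < e" if "i \<ge> max N1 N2" "j \<ge> max N1 N2" for i j
      proof (cases "i \<le> j")
        case False
        then have "LINT w|M. norm (X j w - X i w) < e" using that by (intro *) auto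
        then show ?thesis by (subst norm_minus_commute)
      qed (use * that in blast)
      then show "\<exists>N. \<forall>i\<ge>N. \<forall>j\<ge>N. LINT x|M. norm (X i x - X j x) < e" by blast
    qed
    obtain x where x: "x \<in> K" "I x \<le> liminf (\<lambda>n. I (X (r n)))" using lsc[OF XK r(2)] by blast
    have "(\<lambda>n. m + ennreal (\<epsilon> (r n))) \<longlonglongrightarrow> m + ennreal 0"
      using LIMSEQ_subseq_LIMSEQ[OF \<epsilon>_lim r(1)]
      by (intro tendsto_add tendsto_const tendsto_ennrealI) (simp add: o_def)
    then have "liminf (\<lambda>n. m + ennreal (\<epsilon> (r n))) = m" by (intro lim_imp_Liminf) auto
    moreover have "liminf (\<lambda>n. I (X (r n))) \<le> liminf (\<lambda>n. m + ennreal (\<epsilon> (r n)))"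
      using X(1) by (intro Liminf_mono) (auto simp: L_def)
    ultimately have "I x \<le> m" using x(2) by simp
    then have "\<forall>y\<in>K. I x \<le> I y" unfolding m_def by (meson INF_lower order_trans)
    then show ?thesis using x(1) by blast
  qed
qed

subsection \<open>Additivity and comparison of conditional expectations\<close>

context finite_measure_subalgebra
begin

text \<open>Test the hypothesis on the \<open>F\<close>-set where the opposite strict inequality
  holds. Finiteness of the integral of \<open>g\<close> permits the subtraction that shows this set
  to be null.\<close>

lemma nn_cond_exp_le_if_set_integrals_le:
  assumes f [measurable]: "f \<in> borel_measurable M" and g [measurable]: "g \<in> borel_measurable M"
    and fin: "(\<integral>\<^sup>+w. g w \<partial>M) < \<infinity>"
    and le: "\<And>E. E \<in> sets F \<Longrightarrow> (\<integral>\<^sup>+w. indicator E w * g w \<partial>M) \<le> (\<integral>\<^sup>+w. indicator E w * f w \<partial>M)"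
  shows "AE w in M. nn_cond_exp M F g w \<le> nn_cond_exp M F f w"
proof -
  let ?f = "nn_cond_exp M F f" and ?g = "nn_cond_exp M F g"
  define E where "E = {w \<in> space F. ?f w < ?g w}"
  have EF [measurable]: "E \<in> sets F" unfolding E_def by measurable
  have EM [measurable]: "E \<in> sets M" by (rule sets_F_sets[OF EF])
  have fE: "(\<integral>\<^sup>+w. indicator E w * ?f w \<partial>M) = (\<integral>\<^sup>+w. indicator E w * f w \<partial>M)"
    and gE: "(\<integral>\<^sup>+w. indicator E w * ?g w \<partial>M) = (\<integral>\<^sup>+w. indicator E w * g w \<partial>M)"
    by (auto intro!: nn_cond_exp_intg)
  have fg: "indicator E w * ?f w \<le> indicator E w * ?g w" for w
    by (auto simp: E_def indicator_def)
  have "(\<integral>\<^sup>+w. indicator E w * g w \<partial>M) \<le> (\<integral>\<^sup>+w. g w \<partial>M)"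
    by (rule nn_integral_mono) (auto simp: indicator_def)
  then have fin': "(\<integral>\<^sup>+w. indicator E w * ?g w \<partial>M) < \<infinity>" using fin gE by simp
  have fin'': "(\<integral>\<^sup>+w. indicator E w * ?f w \<partial>M) \<noteq> \<infinity>"
    using order_le_less_trans[OF nn_integral_mono[OF fg] fin'] by simp
  have "(\<integral>\<^sup>+w. indicator E w * ?g w - indicator E w * ?f w \<partial>M)
      = (\<integral>\<^sup>+w. indicator E w * ?g w \<partial>M) - (\<integral>\<^sup>+w. indicator E w * ?f w \<partial>M)"
    by (rule nn_integral_diff) (use fg fin'' in auto)
  also have "\<dots> = 0" using le[OF EF] unfolding fE gE using fin' gE by (intro diff_eq_0_ennreal) auto
  finally have "AE w in M. indicator E w * ?g w - indicator E w * ?f w = 0"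
    by (subst (asm) nn_integral_0_iff_AE) auto
  then show ?thesis using AE_space
  proof eventually_elim
    case (elim w)
    show ?case
    proof (rule ccontr)
      assume "\<not> ?thesis"
      then have "w \<in> E" "?f w < ?g w" using elim by (auto simp: E_def space_F)
      then show False using elim(1) by (auto simp: diff_eq_0_iff_ennreal)
    qed
  qed
qed

text \<open>Links the nonnegative integrand of the minimisation with the signed conditional
  expectations in the certainty equivalents.\<close>

lemma nn_cond_exp_add_ecexp:
  fixes f :: "'a \<Rightarrow> real"
  assumes f: "f \<in> borel_measurable F"
    and f1 [measurable]: "f1 \<in> borel_measurable M" and f2 [measurable]: "f2 \<in> borel_measurable M"
    and b: "b1 \<le> 0" "\<And>w. ereal b1 \<le> f1 w" "b2 \<le> 0" "\<And>w. ereal b2 \<le> f2 w"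
    and nonneg: "\<And>w. 0 \<le> ereal (f w) + f1 w + f2 w"
  shows "AE w in M. enn2ereal (nn_cond_exp M F (\<lambda>w. e2ennreal (ereal (f w) + f1 w + f2 w)) w)
      = ereal (f w) + ecexp M F f1 w + ecexp M F f2 w"
proof -
  let ?N = "nn_cond_exp M F"
  note f [measurable]
  have [measurable]: "f \<in> borel_measurable M" by (rule measurable_F_M[OF f])
  \<comment> \<open>\<open>k1\<close> collects what has to be added to make every summand
    nonnegative: the negative part of \<open>f\<close> and the two lower bounds. It is
    \<open>F\<close>-measurable and finite, so it can be cancelled after conditioning.\<close>
  define k1 where "k1 w = ennreal (- f w) + ennreal (- b1 - b2)" for w
  define k2 where "k2 w = ennreal (f w)" for w
  have kF [measurable]: "k1 \<in> borel_measurable F" "k2 \<in> borel_measurable F" unfolding k1_def k2_def by measurable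
  have kM [measurable]: "k1 \<in> borel_measurable M" "k2 \<in> borel_measurable M" unfolding k1_def k2_def by measurable
  define g where "g w = e2ennreal (ereal (f w) + f1 w + f2 w)" for w
  define g1 where "g1 w = e2ennreal (f1 w - ereal b1)" for w
  define g2 where "g2 w = e2ennreal (f2 w - ereal b2)" for w
  have gM [measurable]: "g \<in> borel_measurable M" "g1 \<in> borel_measurable M" "g2 \<in> borel_measurable M"
    unfolding g_def g1_def g2_def by measurable
  have eq: "g w + k1 w = (k2 w + g1 w) + g2 w" for w
  proof (cases "f1 w = \<infinity> \<or> f2 w = \<infinity>")
    case True
    then have "g w = top" using b(2)[of w] b(4)[of w] unfolding g_def by (cases "f1 w"; cases "f2 w") auto
    moreover have "g1 w = top \<or> g2 w = top" using True unfolding g1_def g2_def by auto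
    ultimately show ?thesis by auto
  next
    case False
    then obtain r1 r2 where r: "f1 w = ereal r1" "f2 w = ereal r2"
      using b(2)[of w] b(4)[of w] by (cases "f1 w"; cases "f2 w") auto
    have *: "b1 \<le> r1" "b2 \<le> r2" "0 \<le> f w + r1 + r2" using r b(2)[of w] b(4)[of w] nonneg[of w] by auto
    show ?thesis
      using * b(1,3) unfolding g_def g1_def g2_def k1_def k2_def r
      by (cases "0 \<le> f w") (auto simp: ennreal_plus[symmetric] ennreal_neg simp del: ennreal_plus)
  qed
  have "AE w in M. ?N g w + ?N k1 w = ?N (\<lambda>w. g w + k1 w) w" by (rule nn_cond_exp_sum) auto
  moreover have "AE w in M. ?N (\<lambda>w. k2 w + g1 w) w + ?N g2 w = ?N (\<lambda>w. g w + k1 w) w"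
    unfolding eq by (rule nn_cond_exp_sum) auto
  moreover have "AE w in M. ?N k2 w + ?N g1 w = ?N (\<lambda>w. k2 w + g1 w) w" by (rule nn_cond_exp_sum) auto
  moreover have "AE w in M. k1 w = ?N k1 w" by (rule nn_cond_exp_F_meas) auto
  moreover have "AE w in M. k2 w = ?N k2 w" by (rule nn_cond_exp_F_meas) auto
  moreover have "AE w in M. ecexp M F f1 w = enn2ereal (?N g1 w) + ereal b1"
    using ecexp_shift[OF f1 b(1,2)] unfolding g1_def[abs_def] .
  moreover have "AE w in M. ecexp M F f2 w = enn2ereal (?N g2 w) + ereal b2"
    using ecexp_shift[OF f2 b(3,4)] unfolding g2_def[abs_def] .
  ultimately show ?thesis unfolding g_def[abs_def, symmetric]
  proof eventually_elim
    case (elim w)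
    have *: "?N g w + k1 w = k2 w + ?N g1 w + ?N g2 w" using elim by simp
    show ?case
    proof (cases "?N g1 w = top \<or> ?N g2 w = top")
      case True
      then have "?N g w + k1 w = top" using * by auto
      then have "?N g w = top" unfolding k1_def by (simp add: ennreal_add_eq_top)
      moreover have "ereal (f w) + ecexp M F f1 w + ecexp M F f2 w = \<infinity>"
        using True elim(6,7) by auto
      ultimately show ?thesis by simp
    next
      case False
      then obtain r1 r2 where r: "?N g1 w = ennreal r1" "0 \<le> r1" "?N g2 w = ennreal r2" "0 \<le> r2"
        by (metis ennreal_cases)
      then have "?N g w + k1 w \<noteq> top" using * unfolding k2_def by simp
      then obtain r0 where r0: "?N g w = ennreal r0" "0 \<le> r0" by (cases "?N g w") auto
      have "r0 = f w + b1 + b2 + r1 + r2"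
        using * b(1,3) r(2,4) r0(2) unfolding k1_def k2_def r r0
        by (cases "0 \<le> f w") (auto simp: ennreal_plus[symmetric] ennreal_neg simp del: ennreal_plus)
      then show ?thesis using elim(6,7) r r0 by simp
    qed
  qed
qed

lemma ecexp_ge:
  assumes [measurable]: "f \<in> borel_measurable M" and b: "\<And>w. ereal b \<le> f w"
  shows "AE w in M. ereal b \<le> ecexp M F f w"
proof -
  have "AE w in M. ecexp M F (\<lambda>_. ereal b) w \<le> ecexp M F f w" by (rule ecexp_mono) (use b in auto)
  moreover have "AE w in M. ecexp M F (\<lambda>_. ereal b) w = ereal b" by (rule ecexp_F_meas) simp
  ultimately show ?thesis by eventually_elim simp
qed

end

subsection \<open>The one-step problem\<close>

text \<open>The endpoints may come in either order; this is needed because one of them will be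
  random.\<close>

definition clip :: "real \<Rightarrow> real \<Rightarrow> real \<Rightarrow> real" where
  "clip x y u = max (min x y) (min u (max x y))"

text \<open>\<open>F\<close> and \<open>G\<close> stand for the information at two consecutive times
  and \<open>h\<close> for the Principal's value at the later one. The bounds on \<open>h\<close>
  and \<open>dP\<close> hold at every point, which keeps the pointwise cost estimates free of null
  sets.\<close>

locale one_step = prob_space M for M :: "'a measure" +
  fixes F G :: "'a measure" and Ha Hp :: "real \<Rightarrow> ereal" and c :: "real^'n::finite \<Rightarrow> real"
    and h :: "'a \<Rightarrow> real" and dP :: "'a \<Rightarrow> real^'n" and \<kappa> \<rho> :: real
  assumes G: "subalgebra M G" and FG: "subalgebra G F"
    and Ha: "coercive_loss Ha" and Hp: "coercive_loss Hp"
    and c_convex: "convex_on UNIV c"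
    and c_superlinear: "filterlim (\<lambda>a. c a / norm a) at_top at_infinity"
    and h: "h \<in> borel_measurable G" "\<And>w. \<bar>h w\<bar> \<le> \<kappa>"
    and dP: "dP \<in> borel_measurable G" "\<And>w. norm (dP w) \<le> \<rho>"
begin

lemma subalg_F: "subalgebra M F"
  using G FG unfolding subalgebra_def by auto

sublocale a: one_step_oce M Ha F
  by (intro one_step_oce.intro one_step_oce_axioms.intro Ha subalg_F) unfold_locales

sublocale p: one_step_oce M Hp F
  by (intro one_step_oce.intro one_step_oce_axioms.intro Hp subalg_F) unfold_locales

lemma F_G: "f \<in> borel_measurable F \<Longrightarrow> f \<in> borel_measurable G"
  using measurable_from_subalg[OF FG] .

lemma G_M: "f \<in> borel_measurable G \<Longrightarrow> f \<in> borel_measurable M"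
  using measurable_from_subalg[OF G] .

lemma c_continuous: "continuous_on UNIV c"
  by (rule convex_on_continuous[OF open_UNIV c_convex])

lemma c_measurable [measurable]: "c \<in> borel_measurable borel"
  by (rule borel_measurable_continuous_onI[OF c_continuous])

text \<open>Superlinearity supplies any slope \<open>k\<close> outside a ball, and continuity bounds
  \<open>c\<close> on the ball. The freedom in \<open>k\<close> is what lets the effort cost
  outweigh the gains from trading.\<close>

lemma c_lower_bound: obtains C where "\<And>B. k * norm B - C \<le> c B"
proof -
  obtain b where b: "\<And>x. b \<le> norm x \<Longrightarrow> k \<le> c x / norm x"
    using c_superlinear unfolding filterlim_at_top eventually_at_infinity by blast
  define b' where "b' = max b 1"
  have "compact (c ` cball 0 b')"
    by (intro compact_continuous_image continuous_on_subset[OF c_continuous]) auto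
  then have "bounded (c ` cball 0 b')" by (rule compact_imp_bounded)
  then obtain m where m: "\<And>x. norm x \<le> b' \<Longrightarrow> \<bar>c x\<bar> \<le> m" 
    unfolding bounded_iff by (metis imageI mem_cball_0 real_norm_def)
  have "k * norm B - (\<bar>k\<bar> * b' + m) \<le> c B" for B
  proof (cases "norm B \<le> b'")
    case True
    have "k * norm B \<le> \<bar>k\<bar> * b'" using True by (intro mult_mono) auto
    then show ?thesis using m[OF True] by linarith
  next
    case False
    have "0 \<le> m" using m[of 0] b'_def by (smt (verit) norm_zero)
    have "k \<le> c B / norm B" using b False by (simp add: b'_def)
    moreover have "0 < norm B" using False unfolding b'_def by linarith
    ultimately have "k * norm B \<le> c B" by (simp add: pos_le_divide_eq)
    moreover have "0 \<le> \<bar>k\<bar> * b'" by (simp add: b'_def)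
    ultimately show ?thesis using \<open>0 \<le> m\<close> by linarith
  qed
  then show thesis by (rule that)
qed

text \<open>With levels \<open>sa\<close> and \<open>sp\<close> and a position \<Gamma> of the
  Agent, the loss arguments are \<open>sa - \<Gamma>\<close> and
  \<open>sp - (h + B dP - \<Gamma>)\<close>. Their sum depends only on \<open>s = sa + sp\<close>,
  the effort and the market; if the first is \<open>u\<close>, the second is the residual.\<close>

definition residual :: "real \<Rightarrow> real^'n \<Rightarrow> real \<Rightarrow> 'a \<Rightarrow> real" where
  "residual s B u w = s - h w - B \<bullet> dP w - u"

definition cost :: "real \<Rightarrow> real^'n \<Rightarrow> real \<Rightarrow> 'a \<Rightarrow> ereal" where
  "cost s B u w = ereal (c B - s) + Ha u + Hp (residual s B u w)"

lemma inner_dP: "\<bar>B \<bullet> dP w\<bar> \<le> \<rho> * norm B"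
proof -
  have "\<bar>B \<bullet> dP w\<bar> \<le> norm B * norm (dP w)" by (rule Cauchy_Schwarz_ineq2)
  also have "\<dots> \<le> norm B * \<rho>" by (intro mult_left_mono dP(2)) auto
  finally show ?thesis by (simp add: mult.commute)
qed

lemma cost_coercive:
  obtains e N where "0 < e" "\<And>s B u w. ereal (norm B + e * \<bar>s\<bar> - N) \<le> cost s B u w"
proof -
  obtain e1 C1 where 1: "0 < e1" "\<And>x. ereal (x + e1 * \<bar>x\<bar> - C1) \<le> Ha x" using a.growth by blast
  obtain e2 C2 where 2: "0 < e2" "\<And>x. ereal (x + e2 * \<bar>x\<bar> - C2) \<le> Hp x" using p.growth by blast
  define e where "e = min e1 e2"
  have e: "0 < e" "e \<le> e1" "e \<le> e2" using 1 2 by (auto simp: e_def)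
  \<comment> \<open>The slope has three duties: 1 is left over as growth in the effort, \<rho> pays
    for the excess of \<open>s\<close> over the sum of the loss arguments, and
    \<open>e * \<rho>\<close> pays for the effort in the lower bound of
    \<open>\<bar>u\<bar> + \<bar>v\<bar>\<close> by \<open>\<bar>s\<bar>\<close>.\<close>
  obtain C where C: "\<And>B. (1 + \<rho> + e * \<rho>) * norm B - C \<le> c B" using c_lower_bound by blast
  define N where "N = C + \<kappa> + e * \<kappa> + C1 + C2"
  have "ereal (norm B + e * \<bar>s\<bar> - N) \<le> cost s B u w" for s B u w
  proof -
    define v where "v = residual s B u w"
    have uv: "u + v = s - h w - B \<bullet> dP w" by (simp add: v_def residual_def)
    have hb: "\<bar>h w\<bar> \<le> \<kappa>" "\<bar>B \<bullet> dP w\<bar> \<le> \<rho> * norm B" using h inner_dP by auto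
    have "\<bar>s\<bar> - \<kappa> - \<rho> * norm B \<le> \<bar>u\<bar> + \<bar>v\<bar>" using uv hb by linarith
    then have "e * (\<bar>s\<bar> - \<kappa> - \<rho> * norm B) \<le> e * (\<bar>u\<bar> + \<bar>v\<bar>)" using e by (intro mult_left_mono) auto
    moreover have "e * \<bar>u\<bar> \<le> e1 * \<bar>u\<bar>" "e * \<bar>v\<bar> \<le> e2 * \<bar>v\<bar>" using e by (auto intro!: mult_right_mono)
    ultimately have 3: "e * \<bar>s\<bar> - e * \<kappa> - e * \<rho> * norm B \<le> e1 * \<bar>u\<bar> + e2 * \<bar>v\<bar>" by (simp add: algebra_simps)
    have 4: "norm B + \<rho> * norm B + e * \<rho> * norm B - C \<le> c B" using C[of B] by (simp add: algebra_simps)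
    have 5: "s - u - v \<le> \<kappa> + \<rho> * norm B" using uv hb by linarith
    have "norm B + e * \<bar>s\<bar> - N \<le> (c B - s) + (u + e1 * \<bar>u\<bar> - C1) + (v + e2 * \<bar>v\<bar> - C2)"
      using add_mono[OF add_mono[OF 3 4] 5] unfolding N_def by simp
    then have "ereal (norm B + e * \<bar>s\<bar> - N) \<le> ereal (c B - s) + ereal (u + e1 * \<bar>u\<bar> - C1) + ereal (v + e2 * \<bar>v\<bar> - C2)"
      by simp
    also have "\<dots> \<le> cost s B u w" unfolding cost_def v_def[symmetric] by (intro add_mono 1 2 order_refl)
    finally show ?thesis .
  qed
  then show thesis using that e(1) by blast
qed

text \<open>Clipping moves \<open>u\<close> towards the fixed point of \<open>Ha\<close> and, at the
  same time, the residual towards that of \<open>Hp\<close>. The two arguments change by opposite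
  amounts, so the linear terms from \<open>towards_fixed_point\<close> cancel.\<close>

lemma cost_clip:
  assumes xa: "Ha xa = ereal xa" and xp: "Hp xp = ereal xp"
  shows "cost s B (clip xa (s - h w - B \<bullet> dP w - xp) u) w \<le> cost s B u w"
proof -
  define q where "q = s - h w - B \<bullet> dP w"
  define u' where "u' = clip xa (q - xp) u"
  have 1: "Ha u' \<le> Ha u + ereal (u' - u)" if "u \<noteq> u'"
    by (rule a.towards_fixed_point[OF xa]) (use that in \<open>auto simp: u'_def clip_def max_def min_def split: if_splits\<close>)
  have 2: "Hp (q - u') \<le> Hp (q - u) + ereal ((q - u') - (q - u))" if "u \<noteq> u'"
    by (rule p.towards_fixed_point[OF xp]) (use that in \<open>auto simp: u'_def clip_def max_def min_def split: if_splits\<close>)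
  have "Ha u' + Hp (q - u') \<le> Ha u + Hp (q - u)"
  proof (cases "u = u'")
    case False
    have "Ha u' + Hp (q - u') \<le> (Ha u + ereal (u' - u)) + (Hp (q - u) + ereal ((q - u') - (q - u)))"
      by (rule add_mono[OF 1[OF False] 2[OF False]])
    also have "\<dots> = Ha u + Hp (q - u)" by (cases "Ha u"; cases "Hp (q - u)") auto
    finally show ?thesis .
  qed simp
  then have "ereal (c B - s) + (Ha u' + Hp (q - u')) \<le> ereal (c B - s) + (Ha u + Hp (q - u))" by (rule add_left_mono)
  then show ?thesis unfolding cost_def residual_def q_def[symmetric] u'_def[symmetric] by (simp add: add.assoc)
qed

text \<open>A reference strategy without effort. Lowering the level by \<kappa> keeps the residual
  at most \<open>xp\<close> whatever the value of \<open>h\<close>.\<close>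

lemma cost_base:
  assumes xa: "Ha xa = ereal xa" and xp: "Hp xp = ereal xp"
  shows "cost (xa + xp - \<kappa>) 0 xa w \<le> ereal (c 0 + \<kappa>)"
proof -
  have "residual (xa + xp - \<kappa>) 0 xa w \<le> xp" using h(2)[of w] unfolding residual_def by auto
  then have "Hp (residual (xa + xp - \<kappa>) 0 xa w) \<le> ereal xp" using p.mono_H xp by metis
  then have "cost (xa + xp - \<kappa>) 0 xa w \<le> ereal (c 0 - (xa + xp - \<kappa>)) + ereal xa + ereal xp"
    unfolding cost_def xa by (intro add_mono order_refl)
  then show ?thesis by simp
qed

end

section \<open>Existence of a minimiser among bounded strategies\<close>

context one_step
begin

lemma measurable_residual:
  assumes "s \<in> borel_measurable F" "B \<in> borel_measurable F" "u \<in> borel_measurable G"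
  shows "(\<lambda>w. residual (s w) (B w) (u w) w) \<in> borel_measurable G"
proof -
  have [measurable]: "s \<in> borel_measurable G" "B \<in> borel_measurable G" using assms F_G by auto
  note assms(3) [measurable] h(1) [measurable] dP(1) [measurable]
  show ?thesis unfolding residual_def by measurable
qed

text \<open>Level, effort and Agent's loss argument form one vector, so that
  \<open>convex_minimizer\<close> applies in a single Euclidean space; \<open>N\<close> is the
  constant that makes the cost nonnegative.\<close>

definition tcost :: "real \<Rightarrow> real \<times> (real^'n) \<times> real \<Rightarrow> 'a \<Rightarrow> ereal" where
  "tcost N z w = ereal (c (fst (snd z)) - fst z + N) + Ha (snd (snd z))
     + Hp (residual (fst z) (fst (snd z)) (snd (snd z)) w)"

lemma tcost_eq: "tcost N z w = cost (fst z) (fst (snd z)) (snd (snd z)) w + ereal N"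
  unfolding tcost_def cost_def using a.not_MInf p.not_MInf
  by (cases "Ha (snd (snd z))"; cases "Hp (residual (fst z) (fst (snd z)) (snd (snd z)) w)") auto

definition strategies :: "real \<Rightarrow> real \<Rightarrow> real \<Rightarrow> ('a \<Rightarrow> real \<times> (real^'n) \<times> real) set" where
  "strategies S L Q = {x. (\<lambda>w. fst (x w)) \<in> borel_measurable F \<and> (\<lambda>w. fst (snd (x w))) \<in> borel_measurable F
     \<and> (\<lambda>w. snd (snd (x w))) \<in> borel_measurable G
     \<and> (\<forall>w. \<bar>fst (x w)\<bar> \<le> S \<and> norm (fst (snd (x w))) \<le> L \<and> \<bar>snd (snd (x w))\<bar> \<le> Q)}"

lemma strategiesD:
  assumes "x \<in> strategies S L Q"
  shows "(\<lambda>w. fst (x w)) \<in> borel_measurable F" "(\<lambda>w. fst (snd (x w))) \<in> borel_measurable F"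
    "(\<lambda>w. snd (snd (x w))) \<in> borel_measurable G"
    "\<bar>fst (x w)\<bar> \<le> S" "norm (fst (snd (x w))) \<le> L" "\<bar>snd (snd (x w))\<bar> \<le> Q"
  using assms unfolding strategies_def by auto

lemma measurable_tcost:
  assumes "(\<lambda>w. fst (x w)) \<in> borel_measurable F" "(\<lambda>w. fst (snd (x w))) \<in> borel_measurable F"
    "(\<lambda>w. snd (snd (x w))) \<in> borel_measurable G"
  shows "(\<lambda>w. tcost N (x w) w) \<in> borel_measurable M"
proof -
  have [measurable]: "(\<lambda>w. fst (x w)) \<in> borel_measurable M" "(\<lambda>w. fst (snd (x w))) \<in> borel_measurable M"
    "(\<lambda>w. snd (snd (x w))) \<in> borel_measurable M"
    "(\<lambda>w. residual (fst (x w)) (fst (snd (x w))) (snd (snd (x w))) w) \<in> borel_measurable M"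
    using assms measurable_residual[OF assms] F_G G_M by auto
  show ?thesis unfolding tcost_def by measurable
qed

text \<open>The residual is affine in the strategy, so joint convexity follows from that of
  \<open>c\<close>, \<open>Ha\<close> and \<open>Hp\<close>. The factor 2 on the left avoids a
  division in \<open>ennreal\<close>.\<close>

lemma tcost_midpoint:
  assumes nonneg: "\<And>z. 0 \<le> tcost N z w"
  shows "2 * e2ennreal (tcost N ((1/2) *\<^sub>R (x + y)) w) \<le> e2ennreal (tcost N x w) + e2ennreal (tcost N y w)"
proof (cases "tcost N x w = \<infinity> \<or> tcost N y w = \<infinity>")
  case False
  obtain s1 B1 u1 where x: "x = (s1, B1, u1)" by (cases x)
  obtain s2 B2 u2 where y: "y = (s2, B2, u2)" by (cases y)
  define v1 v2 where "v1 = residual s1 B1 u1 w" and "v2 = residual s2 B2 u2 w"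
  obtain a1 p1 where 1: "Ha u1 = ereal a1" "Hp v1 = ereal p1"
    using False a.not_MInf[of u1] p.not_MInf[of v1] unfolding tcost_def x v1_def by (cases "Ha u1"; cases "Hp (residual s1 B1 u1 w)") auto
  obtain a2 p2 where 2: "Ha u2 = ereal a2" "Hp v2 = ereal p2"
    using False a.not_MInf[of u2] p.not_MInf[of v2] unfolding tcost_def y v2_def by (cases "Ha u2"; cases "Hp (residual s2 B2 u2 w)") auto
  have A: "Ha ((u1 + u2) / 2) \<le> ereal ((a1 + a2) / 2)"
    using a.convex_H[of "1/2" u1 u2] 1 2 by (simp add: add_divide_distrib)
  have P: "Hp ((v1 + v2) / 2) \<le> ereal ((p1 + p2) / 2)"
    using p.convex_H[of "1/2" v1 v2] 1 2 by (simp add: add_divide_distrib)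
  have C: "c ((1/2) *\<^sub>R (B1 + B2)) \<le> (c B1 + c B2) / 2"
    using convex_onD[OF c_convex, of "1/2" B1 B2] by (simp add: scaleR_add_right add_divide_distrib)
  have R: "residual ((s1 + s2) / 2) ((1/2) *\<^sub>R (B1 + B2)) ((u1 + u2) / 2) w = (v1 + v2) / 2"
    unfolding v1_def v2_def residual_def by (simp add: inner_add_left field_simps)
  define t1 t2 where "t1 = c B1 - s1 + N + a1 + p1" and "t2 = c B2 - s2 + N + a2 + p2"
  have t: "tcost N x w = ereal t1" "tcost N y w = ereal t2"
    unfolding tcost_def x y t1_def t2_def using 1 2 by (auto simp: v1_def v2_def)
  have t0: "0 \<le> t1" "0 \<le> t2" using nonneg[of x] nonneg[of y] t by auto
  have "tcost N ((1/2) *\<^sub>R (x + y)) w = ereal (c ((1/2) *\<^sub>R (B1 + B2)) - (s1 + s2) / 2 + N) + Ha ((u1 + u2) / 2) + Hp ((v1 + v2) / 2)"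
    unfolding tcost_def x y R[symmetric] by simp
  also have "\<dots> \<le> ereal ((c B1 + c B2) / 2 - (s1 + s2) / 2 + N) + ereal ((a1 + a2) / 2) + ereal ((p1 + p2) / 2)"
    using C by (intro add_mono A P) auto
  also have "\<dots> = ereal ((t1 + t2) / 2)" unfolding t1_def t2_def by (simp add: field_simps)
  finally have "e2ennreal (tcost N ((1/2) *\<^sub>R (x + y)) w) \<le> ennreal ((t1 + t2) / 2)"
    using e2ennreal_mono by fastforce
  then have "2 * e2ennreal (tcost N ((1/2) *\<^sub>R (x + y)) w) \<le> 2 * ennreal ((t1 + t2) / 2)"
    by (rule mult_left_mono) simp
  also have "\<dots> = ennreal 2 * ennreal ((t1 + t2) / 2)" by simp
  also have "\<dots> = ennreal (2 * ((t1 + t2) / 2))" by (rule ennreal_mult[symmetric]) (use t0 in auto)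
  also have "2 * ((t1 + t2) / 2) = t1 + t2" by simp
  also have "\<dots> = e2ennreal (tcost N x w) + e2ennreal (tcost N y w)" using t t0 by simp
  finally show ?thesis .
qed auto

lemma tcost_lsc:
  assumes z: "z \<longlonglongrightarrow> z0"
  shows "e2ennreal (tcost N z0 w) \<le> liminf (\<lambda>n. e2ennreal (tcost N (z n) w))"
proof -
  define f where "f z = c (fst (snd z)) - fst z + N" for z :: "real \<times> (real^'n) \<times> real"
  define v where "v z = residual (fst z) (fst (snd z)) (snd (snd z)) w" for z :: "real \<times> (real^'n) \<times> real"
  have "(\<lambda>n. f (z n)) \<longlonglongrightarrow> f z0"
    unfolding f_def using c_continuous z
    by (intro tendsto_intros) (auto intro!: tendsto_fst tendsto_snd continuous_on_tendsto_compose[OF c_continuous])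
  then have F1: "liminf (\<lambda>n. ereal (f (z n))) = ereal (f z0)" by (intro lim_imp_Liminf) auto
  have A: "Ha (snd (snd z0)) \<le> liminf (\<lambda>n. Ha (snd (snd (z n))))"
    using z by (intro a.lsc_sequentially tendsto_snd)
  have "(\<lambda>n. v (z n)) \<longlonglongrightarrow> v z0"
    unfolding v_def residual_def using z by (intro tendsto_intros tendsto_fst tendsto_snd)
  then have P: "Hp (v z0) \<le> liminf (\<lambda>n. Hp (v (z n)))" by (rule p.lsc_sequentially)
  \<comment> \<open>Superadditivity of the lower limit fails for \<infinity> and -\<infinity>
    together; lower semicontinuity itself excludes the value -\<infinity>.\<close>
  have A': "liminf (\<lambda>n. Ha (snd (snd (z n)))) \<noteq> -\<infinity>" using A a.not_MInf by auto
  have P': "liminf (\<lambda>n. Hp (v (z n))) \<noteq> -\<infinity>" using P p.not_MInf by auto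
  have fA: "ereal (f z0) + liminf (\<lambda>n. Ha (snd (snd (z n)))) \<le> liminf (\<lambda>n. ereal (f (z n)) + Ha (snd (snd (z n))))"
    using ereal_liminf_add_mono[of "\<lambda>n. ereal (f (z n))" "\<lambda>n. Ha (snd (snd (z n)))"] F1 by simp
  then have fA': "liminf (\<lambda>n. ereal (f (z n)) + Ha (snd (snd (z n)))) \<noteq> -\<infinity>" using A' by auto
  have "tcost N z0 w = ereal (f z0) + Ha (snd (snd z0)) + Hp (v z0)" unfolding tcost_def f_def v_def ..
  also have "\<dots> \<le> liminf (\<lambda>n. ereal (f (z n)) + Ha (snd (snd (z n)))) + liminf (\<lambda>n. Hp (v (z n)))"
    by (intro add_mono order_trans[OF _ fA] A P order_refl)
  also have "\<dots> \<le> liminf (\<lambda>n. ereal (f (z n)) + Ha (snd (snd (z n))) + Hp (v (z n)))"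
    using fA' P' by (intro ereal_liminf_add_mono) auto
  also have "\<dots> = liminf (\<lambda>n. tcost N (z n) w)" unfolding tcost_def f_def v_def ..
  finally have "e2ennreal (tcost N z0 w) \<le> e2ennreal (liminf (\<lambda>n. tcost N (z n) w))" by (rule e2ennreal_mono)
  also have "\<dots> = liminf (\<lambda>n. e2ennreal (tcost N (z n) w))"
    by (rule Liminf_compose_continuous_mono[symmetric]) (auto intro!: continuous_on_e2ennreal monoI e2ennreal_mono)
  finally show ?thesis .
qed

definition expected_cost :: "real \<Rightarrow> ('a \<Rightarrow> real \<times> (real^'n) \<times> real) \<Rightarrow> ennreal" where
  "expected_cost N x = (\<integral>\<^sup>+w. e2ennreal (tcost N (x w) w) \<partial>M)"

lemma strategies_limit:
  assumes X: "\<And>n::nat. X n \<in> strategies S L Q" and C: "AE w in M. Cauchy (\<lambda>n. X n w)"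
    and pos: "0 \<le> S" "0 \<le> L" "0 \<le> Q"
  shows "\<exists>x\<in>strategies S L Q. AE w in M. (\<lambda>n. X n w) \<longlonglongrightarrow> x w"
proof -
  define s where "s w = lim (\<lambda>n. fst (X n w))" for w
  define B where "B w = lim (\<lambda>n. fst (snd (X n w)))" for w
  define u where "u w = lim (\<lambda>n. snd (snd (X n w)))" for w
  note [measurable] = strategiesD(1-3)[OF X]
  have [measurable]: "s \<in> borel_measurable F" "B \<in> borel_measurable F" "u \<in> borel_measurable G"
    unfolding s_def B_def u_def by measurable
  \<comment> \<open>Where the sequence diverges \<open>lim\<close> is unspecified, so values outside
    the bounds are replaced by 0. This happens only on a null set and keeps the bounds valid
    everywhere.\<close>
  define x where "x w = (if \<bar>s w\<bar> \<le> S then s w else 0, if norm (B w) \<le> L then B w else 0, if \<bar>u w\<bar> \<le> Q then u w else 0)" for w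
  have "x \<in> strategies S L Q" unfolding strategies_def x_def using pos by auto
  moreover have "AE w in M. (\<lambda>n. X n w) \<longlonglongrightarrow> x w" using C
  proof eventually_elim
    case (elim w)
    then obtain l where l: "(\<lambda>n. X n w) \<longlonglongrightarrow> l" using Cauchy_convergent convergent_def by blast
    have ls: "(\<lambda>n. fst (X n w)) \<longlonglongrightarrow> fst l" and lB: "(\<lambda>n. fst (snd (X n w))) \<longlonglongrightarrow> fst (snd l)"
      and lu: "(\<lambda>n. snd (snd (X n w))) \<longlonglongrightarrow> snd (snd l)"
      using l by (auto intro: tendsto_fst tendsto_snd)
    have "\<bar>fst l\<bar> \<le> S" using tendsto_rabs[OF ls] by (rule LIMSEQ_le_const2) (use strategiesD(4)[OF X] in auto)
    moreover have "norm (fst (snd l)) \<le> L" using tendsto_norm[OF lB] by (rule LIMSEQ_le_const2) (use strategiesD(5)[OF X] in auto)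
    moreover have "\<bar>snd (snd l)\<bar> \<le> Q" using tendsto_rabs[OF lu] by (rule LIMSEQ_le_const2) (use strategiesD(6)[OF X] in auto)
    moreover have "s w = fst l" "B w = fst (snd l)" "u w = snd (snd l)"
      unfolding s_def B_def u_def using ls lB lu by (auto intro: limI)
    ultimately have "x w = l" unfolding x_def by simp
    then show ?case using l by simp
  qed
  ultimately show ?thesis by blast
qed

lemma strategies_minimizer:
  assumes ne: "strategies S L Q \<noteq> {}" and nonneg: "\<And>z w. 0 \<le> tcost N z w"
  shows "\<exists>x\<in>strategies S L Q. \<forall>y\<in>strategies S L Q. expected_cost N x \<le> expected_cost N y"
proof (rule convex_minimizer[OF ne, where b = "S + (L + Q)"])
  fix x assume x: "x \<in> strategies S L Q"
  note strategiesD(1-3)[OF x]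
  then have [measurable]: "(\<lambda>w. fst (x w)) \<in> borel_measurable M" "(\<lambda>w. fst (snd (x w))) \<in> borel_measurable M"
    "(\<lambda>w. snd (snd (x w))) \<in> borel_measurable M" using F_G G_M by auto
  have "(\<lambda>w. (fst (x w), fst (snd (x w)), snd (snd (x w)))) \<in> borel_measurable M" by measurable
  then show "x \<in> borel_measurable M" by simp
  fix w
  have "norm (fst (x w), fst (snd (x w)), snd (snd (x w))) \<le> norm (fst (x w)) + (norm (fst (snd (x w))) + norm (snd (snd (x w))))"
    by (intro order_trans[OF norm_Pair_le] add_left_mono norm_Pair_le)
  also have "\<dots> \<le> S + (L + Q)" using strategiesD(4-6)[OF x, of w] by simp
  finally show "norm (x w) \<le> S + (L + Q)" by simp
next
  fix x y assume x: "x \<in> strategies S L Q" and y: "y \<in> strategies S L Q"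
  let ?m = "\<lambda>w. (1/2) *\<^sub>R (x w + y w)"
  have half: "norm ((1/2) *\<^sub>R (p + q)) \<le> R" if "norm p \<le> R" "norm q \<le> R" for p q :: "'z::real_normed_vector" and R
    using that norm_triangle_ineq[of p q] by simp
  note [measurable] = strategiesD(1-3)[OF x] strategiesD(1-3)[OF y]
  show "?m \<in> strategies S L Q"
    unfolding strategies_def
  proof (intro CollectI conjI allI)
    show "(\<lambda>w. fst (?m w)) \<in> borel_measurable F" "(\<lambda>w. fst (snd (?m w))) \<in> borel_measurable F"
      "(\<lambda>w. snd (snd (?m w))) \<in> borel_measurable G" by simp_all
    fix w
    show "\<bar>fst (?m w)\<bar> \<le> S"
      using half[of "fst (x w)" S "fst (y w)"] strategiesD(4)[OF x, of w] strategiesD(4)[OF y, of w] by simp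
    show "norm (fst (snd (?m w))) \<le> L"
      using half[of "fst (snd (x w))" L "fst (snd (y w))"] strategiesD(5)[OF x, of w] strategiesD(5)[OF y, of w] by simp
    show "\<bar>snd (snd (?m w))\<bar> \<le> Q"
      using half[of "snd (snd (x w))" Q "snd (snd (y w))"] strategiesD(6)[OF x, of w] strategiesD(6)[OF y, of w] by simp
  qed
  then have [measurable]: "(\<lambda>w. tcost N (?m w) w) \<in> borel_measurable M"
    by (intro measurable_tcost strategiesD(1-3))
  have [measurable]: "(\<lambda>w. tcost N (x w) w) \<in> borel_measurable M" "(\<lambda>w. tcost N (y w) w) \<in> borel_measurable M"
    using x y by (auto intro!: measurable_tcost strategiesD(1-3))
  have "2 * expected_cost N ?m = (\<integral>\<^sup>+w. 2 * e2ennreal (tcost N (?m w) w) \<partial>M)"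
    unfolding expected_cost_def by (rule nn_integral_cmult[symmetric]) measurable
  also have "\<dots> \<le> (\<integral>\<^sup>+w. e2ennreal (tcost N (x w) w) + e2ennreal (tcost N (y w) w) \<partial>M)"
    by (intro nn_integral_mono tcost_midpoint nonneg)
  also have "\<dots> = expected_cost N x + expected_cost N y"
    unfolding expected_cost_def by (rule nn_integral_add) measurable
  also have "\<dots> \<le> max (expected_cost N x) (expected_cost N y) + max (expected_cost N x) (expected_cost N y)"
    by (intro add_mono) auto
  also have "\<dots> = 2 * max (expected_cost N x) (expected_cost N y)" by (simp add: mult_2)
  finally show "expected_cost N ?m \<le> max (expected_cost N x) (expected_cost N y)"
    by (subst (asm) ennreal_mult_le_mult_iff) auto
next
  fix X :: "nat \<Rightarrow> _" assume X: "\<And>n. X n \<in> strategies S L Q" and C: "AE w in M. Cauchy (\<lambda>n. X n w)"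
  have "0 \<le> S" "0 \<le> L" "0 \<le> Q"
    using strategiesD(4-6)[OF X[of 0], of undefined] by (auto intro: order_trans[OF norm_ge_zero] order_trans[OF abs_ge_zero])
  then obtain x where x: "x \<in> strategies S L Q" "AE w in M. (\<lambda>n. X n w) \<longlonglongrightarrow> x w"
    using strategies_limit[OF X C] by blast
  have [measurable]: "(\<lambda>w. tcost N (X n w) w) \<in> borel_measurable M" for n
    using X by (auto intro!: measurable_tcost strategiesD(1-3))
  have "expected_cost N x \<le> (\<integral>\<^sup>+w. liminf (\<lambda>n. e2ennreal (tcost N (X n w) w)) \<partial>M)"
    unfolding expected_cost_def
    by (rule nn_integral_mono_AE) (use x(2) in \<open>auto elim!: eventually_mono intro: tcost_lsc\<close>)
  also have "\<dots> \<le> liminf (\<lambda>n. expected_cost N (X n))"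
    unfolding expected_cost_def by (rule nn_integral_liminf) measurable
  finally show "\<exists>x\<in>strategies S L Q. expected_cost N x \<le> liminf (\<lambda>n. expected_cost N (X n))"
    using x(1) by blast
qed

text \<open>The reduction to bounded strategies is pointwise: either level and effort are moderate
  and it suffices to clip \<open>u\<close>, or coercivity makes the strategy at least as costly as
  the reference one, which then replaces it.\<close>

lemma strategies_dominate:
  "\<exists>S L Q. \<forall>s\<in>borel_measurable F. \<forall>B\<in>borel_measurable F. \<forall>u\<in>borel_measurable G. \<exists>x\<in>strategies S L Q.
    \<forall>w. cost (fst (x w)) (fst (snd (x w))) (snd (snd (x w))) w \<le> cost (s w) (B w) (u w) w"
proof -
  obtain xa where xa: "Ha xa = ereal xa" using a.fixed_point by blast
  obtain xp where xp: "Hp xp = ereal xp" using p.fixed_point by blast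
  obtain e N where e: "0 < e" and coer: "\<And>s B u w. ereal (norm B + e * \<bar>s\<bar> - N) \<le> cost s B u w"
    using cost_coercive by blast
  \<comment> \<open>The threshold at which the coercive lower bound reaches the bound
    \<open>c 0 + \<kappa>\<close> on the reference cost.\<close>
  define R where "R = N + c 0 + \<kappa>"
  define S where "S = max (R / e) \<bar>xa + xp - \<kappa>\<bar>"
  define L where "L = max R 0"
  define Q where "Q = \<bar>xa\<bar> + \<bar>xp\<bar> + S + \<kappa> + \<rho> * L"
  have \<kappa>: "0 \<le> \<kappa>" using h(2)[of undefined] by linarith
  have \<rho>: "0 \<le> \<rho>" using dP(2)[of undefined] norm_ge_zero order_trans by blast
  have S: "0 \<le> S" unfolding S_def by (simp add: max.coboundedI2)
  have L: "0 \<le> L" unfolding L_def by simp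
  show ?thesis
  proof (rule exI[of _ S], rule exI[of _ L], rule exI[of _ Q], intro ballI)
    fix s :: "'a \<Rightarrow> real" and B :: "'a \<Rightarrow> real^'n" and u :: "'a \<Rightarrow> real"
    assume sB: "s \<in> borel_measurable F" "B \<in> borel_measurable F" and u: "u \<in> borel_measurable G"
    note sB [measurable] and u [measurable]
    define q where "q w = s w - h w - B w \<bullet> dP w - xp" for w
    \<comment> \<open>The case distinction involves \<open>s\<close> and \<open>B\<close> only, so
      the new level and effort remain \<open>F\<close>-measurable although \<open>u\<close> is
      merely \<open>G\<close>-measurable.\<close>
    define x where "x w = (if norm (B w) + e * \<bar>s w\<bar> \<le> R then (s w, B w, clip xa (q w) (u w))
       else (xa + xp - \<kappa>, 0, xa))" for w
    note F_G[OF sB(1), measurable] F_G[OF sB(2), measurable]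
    note h(1) [measurable] dP(1) [measurable]
    have [measurable]: "q \<in> borel_measurable G" unfolding q_def by measurable
    have [measurable]: "(\<lambda>w. clip xa (q w) (u w)) \<in> borel_measurable G" unfolding clip_def by measurable
    have bounds: "\<bar>fst (x w)\<bar> \<le> S \<and> norm (fst (snd (x w))) \<le> L \<and> \<bar>snd (snd (x w))\<bar> \<le> Q" for w
    proof (cases "norm (B w) + e * \<bar>s w\<bar> \<le> R")
      case True
      have "norm (B w) \<le> R" using True e by (smt (verit) mult_nonneg_nonneg abs_ge_zero)
      moreover have "e * \<bar>s w\<bar> \<le> R" using True norm_ge_zero[of "B w"] by linarith
      ultimately have bS: "\<bar>s w\<bar> \<le> S" and bL: "norm (B w) \<le> L"
        using e by (auto simp: S_def L_def field_simps max.coboundedI1)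
      have "\<bar>clip xa (q w) (u w)\<bar> \<le> \<bar>xa\<bar> + \<bar>q w\<bar>"
        unfolding clip_def by (auto simp: max_def min_def)
      also have "\<bar>q w\<bar> \<le> \<bar>s w\<bar> + \<bar>h w\<bar> + \<bar>B w \<bullet> dP w\<bar> + \<bar>xp\<bar>" unfolding q_def by linarith
      also have "\<bar>B w \<bullet> dP w\<bar> \<le> \<rho> * L" using inner_dP[of "B w" w] mult_left_mono[OF bL \<rho>] by linarith
      also have "\<bar>h w\<bar> \<le> \<kappa>" by (rule h(2))
      also note bS
      finally show ?thesis using True bS bL unfolding x_def Q_def by simp
    next
      case False
      then show ?thesis unfolding x_def using L S \<rho> \<kappa> by (auto simp: S_def Q_def)
    qed
    have "(\<lambda>w. fst (x w)) = (\<lambda>w. if norm (B w) + e * \<bar>s w\<bar> \<le> R then s w else xa + xp - \<kappa>)"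
      "(\<lambda>w. fst (snd (x w))) = (\<lambda>w. if norm (B w) + e * \<bar>s w\<bar> \<le> R then B w else 0)"
      "(\<lambda>w. snd (snd (x w))) = (\<lambda>w. if norm (B w) + e * \<bar>s w\<bar> \<le> R then clip xa (q w) (u w) else xa)"
      unfolding x_def by auto
    then have "x \<in> strategies S L Q" unfolding strategies_def using bounds
      by simp
    moreover have "cost (fst (x w)) (fst (snd (x w))) (snd (snd (x w))) w \<le> cost (s w) (B w) (u w) w" for w
    proof (cases "norm (B w) + e * \<bar>s w\<bar> \<le> R")
      case True
      then show ?thesis using cost_clip[OF xa xp] unfolding x_def q_def by simp
    next
      case False
      have "cost (xa + xp - \<kappa>) 0 xa w \<le> ereal (c 0 + \<kappa>)" by (rule cost_base[OF xa xp])
      also have "\<dots> \<le> ereal (norm (B w) + e * \<bar>s w\<bar> - N)" using False by (simp add: R_def)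
      also note coer
      finally show ?thesis using False unfolding x_def by simp
    qed
    ultimately show "\<exists>x\<in>strategies S L Q.
      \<forall>w. cost (fst (x w)) (fst (snd (x w))) (snd (snd (x w))) w \<le> cost (s w) (B w) (u w) w" by blast
  qed
qed

end

section \<open>Conditional optimality against unbounded strategies\<close>

context one_step
begin

lemma bounded_cond_value:
  fixes l U :: real and \<alpha> :: "'a \<Rightarrow> ereal"
  assumes \<alpha> [measurable]: "\<alpha> \<in> borel_measurable F" and bnd: "AE w in M. ereal l \<le> \<alpha> w \<and> \<alpha> w \<le> ereal U"
  shows "\<exists>a\<in>borel_measurable F. (AE w in M. \<alpha> w = ereal (a w)) \<and> (\<forall>w. \<bar>a w\<bar> \<le> \<bar>l\<bar> + \<bar>U\<bar>)"
proof (intro bexI conjI allI)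
  let ?a = "\<lambda>w. max l (min U (real_of_ereal (\<alpha> w)))"
  show "?a \<in> borel_measurable F" by measurable
  show "AE w in M. \<alpha> w = ereal (?a w)" using bnd
  proof eventually_elim
    case (elim w) then show ?case by (cases "\<alpha> w") auto
  qed
  have "\<bar>max l (min U y)\<bar> \<le> \<bar>l\<bar> + \<bar>U\<bar>" for y by (auto simp: max_def min_def)
  then show "\<bar>?a w\<bar> \<le> \<bar>l\<bar> + \<bar>U\<bar>" for w .
qed

text \<open>Pasting a competitor onto an arbitrary \<open>F\<close>-set turns optimality in expectation into
  conditional optimality.\<close>

lemma strategies_cond_optimal:
  assumes x: "x \<in> strategies S L Q" and y: "y \<in> strategies S L Q"
    and opt: "\<And>y. y \<in> strategies S L Q \<Longrightarrow> expected_cost N x \<le> expected_cost N y"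
    and fin: "expected_cost N x < \<infinity>"
  shows "AE w in M. nn_cond_exp M F (\<lambda>w. e2ennreal (tcost N (x w) w)) w
      \<le> nn_cond_exp M F (\<lambda>w. e2ennreal (tcost N (y w) w)) w"
proof (rule a.nn_cond_exp_le_if_set_integrals_le)
  have xM: "(\<lambda>w. tcost N (x w) w) \<in> borel_measurable M" and yM: "(\<lambda>w. tcost N (y w) w) \<in> borel_measurable M"
    using x y by (auto intro!: measurable_tcost strategiesD(1-3))
  note xM [measurable] and yM [measurable]
  show "(\<lambda>w. e2ennreal (tcost N (x w) w)) \<in> borel_measurable M" "(\<lambda>w. e2ennreal (tcost N (y w) w)) \<in> borel_measurable M"
    by measurable
  show "(\<integral>\<^sup>+w. e2ennreal (tcost N (x w) w) \<partial>M) < \<infinity>" using fin unfolding expected_cost_def .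
  fix E assume E: "E \<in> sets F"
  note E [measurable]
  have EM [measurable]: "E \<in> sets M" using E a.sets_F_sets by blast
  have EG [measurable]: "E \<in> sets G" using E FG unfolding subalgebra_def by blast
  define z where "z w = (if w \<in> E then y w else x w)" for w
  note [measurable] = strategiesD(1-3)[OF x] strategiesD(1-3)[OF y]
  have "(\<lambda>w. fst (z w)) = (\<lambda>w. if w \<in> E then fst (y w) else fst (x w))"
    "(\<lambda>w. fst (snd (z w))) = (\<lambda>w. if w \<in> E then fst (snd (y w)) else fst (snd (x w)))"
    "(\<lambda>w. snd (snd (z w))) = (\<lambda>w. if w \<in> E then snd (snd (y w)) else snd (snd (x w)))"
    by (auto simp: z_def)
  moreover have "\<bar>fst (z w)\<bar> \<le> S \<and> norm (fst (snd (z w))) \<le> L \<and> \<bar>snd (snd (z w))\<bar> \<le> Q" for w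
    using strategiesD(4-6)[OF x, of w] strategiesD(4-6)[OF y, of w] by (simp add: z_def)
  ultimately have "z \<in> strategies S L Q" unfolding strategies_def by simp
  then have le: "expected_cost N x \<le> expected_cost N z" by (rule opt)
  \<comment> \<open>The cost off \<open>E\<close> is common to both strategies and finite, hence can
    be cancelled.\<close>
  define R where "R = (\<integral>\<^sup>+w. indicator (space M - E) w * e2ennreal (tcost N (x w) w) \<partial>M)"
  have "R \<le> expected_cost N x"
    unfolding R_def expected_cost_def by (rule nn_integral_mono) (auto simp: indicator_def)
  then have R: "R \<noteq> top" using fin by (auto simp: top_unique)
  have 1: "expected_cost N x = R + (\<integral>\<^sup>+w. indicator E w * e2ennreal (tcost N (x w) w) \<partial>M)"
    unfolding R_def expected_cost_def
    by (subst nn_integral_add[symmetric]) (auto intro!: nn_integral_cong simp: indicator_def)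
  have 2: "expected_cost N z = R + (\<integral>\<^sup>+w. indicator E w * e2ennreal (tcost N (y w) w) \<partial>M)"
    unfolding R_def expected_cost_def
    by (subst nn_integral_add[symmetric]) (auto intro!: nn_integral_cong simp: indicator_def z_def)
  show "(\<integral>\<^sup>+w. indicator E w * e2ennreal (tcost N (x w) w) \<partial>M)
      \<le> (\<integral>\<^sup>+w. indicator E w * e2ennreal (tcost N (y w) w) \<partial>M)"
    using le R unfolding 1 2 ennreal_add_left_cancel_le by auto
qed

lemma cond_tcost:
  assumes nonneg: "\<And>z w. 0 \<le> tcost N z w"
    and s: "s \<in> borel_measurable F" and B: "B \<in> borel_measurable F" and u: "u \<in> borel_measurable G"
  shows "AE w in M. enn2ereal (nn_cond_exp M F (\<lambda>w. e2ennreal (tcost N (s w, B w, u w) w)) w)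
    = ereal (c (B w) - s w + N) + ecexp M F (\<lambda>w. Ha (u w)) w + ecexp M F (\<lambda>w. Hp (residual (s w) (B w) (u w) w)) w"
proof -
  obtain ba where ba: "ba \<le> 0" "\<And>x. ereal ba \<le> Ha x" using a.loss_bound by blast
  obtain bp where bp: "bp \<le> 0" "\<And>x. ereal bp \<le> Hp x" using p.loss_bound by blast
  note s [measurable] B [measurable] u [measurable]
  note G_M[OF measurable_residual[OF s B u], measurable] G_M[OF u, measurable]
  show ?thesis unfolding tcost_def fst_conv snd_conv
  proof (rule a.nn_cond_exp_add_ecexp[OF _ _ _ ba(1) _ bp(1)])
    show "0 \<le> ereal (c (B w) - s w + N) + Ha (u w) + Hp (residual (s w) (B w) (u w) w)" for w
      using nonneg[of "(s w, B w, u w)" w] unfolding tcost_def by simp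
  qed (auto simp: ba bp)
qed

text \<open>Conditional optimality extends from bounded strategies to all measurable ones by
  \<open>strategies_dominate\<close>. The two expected losses are returned as bounded real variables
  because they become the parties' values.\<close>

lemma optimal_strategy:
  "\<exists>K s A r a p. s \<in> borel_measurable F \<and> A \<in> borel_measurable F \<and> r \<in> borel_measurable G
    \<and> a \<in> borel_measurable F \<and> p \<in> borel_measurable F
    \<and> (\<forall>w. \<bar>s w\<bar> \<le> K \<and> norm (A w) \<le> K \<and> \<bar>r w\<bar> \<le> K \<and> \<bar>a w\<bar> \<le> K \<and> \<bar>p w\<bar> \<le> K)
    \<and> (AE w in M. ecexp M F (\<lambda>w. Ha (r w)) w = ereal (a w))
    \<and> (AE w in M. ecexp M F (\<lambda>w. Hp (residual (s w) (A w) (r w) w)) w = ereal (p w))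
    \<and> (\<forall>t\<in>borel_measurable F. \<forall>B\<in>borel_measurable F. \<forall>u\<in>borel_measurable G.
        AE w in M. ereal (c (A w) - s w + a w + p w)
          \<le> ereal (c (B w) - t w) + ecexp M F (\<lambda>w. Ha (u w)) w + ecexp M F (\<lambda>w. Hp (residual (t w) (B w) (u w) w)) w)"
proof -
  obtain ba where ba: "ba \<le> 0" "\<And>x. ereal ba \<le> Ha x" using a.loss_bound by blast
  obtain bp where bp: "bp \<le> 0" "\<And>x. ereal bp \<le> Hp x" using p.loss_bound by blast
  obtain xa where xa: "Ha xa = ereal xa" using a.fixed_point by blast
  obtain xp where xp: "Hp xp = ereal xp" using p.fixed_point by blast
  obtain C where C: "\<And>B. 0 * norm B - C \<le> c B" using c_lower_bound by blast
  obtain e N where e: "0 < e" and coer: "\<And>s B u w. ereal (norm B + e * \<bar>s\<bar> - N) \<le> cost s B u w"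
    using cost_coercive by blast
  obtain S L Q where dom: "\<And>s B u. s \<in> borel_measurable F \<Longrightarrow> B \<in> borel_measurable F \<Longrightarrow> u \<in> borel_measurable G \<Longrightarrow>
     \<exists>x\<in>strategies S L Q. \<forall>w. cost (fst (x w)) (fst (snd (x w))) (snd (snd (x w))) w \<le> cost (s w) (B w) (u w) w"
    using strategies_dominate by blast
  have nonneg: "0 \<le> tcost N z w" for z w
  proof -
    have "ereal (- N) \<le> ereal (norm (fst (snd z)) + e * \<bar>fst z\<bar> - N)" using e by simp
    also have "\<dots> \<le> cost (fst z) (fst (snd z)) (snd (snd z)) w" by (rule coer)
    finally show ?thesis unfolding tcost_eq by (cases "cost (fst z) (fst (snd z)) (snd (snd z)) w") auto
  qed
  obtain x0 where x0: "x0 \<in> strategies S L Q"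
    "\<And>w. cost (fst (x0 w)) (fst (snd (x0 w))) (snd (snd (x0 w))) w \<le> cost (xa + xp - \<kappa>) 0 xa w"
    using dom[of "\<lambda>_. xa + xp - \<kappa>" "\<lambda>_. 0" "\<lambda>_. xa"] by auto
  obtain x where x: "x \<in> strategies S L Q" and opt: "\<And>y. y \<in> strategies S L Q \<Longrightarrow> expected_cost N x \<le> expected_cost N y"
    using strategies_minimizer[OF _ nonneg, of S L Q] x0(1) by blast
  have "expected_cost N x0 \<le> (\<integral>\<^sup>+w. ennreal (c 0 + \<kappa> + N) \<partial>M)"
    unfolding expected_cost_def
  proof (rule nn_integral_mono)
    fix w
    have "tcost N (x0 w) w \<le> ereal (c 0 + \<kappa>) + ereal N"
      unfolding tcost_eq by (intro add_right_mono order_trans[OF x0(2)] cost_base[OF xa xp])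
    then show "e2ennreal (tcost N (x0 w) w) \<le> ennreal (c 0 + \<kappa> + N)" using e2ennreal_mono by fastforce
  qed
  also have "\<dots> < \<infinity>" by (simp add: emeasure_space_1)
  finally have fin: "expected_cost N x < \<infinity>" using opt[OF x0(1)] by order
  define s where "s w = fst (x w)" for w
  define A where "A w = fst (snd (x w))" for w
  define r where "r w = snd (snd (x w))" for w
  have x_eq: "x w = (s w, A w, r w)" for w by (simp add: s_def A_def r_def)
  have s: "s \<in> borel_measurable F" and A: "A \<in> borel_measurable F" and r: "r \<in> borel_measurable G"
    and bnd: "\<And>w. \<bar>s w\<bar> \<le> S" "\<And>w. norm (A w) \<le> L" "\<And>w. \<bar>r w\<bar> \<le> Q"
    using strategiesD[OF x] unfolding s_def[abs_def] A_def[abs_def] r_def[abs_def] by auto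
  define \<alpha> where "\<alpha> = ecexp M F (\<lambda>w. Ha (r w))"
  define \<pi> where "\<pi> = ecexp M F (\<lambda>w. Hp (residual (s w) (A w) (r w) w))"
  have opt': "AE w in M. ereal (c (A w) - s w) + \<alpha> w + \<pi> w
       \<le> ereal (c (B w) - t w) + ecexp M F (\<lambda>w. Ha (u w)) w + ecexp M F (\<lambda>w. Hp (residual (t w) (B w) (u w) w)) w"
    if t: "t \<in> borel_measurable F" and B: "B \<in> borel_measurable F" and u: "u \<in> borel_measurable G" for t B u
  proof -
    obtain y where y: "y \<in> strategies S L Q"
      "\<And>w. cost (fst (y w)) (fst (snd (y w))) (snd (snd (y w))) w \<le> cost (t w) (B w) (u w) w"
      using dom[OF t B u] by blast
    have yM: "(\<lambda>w. tcost N (y w) w) \<in> borel_measurable M"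
      using y(1) by (auto intro!: measurable_tcost strategiesD(1-3))
    have tM: "(\<lambda>w. tcost N (t w, B w, u w) w) \<in> borel_measurable M"
      by (rule measurable_tcost) (simp_all add: t B u)
    note yM [measurable] tM [measurable]
    have le: "tcost N (y w) w \<le> tcost N (t w, B w, u w) w" for w
      unfolding tcost_eq fst_conv snd_conv by (intro add_right_mono y(2))
    have "AE w in M. nn_cond_exp M F (\<lambda>w. e2ennreal (tcost N (y w) w)) w
        \<le> nn_cond_exp M F (\<lambda>w. e2ennreal (tcost N (t w, B w, u w) w)) w"
      by (rule a.nn_cond_exp_mono, rule AE_I2, rule e2ennreal_mono, rule le) measurable
    moreover have "AE w in M. nn_cond_exp M F (\<lambda>w. e2ennreal (tcost N (x w) w)) w
        \<le> nn_cond_exp M F (\<lambda>w. e2ennreal (tcost N (y w) w)) w"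
      by (rule strategies_cond_optimal[OF x y(1) opt fin])
    moreover note cond_tcost[OF nonneg t B u]
    moreover note cond_tcost[OF nonneg s A r, folded x_eq]
    ultimately show ?thesis
    proof eventually_elim
      case (elim w)
      have "enn2ereal (nn_cond_exp M F (\<lambda>w. e2ennreal (tcost N (x w) w)) w)
          \<le> enn2ereal (nn_cond_exp M F (\<lambda>w. e2ennreal (tcost N (t w, B w, u w) w)) w)"
        using order_trans[OF elim(2,1)] by (simp add: less_eq_ennreal.rep_eq)
      then have le: "ereal (c (A w) - s w + N) + \<alpha> w + \<pi> w
         \<le> ereal (c (B w) - t w + N) + ecexp M F (\<lambda>w. Ha (u w)) w + ecexp M F (\<lambda>w. Hp (residual (t w) (B w) (u w) w)) w"
        unfolding elim(3,4) \<alpha>_def \<pi>_def .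
      have cancel: "ereal a + x + y \<le> ereal b + x' + y'" if "ereal (a + N) + x + y \<le> ereal (b + N) + x' + y'"
        for a b x y x' y'
        using that by (cases x; cases y; cases x'; cases y') auto
      show ?case by (rule cancel[OF le])
    qed
  qed
  have [measurable]: "r \<in> borel_measurable M" "(\<lambda>w. residual (s w) (A w) (r w) w) \<in> borel_measurable M"
    using G_M[OF r] G_M[OF measurable_residual[OF s A r]] by auto
  have \<alpha>_lower: "AE w in M. ereal ba \<le> \<alpha> w" unfolding \<alpha>_def by (rule a.ecexp_ge) (auto simp: ba)
  have \<pi>_lower: "AE w in M. ereal bp \<le> \<pi> w" unfolding \<pi>_def by (rule a.ecexp_ge) (auto simp: bp)
  \<comment> \<open>Comparison with the reference strategy bounds the total from above. As effort
    cost, level and both losses are bounded below, each expected loss is then bounded above by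
    itself.\<close>
  have "AE w in M. ereal (c (A w) - s w) + \<alpha> w + \<pi> w \<le> ereal (c 0 + \<kappa>)"
  proof -
    let ?v = "\<lambda>w. residual (xa + xp - \<kappa>) 0 xa w"
    have [measurable]: "?v \<in> borel_measurable M"
      using G_M[OF measurable_residual[of "\<lambda>_. xa + xp - \<kappa>" "\<lambda>_. 0" "\<lambda>_. xa"]] by simp
    have "AE w in M. ecexp M F (\<lambda>w. Hp (?v w)) w \<le> ecexp M F (\<lambda>_. ereal xp) w"
    proof (rule a.ecexp_mono)
      show "AE w in M. Hp (?v w) \<le> ereal xp"
      proof (rule AE_I2)
        fix w
        have "?v w \<le> xp" using h(2)[of w] unfolding residual_def by auto
        then show "Hp (?v w) \<le> ereal xp" using p.mono_H xp by metis
      qed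
    qed auto
    moreover have "AE w in M. ecexp M F (\<lambda>_. ereal xp) w = ereal xp" by (rule a.ecexp_F_meas) simp
    moreover have "AE w in M. ecexp M F (\<lambda>_. Ha xa) w = ereal xa" unfolding xa by (rule a.ecexp_F_meas) simp
    moreover have "AE w in M. ereal (c (A w) - s w) + \<alpha> w + \<pi> w
        \<le> ereal (c 0 - (xa + xp - \<kappa>)) + ecexp M F (\<lambda>_. Ha xa) w + ecexp M F (\<lambda>w. Hp (?v w)) w"
      by (rule opt') auto
    ultimately show ?thesis
    proof eventually_elim
      case (elim w)
      note elim(4)
      also have "ereal (c 0 - (xa + xp - \<kappa>)) + ecexp M F (\<lambda>_. Ha xa) w + ecexp M F (\<lambda>w. Hp (?v w)) w
          \<le> ereal (c 0 - (xa + xp - \<kappa>)) + ereal xa + ereal xp"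
        using elim(1,2,3) by (intro add_mono) auto
      also have "\<dots> = ereal (c 0 + \<kappa>)" by simp
      finally show "ereal (c (A w) - s w) + \<alpha> w + \<pi> w \<le> ereal (c 0 + \<kappa>)" .
    qed
  qed
  then have both: "AE w in M. (ereal ba \<le> \<alpha> w \<and> \<alpha> w \<le> ereal (c 0 + \<kappa> + C + S - bp))
       \<and> (ereal bp \<le> \<pi> w \<and> \<pi> w \<le> ereal (c 0 + \<kappa> + C + S - ba))"
    using \<alpha>_lower \<pi>_lower
  proof eventually_elim
    case (elim w)
    have "- C - S \<le> c (A w) - s w" using C[of "A w"] bnd(1)[of w] by simp
    then show ?case using elim by (cases "\<alpha> w"; cases "\<pi> w") auto
  qed
  have "\<alpha> \<in> borel_measurable F" "AE w in M. ereal ba \<le> \<alpha> w \<and> \<alpha> w \<le> ereal (c 0 + \<kappa> + C + S - bp)"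
    using both by (simp_all add: \<alpha>_def)
  from bounded_cond_value[OF this] obtain a where a: "a \<in> borel_measurable F" "AE w in M. \<alpha> w = ereal (a w)"
      "\<And>w. \<bar>a w\<bar> \<le> \<bar>ba\<bar> + \<bar>c 0 + \<kappa> + C + S - bp\<bar>"
    by blast
  have "\<pi> \<in> borel_measurable F" "AE w in M. ereal bp \<le> \<pi> w \<and> \<pi> w \<le> ereal (c 0 + \<kappa> + C + S - ba)"
    using both by (simp_all add: \<pi>_def)
  from bounded_cond_value[OF this] obtain p where p: "p \<in> borel_measurable F" "AE w in M. \<pi> w = ereal (p w)"
      "\<And>w. \<bar>p w\<bar> \<le> \<bar>bp\<bar> + \<bar>c 0 + \<kappa> + C + S - ba\<bar>"
    by blast
  define K where "K = Max {S, L, Q, \<bar>ba\<bar> + \<bar>c 0 + \<kappa> + C + S - bp\<bar>, \<bar>bp\<bar> + \<bar>c 0 + \<kappa> + C + S - ba\<bar>}"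
  have K: "S \<le> K" "L \<le> K" "Q \<le> K" "\<bar>ba\<bar> + \<bar>c 0 + \<kappa> + C + S - bp\<bar> \<le> K" "\<bar>bp\<bar> + \<bar>c 0 + \<kappa> + C + S - ba\<bar> \<le> K"
    unfolding K_def by (rule Max_ge; simp)+
  show ?thesis
  proof (intro exI[of _ K], rule exI[of _ s], rule exI[of _ A], rule exI[of _ r], rule exI[of _ a], rule exI[of _ p], intro conjI allI ballI s A r a(1) p(1))
    fix w
    show "\<bar>s w\<bar> \<le> K" by (rule order_trans[OF bnd(1) K(1)])
    show "norm (A w) \<le> K" by (rule order_trans[OF bnd(2) K(2)])
    show "\<bar>r w\<bar> \<le> K" by (rule order_trans[OF bnd(3) K(3)])
    show "\<bar>a w\<bar> \<le> K" by (rule order_trans[OF a(3) K(4)])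
    show "\<bar>p w\<bar> \<le> K" by (rule order_trans[OF p(3) K(5)])
  next
    show "AE w in M. ecexp M F (\<lambda>w. Ha (r w)) w = ereal (a w)" using a(2) unfolding \<alpha>_def .
    show "AE w in M. ecexp M F (\<lambda>w. Hp (residual (s w) (A w) (r w) w)) w = ereal (p w)" using p(2) unfolding \<pi>_def .
  next
    fix t :: "'a \<Rightarrow> real" and B :: "'a \<Rightarrow> real^'n" and u :: "'a \<Rightarrow> real"
    assume "t \<in> borel_measurable F" "B \<in> borel_measurable F" "u \<in> borel_measurable G"
    from opt'[OF this] a(2) p(2)
    show "AE w in M. ereal (c (A w) - s w + a w + p w)
          \<le> ereal (c (B w) - t w) + ecexp M F (\<lambda>w. Ha (u w)) w + ecexp M F (\<lambda>w. Hp (residual (t w) (B w) (u w) w)) w"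
      by eventually_elim simp
  qed
qed

end

subsection \<open>The first-best bound\<close>

text \<open>Reduces the bound for unbounded positions to bounded ones without interchanging a supremum with a
  limit: both lower truncation levels tend to \<open>-\<infinity>\<close> before the upper ones tend to \<open>\<infinity>\<close>.\<close>

lemma trunc_add_le:
  assumes le: "xa + xp \<le> ereal y" and fin: "xa < \<infinity>" "xp < \<infinity>" and y: "\<bar>y\<bar> \<le> m"
    and k: "real n' + m \<le> real k" "real n + m \<le> real k'"
  shows "trunc n k xa + trunc n' k' xp \<le> y"
proof -
  have up: "trunc n k x \<le> real n" for n k x
    unfolding trunc_def by (cases x) (auto simp: max_def min_def)
  have low: "trunc n k x = - real k" if "x \<le> ereal (- real k)" for n k x
    unfolding trunc_def using that by (cases x) (auto simp: max_def min_def)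
  have id: "trunc n k (ereal r) \<le> r" if "- real k \<le> r" for n k r
    unfolding trunc_def using that by (auto simp: max_def min_def)
  \<comment> \<open>If one position lies below its lower truncation level, that level outweighs the
    other's upper one: \<open>- real k + real n' \<le> - m \<le> y\<close>. Otherwise truncation
    only lowers both positions.\<close>
  consider "xa \<le> ereal (- real k)" | "xp \<le> ereal (- real k')" | "ereal (- real k) < xa" "ereal (- real k') < xp"
    by fastforce
  then show ?thesis
  proof cases
    case 1 then show ?thesis using low[OF 1, of n] up[of n' k' xp] k y by linarith
  next
    case 2 then show ?thesis using low[OF 2, of n'] up[of n k xa] k y by linarith
  next
    case 3
    then obtain ra rp where r: "xa = ereal ra" "xp = ereal rp" using fin by (cases xa; cases xp) auto
    have "trunc n k xa \<le> ra" "trunc n' k' xp \<le> rp" using 3 r id[of k ra n] id[of k' rp n'] by auto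
    then show ?thesis using le r by simp
  qed
qed

text \<open>The symmetric way to bound a sum: unlike \<open>x + y \<le> ereal q\<close>, it remains
  true for opposite infinities. Suprema and limits can thus be taken in one variable while the other
  stays on the right.\<close>

lemma ereal_le_minus_swap: "x \<le> ereal q - y \<longleftrightarrow> y \<le> ereal q - x"
  by (cases x; cases y) auto

context one_step
begin

text \<open>Every pair of levels and positions yields a competitor in the minimisation, so
  minimality of \<open>- V\<close> bounds the sum of the two payoffs. \<open>K\<close> is cash known
  at time t, and \<open>D\<close> localises to a set where truncated positions satisfy the
  budget.\<close>

lemma payoffs_le:
  fixes Xa Xp K :: "'a \<Rightarrow> real"
  assumes opt: "\<And>t B u. t \<in> borel_measurable F \<Longrightarrow> B \<in> borel_measurable F \<Longrightarrow> u \<in> borel_measurable G \<Longrightarrow>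
      AE w in M. ereal (- V w) \<le> ereal (c (B w) - t w) + ecexp M F (\<lambda>w. Ha (u w)) w
        + ecexp M F (\<lambda>w. Hp (residual (t w) (B w) (u w) w)) w"
    and Xa: "Xa \<in> borel_measurable G" and Xp: "Xp \<in> borel_measurable G"
    and K: "K \<in> borel_measurable F" and B: "B \<in> borel_measurable F" and D: "D \<in> sets F"
    and le: "AE w in M. w \<in> D \<longrightarrow> Xa w + Xp w \<le> K w + h w + B w \<bullet> dP w"
  shows "AE w in M. w \<in> D \<longrightarrow> a.payoff sa Xa w \<le> ereal (K w + c (B w) + V w) - p.payoff sp Xp w"
proof -
  obtain ba where ba: "ba \<le> 0" "\<And>x. ereal ba \<le> Ha x" using a.loss_bound by blast
  obtain bp where bp: "bp \<le> 0" "\<And>x. ereal bp \<le> Hp x" using p.loss_bound by blast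
  \<comment> \<open>With this level and \<open>u = sa - Xa\<close> the residual is
    \<open>sp - (K + h + B dP - Xa)\<close>, which on \<open>D\<close> is at most
    \<open>sp - Xp\<close>.\<close>
  define t where "t w = sa + sp - K w" for w
  define u where "u w = sa - Xa w" for w
  note K [measurable] B [measurable]
  have t: "t \<in> borel_measurable F" unfolding t_def by measurable
  have u: "u \<in> borel_measurable G" unfolding u_def using Xa by measurable
  note G_M[OF measurable_residual[OF t B u], measurable] G_M[OF Xa, measurable] G_M[OF Xp, measurable]
  have "AE w in M. w \<in> D \<longrightarrow> ecexp M F (\<lambda>w. Hp (residual (t w) (B w) (u w) w)) w \<le> ecexp M F (\<lambda>w. Hp (sp - Xp w)) w"
  proof (rule a.ecexp_mono_on[OF D])
    show "AE w in M. w \<in> D \<longrightarrow> Hp (residual (t w) (B w) (u w) w) \<le> Hp (sp - Xp w)"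
      using le by eventually_elim (auto simp: residual_def t_def u_def intro!: p.mono_H)
  qed measurable
  moreover have "AE w in M. ereal ba \<le> ecexp M F (\<lambda>w. Ha (sa - Xa w)) w" by (rule a.ecexp_ge) (auto simp: ba)
  moreover have "AE w in M. ereal bp \<le> ecexp M F (\<lambda>w. Hp (sp - Xp w)) w" by (rule a.ecexp_ge) (auto simp: bp)
  moreover note opt[OF t B u]
  ultimately show ?thesis
  proof eventually_elim
    case (elim w)
    show ?case
    proof
      assume w: "w \<in> D"
      define x where "x = ecexp M F (\<lambda>w. Ha (sa - Xa w)) w"
      define y where "y = ecexp M F (\<lambda>w. Hp (sp - Xp w)) w"
      have "ereal (- V w) \<le> ereal (c (B w) - t w) + x + ecexp M F (\<lambda>w. Hp (residual (t w) (B w) (u w) w)) w"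
        using elim(4) unfolding x_def u_def .
      also have "\<dots> \<le> ereal (c (B w) - t w) + x + y"
        using elim(1) w unfolding y_def by (intro add_left_mono) auto
      finally have "ereal (- V w) \<le> ereal (c (B w) - t w) + x + y" .
      then have "ereal sa - x \<le> ereal (K w + c (B w) + V w) - (ereal sp - y)"
        using elim(2,3) unfolding x_def[symmetric] y_def[symmetric] t_def by (cases x; cases y) auto
      then show "a.payoff sa Xa w \<le> ereal (K w + c (B w) + V w) - p.payoff sp Xp w"
        unfolding a.payoff_def p.payoff_def x_def y_def .
    qed
  qed
qed

text \<open>The suprema over the two levels are taken one after the other, with
  \<open>ereal_le_minus_swap\<close> exchanging the roles in between.\<close>

lemma oce1_le_minus:
  fixes Xa Xp K V :: "'a \<Rightarrow> real"
  assumes opt: "\<And>t B u. t \<in> borel_measurable F \<Longrightarrow> B \<in> borel_measurable F \<Longrightarrow> u \<in> borel_measurable G \<Longrightarrow>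
      AE w in M. ereal (- V w) \<le> ereal (c (B w) - t w) + ecexp M F (\<lambda>w. Ha (u w)) w
        + ecexp M F (\<lambda>w. Hp (residual (t w) (B w) (u w) w)) w"
    and V: "V \<in> borel_measurable F"
    and Xa: "Xa \<in> borel_measurable G" and Xp: "Xp \<in> borel_measurable G"
    and K: "K \<in> borel_measurable F" and B: "B \<in> borel_measurable F" and D: "D \<in> sets F"
    and le: "AE w in M. w \<in> D \<longrightarrow> Xa w + Xp w \<le> K w + h w + B w \<bullet> dP w"
    and Ya: "oce1 M F Ha Xa Ya" and Yp: "oce1 M F Hp Xp Yp"
  shows "AE w in M. w \<in> D \<longrightarrow> Ya w \<le> ereal (K w + c (B w) + V w) - Yp w"
proof -
  note V [measurable] K [measurable] B [measurable]
  have [measurable]: "Ya \<in> borel_measurable F" using Ya unfolding a.oce1_alt by blast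
  have "AE w in M. w \<in> D \<longrightarrow> Ya w \<le> ereal (K w + c (B w) + V w) - p.payoff sp Xp w" for sp
    by (rule a.oce1_le_on[OF Ya D]) (measurable, rule payoffs_le[OF opt Xa Xp K B D le])
  then have "AE w in M. w \<in> D \<longrightarrow> p.payoff sp Xp w \<le> ereal (K w + c (B w) + V w) - Ya w" for sp
    by (subst ereal_le_minus_swap)
  then have "AE w in M. w \<in> D \<longrightarrow> Yp w \<le> ereal (K w + c (B w) + V w) - Ya w"
    by (intro p.oce1_le_on[OF Yp D]) measurable
  then show ?thesis by (subst ereal_le_minus_swap)
qed

lemma oce_add_le:
  fixes Xa Xp :: "'a \<Rightarrow> ereal" and K V :: "'a \<Rightarrow> real"
  assumes opt: "\<And>t B u. t \<in> borel_measurable F \<Longrightarrow> B \<in> borel_measurable F \<Longrightarrow> u \<in> borel_measurable G \<Longrightarrow>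
      AE w in M. ereal (- V w) \<le> ereal (c (B w) - t w) + ecexp M F (\<lambda>w. Ha (u w)) w
        + ecexp M F (\<lambda>w. Hp (residual (t w) (B w) (u w) w)) w"
    and V: "V \<in> borel_measurable F"
    and Xa: "Xa \<in> borel_measurable G" "AE w in M. Xa w < \<infinity>" and Xp: "Xp \<in> borel_measurable G" "AE w in M. Xp w < \<infinity>"
    and K: "K \<in> borel_measurable F" and B: "B \<in> borel_measurable F"
    and le: "AE w in M. Xa w + Xp w \<le> ereal (K w + h w + B w \<bullet> dP w)"
    and Ya: "oce M F Ha Xa Ya" and Yp: "oce M F Hp Xp Yp"
  shows "AE w in M. Ya w + Yp w \<le> ereal (K w + c (B w) + V w)"
proof -
  obtain Yda Za where Yda: "\<And>n k. oce1 M F Ha (\<lambda>w. trunc n k (Xa w)) (Yda n k)"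
    and Za: "\<And>n. AE w in M. (\<lambda>k. Yda n k w) \<longlonglongrightarrow> Za n w" and Za': "AE w in M. (\<lambda>n. Za n w) \<longlonglongrightarrow> Ya w"
    using Ya unfolding oce_alt by blast
  obtain Ydp Zp where Ydp: "\<And>n k. oce1 M F Hp (\<lambda>w. trunc n k (Xp w)) (Ydp n k)"
    and Zp: "\<And>n. AE w in M. (\<lambda>k. Ydp n k w) \<longlonglongrightarrow> Zp n w" and Zp': "AE w in M. (\<lambda>n. Zp n w) \<longlonglongrightarrow> Yp w"
    using Yp unfolding oce_alt by blast
  note K [measurable] B [measurable] Xa(1) [measurable] Xp(1) [measurable]
  \<comment> \<open>\<open>K\<close> and \<open>B\<close> may be unbounded, but truncation needs one
    bound \<open>m\<close> on the budget. The \<open>F\<close>-sets \<open>D j\<close> exhaust the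
    space and provide it locally.\<close>
  define D where "D j = {w \<in> space F. \<bar>K w\<bar> \<le> real j \<and> norm (B w) \<le> real j}" for j :: nat
  define m where "m j = real j + \<kappa> + \<rho> * real j" for j :: nat
  have D [measurable]: "D j \<in> sets F" for j unfolding D_def by measurable
  have \<rho>: "0 \<le> \<rho>" using dP(2)[of undefined] norm_ge_zero order_trans by blast
  have mD: "\<bar>K w + h w + B w \<bullet> dP w\<bar> \<le> m j" if "w \<in> D j" for w j
  proof -
    have "\<rho> * norm (B w) \<le> \<rho> * real j" using that \<rho> by (intro mult_left_mono) (auto simp: D_def)
    then have "\<bar>B w \<bullet> dP w\<bar> \<le> \<rho> * real j" using inner_dP[of "B w" w] by linarith
    moreover have "\<bar>K w\<bar> \<le> real j" using that by (simp add: D_def)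
    ultimately show ?thesis using h(2)[of w] unfolding m_def by linarith
  qed
  define W where "W w = K w + c (B w) + V w" for w
  have "AE w in M. real n' + m j \<le> real k \<longrightarrow> real n + m j \<le> real k' \<longrightarrow> w \<in> D j \<longrightarrow> Yda n k w \<le> ereal (W w) - Ydp n' k' w"
    for n n' k k' j
  proof (cases "real n' + m j \<le> real k \<and> real n + m j \<le> real k'")
    case True
    have "AE w in M. w \<in> D j \<longrightarrow> Yda n k w \<le> ereal (W w) - Ydp n' k' w"
      unfolding W_def
    proof (rule oce1_le_minus[OF opt V measurable_compose[OF Xa(1) measurable_trunc] measurable_compose[OF Xp(1) measurable_trunc] K B D _ Yda Ydp])
      show "AE w in M. w \<in> D j \<longrightarrow> trunc n k (Xa w) + trunc n' k' (Xp w) \<le> K w + h w + B w \<bullet> dP w"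
        using le Xa(2) Xp(2)
      proof eventually_elim
        case (elim w)
        then show ?case using trunc_add_le[OF elim mD] True by blast
      qed
    qed
    then show ?thesis by eventually_elim auto
  qed auto
  then have "AE w in M. \<forall>n n' k k' j. real n' + m j \<le> real k \<longrightarrow> real n + m j \<le> real k' \<longrightarrow> w \<in> D j \<longrightarrow> Yda n k w \<le> ereal (W w) - Ydp n' k' w"
    by (simp add: AE_all_countable)
  moreover have "AE w in M. \<forall>n. (\<lambda>k. Yda n k w) \<longlonglongrightarrow> Za n w" using Za by (simp add: AE_all_countable)
  moreover have "AE w in M. \<forall>n. (\<lambda>k. Ydp n k w) \<longlonglongrightarrow> Zp n w" using Zp by (simp add: AE_all_countable)
  moreover have "AE w in M. Ya w < \<infinity>" by (rule a.oce_finite[OF Ya G_M[OF Xa(1)] Xa(2)])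
  moreover have "AE w in M. Yp w < \<infinity>" by (rule p.oce_finite[OF Yp G_M[OF Xp(1)] Xp(2)])
  ultimately show ?thesis using Za' Zp' AE_space
  proof eventually_elim
    case (elim w)
    obtain j :: nat where "max \<bar>K w\<bar> (norm (B w)) \<le> real j" using real_arch_simple by blast
    then have j: "w \<in> D j" using elim(8) by (simp add: D_def a.space_F)
    \<comment> \<open>The limits are taken in the order \<open>k\<close>, \<open>k'\<close>,
      \<open>n\<close>, \<open>n'\<close>. Both lower levels can exceed their thresholds because
      these involve only the upper levels, which are still fixed.\<close>
    have 1: "Za n w \<le> ereal (W w) - Ydp n' k' w" if k': "real n + m j \<le> real k'" for n n' k'
    proof (rule LIMSEQ_le_const2[OF elim(2)[rule_format]])
      obtain k0 :: nat where "real n' + m j \<le> real k0" using real_arch_simple by blast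
      then show "\<exists>N. \<forall>k\<ge>N. Yda n k w \<le> ereal (W w) - Ydp n' k' w"
        using elim(1) k' j by (intro exI[of _ k0]) (meson of_nat_mono order_trans)
    qed
    have swap1: "Ydp n' k' w \<le> ereal (W w) - Za n w" if "real n + m j \<le> real k'" for n n' k'
      using 1[OF that] by (subst ereal_le_minus_swap)
    have 2: "Zp n' w \<le> ereal (W w) - Za n w" for n n'
    proof (rule LIMSEQ_le_const2[OF elim(3)[rule_format]])
      obtain k0 :: nat where "real n + m j \<le> real k0" using real_arch_simple by blast
      then show "\<exists>N. \<forall>k\<ge>N. Ydp n' k w \<le> ereal (W w) - Za n w"
        using swap1 by (intro exI[of _ k0]) (meson of_nat_mono order_trans)
    qed
    then have swap2: "Za n w \<le> ereal (W w) - Zp n' w" for n n' by (subst ereal_le_minus_swap)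
    have 3: "Ya w \<le> ereal (W w) - Zp n' w" for n'
      using swap2 by (intro LIMSEQ_le_const2[OF elim(6)] exI allI impI)
    then have swap3: "Zp n' w \<le> ereal (W w) - Ya w" for n' by (subst ereal_le_minus_swap)
    then have "Yp w \<le> ereal (W w) - Ya w"
      by (intro LIMSEQ_le_const2[OF elim(7)] exI allI impI)
    then show ?case using elim(4,5) unfolding W_def by (cases "Ya w"; cases "Yp w") auto
  qed
qed

end

text \<open>All that the dynamic argument needs from one period: a lower bound for each party and a
  joint upper bound, with \<open>K\<close> the cash known at the start of the period. The lower
  bounds assume only that positions dominate the optimal ones, since backward induction yields
  continuation values only up to inequality.\<close>

definition step_solution :: "'a measure \<Rightarrow> 'a measure \<Rightarrow> 'a measure \<Rightarrow> (real \<Rightarrow> ereal) \<Rightarrow> (real \<Rightarrow> ereal)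
    \<Rightarrow> (real^'n::finite \<Rightarrow> real) \<Rightarrow> ('a \<Rightarrow> real) \<Rightarrow> ('a \<Rightarrow> real^'n) \<Rightarrow> ('a \<Rightarrow> real^'n) \<Rightarrow> ('a \<Rightarrow> real)
    \<Rightarrow> ('a \<Rightarrow> real) \<Rightarrow> ('a \<Rightarrow> real) \<Rightarrow> bool" where
  "step_solution M F G Ha Hp c h dP A \<Gamma> va vp \<longleftrightarrow>
     A \<in> borel_measurable F \<and> \<Gamma> \<in> borel_measurable G \<and> va \<in> borel_measurable F \<and> vp \<in> borel_measurable F
   \<and> (\<exists>b. \<forall>w. norm (A w) \<le> b \<and> \<bar>\<Gamma> w\<bar> \<le> b \<and> \<bar>va w\<bar> \<le> b \<and> \<bar>vp w\<bar> \<le> b \<and> \<bar>c (A w)\<bar> \<le> b)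
   \<and> (\<forall>K k X Y. K \<in> borel_measurable F \<longrightarrow> (AE w in M. \<bar>K w\<bar> \<le> k) \<longrightarrow> X \<in> borel_measurable M
        \<longrightarrow> (AE w in M. ereal (K w + \<Gamma> w) \<le> X w) \<longrightarrow> oce M F Ha X Y \<longrightarrow> (AE w in M. ereal (K w + va w) \<le> Y w))
   \<and> (\<forall>K k X Y. K \<in> borel_measurable F \<longrightarrow> (AE w in M. \<bar>K w\<bar> \<le> k) \<longrightarrow> X \<in> borel_measurable M
        \<longrightarrow> (AE w in M. ereal (h w + A w \<bullet> dP w - \<Gamma> w - K w) \<le> X w) \<longrightarrow> oce M F Hp X Y
        \<longrightarrow> (AE w in M. ereal (vp w - K w) \<le> Y w))
   \<and> (\<forall>K B Xa Xp Ya Yp. K \<in> borel_measurable F \<longrightarrow> B \<in> borel_measurable F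
        \<longrightarrow> Xa \<in> borel_measurable G \<longrightarrow> (AE w in M. Xa w < \<infinity>) \<longrightarrow> Xp \<in> borel_measurable G \<longrightarrow> (AE w in M. Xp w < \<infinity>)
        \<longrightarrow> (AE w in M. Xa w + Xp w \<le> ereal (K w + h w + B w \<bullet> dP w)) \<longrightarrow> oce M F Ha Xa Ya \<longrightarrow> oce M F Hp Xp Yp
        \<longrightarrow> (AE w in M. Ya w + Yp w \<le> ereal (K w + c (B w) + (va w - c (A w) + vp w))))"

lemma step_solutionD:
  assumes "step_solution M F G Ha Hp c h dP A \<Gamma> va vp"
  shows "A \<in> borel_measurable F" "\<Gamma> \<in> borel_measurable G" "va \<in> borel_measurable F" "vp \<in> borel_measurable F"
    "\<exists>b. \<forall>w. norm (A w) \<le> b \<and> \<bar>\<Gamma> w\<bar> \<le> b \<and> \<bar>va w\<bar> \<le> b \<and> \<bar>vp w\<bar> \<le> b \<and> \<bar>c (A w)\<bar> \<le> b"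
  using assms unfolding step_solution_def by blast+

lemma step_solution_agent_ge:
  assumes "step_solution M F G Ha Hp c h dP A \<Gamma> va vp" "K \<in> borel_measurable F" "AE w in M. \<bar>K w\<bar> \<le> k"
    "X \<in> borel_measurable M" "AE w in M. ereal (K w + \<Gamma> w) \<le> X w" "oce M F Ha X Y"
  shows "AE w in M. ereal (K w + va w) \<le> Y w"
  using assms(1)[unfolded step_solution_def, THEN conjunct2, THEN conjunct2, THEN conjunct2, THEN conjunct2, THEN conjunct2, THEN conjunct1]
    assms(2-) by blast

lemma step_solution_principal_ge:
  assumes "step_solution M F G Ha Hp c h dP A \<Gamma> va vp" "K \<in> borel_measurable F" "AE w in M. \<bar>K w\<bar> \<le> k"
    "X \<in> borel_measurable M" "AE w in M. ereal (h w + A w \<bullet> dP w - \<Gamma> w - K w) \<le> X w" "oce M F Hp X Y"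
  shows "AE w in M. ereal (vp w - K w) \<le> Y w"
  using assms(1)[unfolded step_solution_def, THEN conjunct2, THEN conjunct2, THEN conjunct2, THEN conjunct2, THEN conjunct2, THEN conjunct2, THEN conjunct1]
    assms(2-) by blast

lemma step_solution_add_le:
  assumes "step_solution M F G Ha Hp c h dP A \<Gamma> va vp" "K \<in> borel_measurable F" "B \<in> borel_measurable F"
    "Xa \<in> borel_measurable G" "AE w in M. Xa w < \<infinity>" "Xp \<in> borel_measurable G" "AE w in M. Xp w < \<infinity>"
    "AE w in M. Xa w + Xp w \<le> ereal (K w + h w + B w \<bullet> dP w)" "oce M F Ha Xa Ya" "oce M F Hp Xp Yp"
  shows "AE w in M. Ya w + Yp w \<le> ereal (K w + c (B w) + (va w - c (A w) + vp w))"
  using assms(1)[unfolded step_solution_def, THEN conjunct2, THEN conjunct2, THEN conjunct2, THEN conjunct2, THEN conjunct2, THEN conjunct2, THEN conjunct2]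
    assms(2-) by blast

lemma step_solution_cong_AE:
  assumes sol: "step_solution M F G Ha Hp c h dP' A \<Gamma> va vp" and eq: "AE w in M. dP w = dP' w"
  shows "step_solution M F G Ha Hp c h dP A \<Gamma> va vp"
  unfolding step_solution_def
proof (intro conjI allI impI step_solutionD[OF sol])
  fix K k X Y assume "K \<in> borel_measurable F" "AE w in M. \<bar>K w\<bar> \<le> k" "X \<in> borel_measurable M"
    "AE w in M. ereal (K w + \<Gamma> w) \<le> X w" "oce M F Ha X Y"
  then show "AE w in M. ereal (K w + va w) \<le> Y w" by (rule step_solution_agent_ge[OF sol])
next
  fix K k X Y assume *: "K \<in> borel_measurable F" "AE w in M. \<bar>K w\<bar> \<le> k" "X \<in> borel_measurable M"
    "AE w in M. ereal (h w + A w \<bullet> dP w - \<Gamma> w - K w) \<le> X w" "oce M F Hp X Y"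
  have "AE w in M. ereal (h w + A w \<bullet> dP' w - \<Gamma> w - K w) \<le> X w" using *(4) eq by eventually_elim simp
  then show "AE w in M. ereal (vp w - K w) \<le> Y w" by (rule step_solution_principal_ge[OF sol *(1-3) _ *(5)])
next
  fix K B Xa Xp Ya Yp
  assume *: "K \<in> borel_measurable F" "B \<in> borel_measurable F"
    "Xa \<in> borel_measurable G" "AE w in M. Xa w < \<infinity>" "Xp \<in> borel_measurable G" "AE w in M. Xp w < \<infinity>"
    "AE w in M. Xa w + Xp w \<le> ereal (K w + h w + B w \<bullet> dP w)" "oce M F Ha Xa Ya" "oce M F Hp Xp Yp"
  have "AE w in M. Xa w + Xp w \<le> ereal (K w + h w + B w \<bullet> dP' w)" using *(7) eq by eventually_elim simp
  then show "AE w in M. Ya w + Yp w \<le> ereal (K w + c (B w) + (va w - c (A w) + vp w))"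
    by (rule step_solution_add_le[OF sol *(1-6) _ *(8,9)])
qed

lemma (in one_step) step_solution_exists: "\<exists>A \<Gamma> va vp. step_solution M F G Ha Hp c h dP A \<Gamma> va vp"
proof -
  from optimal_strategy obtain K s A r a p where s: "s \<in> borel_measurable F" and A: "A \<in> borel_measurable F" and r: "r \<in> borel_measurable G"
    and a: "a \<in> borel_measurable F" and p: "p \<in> borel_measurable F"
    and bnd: "\<forall>w. \<bar>s w\<bar> \<le> K \<and> norm (A w) \<le> K \<and> \<bar>r w\<bar> \<le> K \<and> \<bar>a w\<bar> \<le> K \<and> \<bar>p w\<bar> \<le> K"
    and ea: "AE w in M. ecexp M F (\<lambda>w. Ha (r w)) w = ereal (a w)"
    and ep: "AE w in M. ecexp M F (\<lambda>w. Hp (residual (s w) (A w) (r w) w)) w = ereal (p w)"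
    and opt: "\<forall>t\<in>borel_measurable F. \<forall>B\<in>borel_measurable F. \<forall>u\<in>borel_measurable G.
        AE w in M. ereal (c (A w) - s w + a w + p w)
          \<le> ereal (c (B w) - t w) + ecexp M F (\<lambda>w. Ha (u w)) w + ecexp M F (\<lambda>w. Hp (residual (t w) (B w) (u w) w)) w"
    by (elim exE conjE) (rule that)
  \<comment> \<open>The Agent's level is 0 and the Principal's is \<open>s\<close>; each value is
    the level minus the expected loss.\<close>
  define \<Gamma> where "\<Gamma> w = - r w" for w
  define va where "va w = - a w" for w
  define vp where "vp w = s w - p w" for w
  note s [measurable] A [measurable] r [measurable] a [measurable] p [measurable] h(1) [measurable] dP(1) [measurable]
  note F_G[OF s, measurable] F_G[OF A, measurable]
  have "compact (c ` cball 0 K)"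
    by (intro compact_continuous_image continuous_on_subset[OF c_continuous]) auto
  then have "bounded (c ` cball 0 K)" by (rule compact_imp_bounded)
  then obtain m where m: "\<And>x. norm x \<le> K \<Longrightarrow> \<bar>c x\<bar> \<le> m"
    unfolding bounded_iff by (metis imageI mem_cball_0 real_norm_def)
  have "step_solution M F G Ha Hp c h dP A \<Gamma> va vp"
    unfolding step_solution_def
  proof (intro conjI allI impI)
    show "A \<in> borel_measurable F" by (rule A)
    show "\<Gamma> \<in> borel_measurable G" "va \<in> borel_measurable F" "vp \<in> borel_measurable F"
      unfolding \<Gamma>_def va_def vp_def by measurable
    have "norm (A w) \<le> max (2 * K) m \<and> \<bar>\<Gamma> w\<bar> \<le> max (2 * K) m \<and> \<bar>va w\<bar> \<le> max (2 * K) m \<and> \<bar>vp w\<bar> \<le> max (2 * K) m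
       \<and> \<bar>c (A w)\<bar> \<le> max (2 * K) m" for w
    proof -
      have b: "\<bar>s w\<bar> \<le> K" "norm (A w) \<le> K" "\<bar>r w\<bar> \<le> K" "\<bar>a w\<bar> \<le> K" "\<bar>p w\<bar> \<le> K" using bnd[rule_format, of w] by auto
      have "0 \<le> K" using b(1) abs_ge_zero order_trans by blast
      then have "K \<le> max (2 * K) m" by (simp add: le_max_iff_disj)
      moreover have "\<bar>vp w\<bar> \<le> max (2 * K) m"
        using abs_triangle_ineq4[of "s w" "p w"] b(1,5) unfolding vp_def by (simp add: le_max_iff_disj)
      moreover have "\<bar>c (A w)\<bar> \<le> max (2 * K) m" using m[OF b(2)] by (simp add: le_max_iff_disj)
      ultimately show ?thesis using b unfolding \<Gamma>_def va_def by simp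
    qed
    then show "\<exists>b. \<forall>w. norm (A w) \<le> b \<and> \<bar>\<Gamma> w\<bar> \<le> b \<and> \<bar>va w\<bar> \<le> b \<and> \<bar>vp w\<bar> \<le> b \<and> \<bar>c (A w)\<bar> \<le> b" by blast
  next
    fix Kf k X Y
    assume *: "Kf \<in> borel_measurable F" "AE w in M. \<bar>Kf w\<bar> \<le> k" "X \<in> borel_measurable M"
      "AE w in M. ereal (Kf w + \<Gamma> w) \<le> X w" "oce M F Ha X Y"
    \<comment> \<open>Cash shifts the level: with level \<open>Kf\<close> for the Agent, and below
      with \<open>s - Kf\<close> for the Principal, the loss arguments are the same as without
      cash.\<close>
    have "AE w in M. ereal (Kf w) - ecexp M F (\<lambda>w'. Ha (Kf w' - (Kf w' + \<Gamma> w'))) w \<le> Y w"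
    proof (rule a.oce_ge[OF *(5,3) _ *(1,4)])
      have "(\<lambda>w. Kf w + \<Gamma> w) \<in> borel_measurable G" unfolding \<Gamma>_def using F_G[OF *(1)] by measurable
      then show "(\<lambda>w. Kf w + \<Gamma> w) \<in> borel_measurable M" by (rule G_M)
      show "AE w in M. \<bar>Kf w + \<Gamma> w\<bar> \<le> k + K" using *(2)
      proof eventually_elim
        case (elim w) then show ?case using bnd[rule_format, of w] abs_triangle_ineq4[of "Kf w" "r w"] unfolding \<Gamma>_def by simp
      qed
    qed
    moreover have "(\<lambda>w'. Ha (Kf w' - (Kf w' + \<Gamma> w'))) = (\<lambda>w. Ha (r w))" by (simp add: \<Gamma>_def)
    ultimately have "AE w in M. ereal (Kf w) - ecexp M F (\<lambda>w. Ha (r w)) w \<le> Y w" by simp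
    then show "AE w in M. ereal (Kf w + va w) \<le> Y w" using ea by eventually_elim (simp add: va_def)
  next
    fix Kf k X Y
    assume *: "Kf \<in> borel_measurable F" "AE w in M. \<bar>Kf w\<bar> \<le> k" "X \<in> borel_measurable M"
      "AE w in M. ereal (h w + A w \<bullet> dP w - \<Gamma> w - Kf w) \<le> X w" "oce M F Hp X Y"
    have sK: "(\<lambda>w. s w - Kf w) \<in> borel_measurable F" using *(1) by measurable
    have "AE w in M. ereal (s w - Kf w) - ecexp M F (\<lambda>w'. Hp ((s w' - Kf w') - (h w' + A w' \<bullet> dP w' - \<Gamma> w' - Kf w'))) w \<le> Y w"
    proof (rule p.oce_ge[OF *(5,3) _ sK *(4)])
      have "(\<lambda>w. h w + A w \<bullet> dP w - \<Gamma> w - Kf w) \<in> borel_measurable G" unfolding \<Gamma>_def using F_G[OF *(1)] by measurable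
      then show "(\<lambda>w. h w + A w \<bullet> dP w - \<Gamma> w - Kf w) \<in> borel_measurable M" by (rule G_M)
      show "AE w in M. \<bar>h w + A w \<bullet> dP w - \<Gamma> w - Kf w\<bar> \<le> \<kappa> + \<rho> * K + K + k" using *(2)
      proof eventually_elim
        case (elim w)
        have b: "norm (A w) \<le> K" "\<bar>\<Gamma> w\<bar> \<le> K" using bnd[rule_format, of w] by (auto simp: \<Gamma>_def)
        have "0 \<le> \<rho>" using dP(2)[of undefined] norm_ge_zero order_trans by blast
        then have "\<bar>A w \<bullet> dP w\<bar> \<le> \<rho> * K" using inner_dP[of "A w" w] mult_left_mono[OF b(1)] order_trans by blast
        then have "\<bar>h w\<bar> + \<bar>A w \<bullet> dP w\<bar> + \<bar>\<Gamma> w\<bar> + \<bar>Kf w\<bar> \<le> \<kappa> + \<rho> * K + K + k"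
          using h(2) b(2) elim by (intro add_mono)
        moreover have "\<bar>x + y - z - q\<bar> \<le> \<bar>x\<bar> + \<bar>y\<bar> + \<bar>z\<bar> + \<bar>q\<bar>" for x y z q :: real by linarith
        ultimately show ?case by (rule order_trans[rotated])
      qed
    qed
    moreover have "(\<lambda>w'. Hp ((s w' - Kf w') - (h w' + A w' \<bullet> dP w' - \<Gamma> w' - Kf w'))) = (\<lambda>w. Hp (residual (s w) (A w) (r w) w))"
      by (simp add: \<Gamma>_def residual_def algebra_simps)
    ultimately have "AE w in M. ereal (s w - Kf w) - ecexp M F (\<lambda>w. Hp (residual (s w) (A w) (r w) w)) w \<le> Y w" by simp
    then show "AE w in M. ereal (vp w - Kf w) \<le> Y w" using ep by eventually_elim (simp add: vp_def algebra_simps)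
  next
    fix Kf B Xa Xp Ya Yp
    assume *: "Kf \<in> borel_measurable F" "B \<in> borel_measurable F"
      "Xa \<in> borel_measurable G" "AE w in M. Xa w < \<infinity>" "Xp \<in> borel_measurable G" "AE w in M. Xp w < \<infinity>"
      "AE w in M. Xa w + Xp w \<le> ereal (Kf w + h w + B w \<bullet> dP w)" "oce M F Ha Xa Ya" "oce M F Hp Xp Yp"
    have V: "(\<lambda>w. va w - c (A w) + vp w) \<in> borel_measurable F" unfolding va_def vp_def by measurable
    have neg: "- (va w - c (A w) + vp w) = c (A w) - s w + a w + p w" for w
      by (simp add: va_def vp_def)
    show "AE w in M. Ya w + Yp w \<le> ereal (Kf w + c (B w) + (va w - c (A w) + vp w))"
      by (rule oce_add_le[OF _ V *(3-6) *(1,2) *(7-9)]) (unfold neg, rule opt[rule_format])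
  qed
  then show ?thesis by blast
qed

section \<open>Certainty equivalents under changes on null sets\<close>

context one_step_oce
begin

lemma payoff_cong_AE:
  assumes [measurable]: "X \<in> borel_measurable M" "X' \<in> borel_measurable M" and eq: "AE w in M. X w = X' w"
  shows "AE w in M. payoff s X w = payoff s X' w"
proof -
  have "AE w in M. ecexp M F (\<lambda>w. H (s - X w)) w \<le> ecexp M F (\<lambda>w. H (s - X' w)) w"
    by (rule ecexp_mono) (use eq in \<open>auto elim!: eventually_mono\<close>)
  moreover have "AE w in M. ecexp M F (\<lambda>w. H (s - X' w)) w \<le> ecexp M F (\<lambda>w. H (s - X w)) w"
    by (rule ecexp_mono) (use eq in \<open>auto elim!: eventually_mono\<close>)
  ultimately show ?thesis unfolding payoff_def by eventually_elim simp
qed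

lemma oce1_cong_AE:
  assumes X: "X \<in> borel_measurable M" "X' \<in> borel_measurable M" and eq: "AE w in M. X w = X' w"
    and Y: "oce1 M F H X Y"
  shows "oce1 M F H X' Y"
proof -
  have le: "AE w in M. payoff s X' w \<le> Z w" if "AE w in M. payoff s X w \<le> Z w" for s Z
    using that payoff_cong_AE[OF X eq, of s] by eventually_elim simp
  have ge: "AE w in M. payoff s X w \<le> Z w" if "AE w in M. payoff s X' w \<le> Z w" for s Z
    using that payoff_cong_AE[OF X eq, of s] by eventually_elim simp
  show ?thesis using Y le ge unfolding oce1_alt by blast
qed

lemma oce_cong_AE:
  assumes X [measurable]: "X \<in> borel_measurable M" "X' \<in> borel_measurable M" and eq: "AE w in M. X w = X' w"
    and Y: "oce M F H X Y"
  shows "oce M F H X' Y"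
proof -
  have "oce1 M F H (\<lambda>w. trunc n k (X' w)) Z" if "oce1 M F H (\<lambda>w. trunc n k (X w)) Z" for n k Z
    by (rule oce1_cong_AE[OF _ _ _ that]) (use eq in \<open>auto elim!: eventually_mono\<close>)
  then show ?thesis using Y unfolding oce_alt by blast
qed

text \<open>\<open>oce\<close> fixes its value only up to null sets, so \<open>X\<close> itself is a
  version; this allows a pasted chain that stays constant.\<close>

lemma oce_self:
  assumes X: "X \<in> borel_measurable F"
  shows "oce M F H X X"
proof -
  obtain Y where Y: "oce M F H X Y" using oce_exists[OF measurable_F_M[OF X]] by blast
  have eq: "AE w in M. Y w = X w" by (rule oce_F_meas[OF Y X])
  obtain Yd Z where "\<And>n k. oce1 M F H (\<lambda>w. trunc n k (X w)) (Yd n k)"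
    and "\<And>n. AE w in M. (\<lambda>k. Yd n k w) \<longlonglongrightarrow> Z n w" and lim: "AE w in M. (\<lambda>n. Z n w) \<longlonglongrightarrow> Y w"
    using Y unfolding oce_alt by blast
  moreover have "AE w in M. (\<lambda>n. Z n w) \<longlonglongrightarrow> X w" using lim eq by eventually_elim simp
  ultimately show ?thesis using X unfolding oce_alt by blast
qed

end

subsection \<open>The dynamic problem\<close>

lemma strictly_convex_imp_convex_on:
  assumes "strictly_convex f" shows "convex_on UNIV f"
proof (rule convex_onI)
  fix t :: real and x y assume t: "0 < t" "t < 1"
  show "f ((1 - t) *\<^sub>R x + t *\<^sub>R y) \<le> (1 - t) * f x + t * f y"
  proof (cases "x = y")
    case True then show ?thesis by (simp add: algebra_simps flip: scaleR_add_left)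
  next
    case False
    then have "f ((1 - t) *\<^sub>R x + (1 - (1 - t)) *\<^sub>R y) < (1 - t) * f x + (1 - (1 - t)) * f y"
      using assms t unfolding strictly_convex_def by (metis diff_gt_0_iff_gt diff_less_eq less_add_same_cancel1)
    then show ?thesis by simp
  qed
qed simp

locale contracting = prob_space M for M :: "'a measure" +
  fixes P :: "nat \<Rightarrow> 'a \<Rightarrow> real^'n::finite" and T :: nat
    and c :: "nat \<Rightarrow> real^'n \<Rightarrow> real" and Ha Hp :: "nat \<Rightarrow> real \<Rightarrow> ereal"
  assumes P_measurable: "\<And>t. t \<le> T \<Longrightarrow> P t \<in> borel_measurable M"
    and P_bounded: "\<exists>pm pp. 0 < pm \<and> pm \<le> pp \<and> (\<forall>t\<le>T. \<forall>i. AE w in M. pm \<le> P t w $ i \<and> P t w $ i \<le> pp)"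
    and c_convex: "\<And>t. t < T \<Longrightarrow> convex_on UNIV (c t)"
    and c_superlinear: "\<And>t. t < T \<Longrightarrow> filterlim (\<lambda>a. c t a / norm a) at_top at_infinity"
    and Ha: "\<And>t. t < T \<Longrightarrow> coercive_loss (Ha t)" and Hp: "\<And>t. t < T \<Longrightarrow> coercive_loss (Hp t)"
begin

abbreviation "F \<equiv> Filt M P"

lemma space_Filt [simp]: "space (F t) = space M"
  unfolding Filt_def by (rule space_measure_of) auto

lemma sets_Filt: "sets (F t) = sigma_sets (space M) {P s -` B \<inter> space M | s B. s \<le> t \<and> B \<in> sets borel}"
  unfolding Filt_def by (rule sets_measure_of) auto

lemma subalgebra_Filt:
  assumes t: "t \<le> T" shows "subalgebra M (F t)"
proof -
  have "{P s -` B \<inter> space M | s B. s \<le> t \<and> B \<in> sets borel} \<subseteq> sets M"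
  proof clarify
    fix s B assume "s \<le> t" "B \<in> sets (borel :: (real^'n) measure)"
    then show "P s -` B \<inter> space M \<in> sets M" using t by (intro measurable_sets[OF P_measurable]) simp_all
  qed
  then show ?thesis unfolding subalgebra_def sets_Filt by (simp add: sets.sigma_sets_subset)
qed

lemma subalgebra_Filt_mono:
  assumes "s \<le> t" shows "subalgebra (F t) (F s)"
proof -
  have "{P r -` B \<inter> space M | r B. r \<le> s \<and> B \<in> sets borel} \<subseteq> {P r -` B \<inter> space M | r B. r \<le> t \<and> B \<in> sets borel}"
  proof clarify
    fix r and B :: "(real^'n) set" assume "r \<le> s" "B \<in> sets borel"
    then show "\<exists>q C. P r -` B \<inter> space M = P q -` C \<inter> space M \<and> q \<le> t \<and> C \<in> sets borel"
      using assms by (intro exI[of _ r] exI[of _ B] conjI refl) simp_all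
  qed
  then show ?thesis unfolding subalgebra_def sets_Filt by (simp add: sigma_sets_mono')
qed

lemma Filt_mono: "s \<le> t \<Longrightarrow> f \<in> borel_measurable (F s) \<Longrightarrow> f \<in> borel_measurable (F t)"
  using measurable_from_subalg[OF subalgebra_Filt_mono] by blast

lemma Filt_M: "t \<le> T \<Longrightarrow> f \<in> borel_measurable (F t) \<Longrightarrow> f \<in> borel_measurable M"
  using measurable_from_subalg[OF subalgebra_Filt] by blast

lemma P_adapted: "s \<le> t \<Longrightarrow> P s \<in> borel_measurable (F t)"
proof (rule measurableI)
  fix B :: "(real^'n) set" assume "s \<le> t" "B \<in> sets borel"
  then show "P s -` B \<inter> space (F t) \<in> sets (F t)"
    unfolding sets_Filt space_Filt by (intro sigma_sets.Basic) blast
qed simp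

lemma dPrel_measurable: "dPrel P t \<in> borel_measurable (F (Suc t))"
proof -
  have [measurable]: "(\<lambda>w. P s w $ i) \<in> borel_measurable (F (Suc t))" if "s \<le> Suc t" for s i
    by (rule measurable_compose[OF P_adapted[OF that] borel_measurable_nth])
  have "(\<lambda>w. dPrel P t w $ i) \<in> borel_measurable (F (Suc t))" for i
    unfolding dPrel_def vec_lambda_beta by measurable
  then show ?thesis
    unfolding borel_measurable_euclidean_space[of "dPrel P t"] by (auto simp: Basis_vec_def inner_axis)
qed

lemma dPrel_bounded:
  assumes t: "t < T" obtains \<rho> where "AE w in M. norm (dPrel P t w) \<le> \<rho>"
proof -
  obtain pm pp where pm: "0 < pm" "pm \<le> pp"
    and b: "\<And>t i. t \<le> T \<Longrightarrow> AE w in M. pm \<le> P t w $ i \<and> P t w $ i \<le> pp"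
    using P_bounded by blast
  have "AE w in M. \<forall>i. pm \<le> P t w $ i \<and> P t w $ i \<le> pp" using b[of t] t by (simp add: AE_all_countable)
  moreover have "AE w in M. \<forall>i. pm \<le> P (Suc t) w $ i \<and> P (Suc t) w $ i \<le> pp" using b[of "Suc t"] t by (simp add: AE_all_countable)
  ultimately have "AE w in M. norm (dPrel P t w) \<le> (\<Sum>i\<in>(UNIV::'n set). pp / pm)"
  proof eventually_elim
    case (elim w)
    have "\<bar>dPrel P t w $ i\<bar> \<le> pp / pm" for i
    proof -
      have "\<bar>P (Suc t) w $ i - P t w $ i\<bar> \<le> pp" "pm \<le> P t w $ i" using elim pm by (smt (verit))+
      then show ?thesis unfolding dPrel_def using pm by (auto simp: abs_divide intro!: frac_le)
    qed
    then show ?case by (intro order_trans[OF norm_le_l1_cart] sum_mono)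
  qed
  then show thesis by (rule that)
qed

lemma one_step_oce: "t < T \<Longrightarrow> coercive_loss H \<Longrightarrow> one_step_oce M H (F t)"
  by (intro one_step_oce.intro one_step_oce_axioms.intro prob_space_axioms subalgebra_Filt) auto

lemma step_solution_exists:
  assumes t: "t < T" and h: "h \<in> borel_measurable (F (Suc t))" "\<exists>\<kappa>. \<forall>w. \<bar>h w\<bar> \<le> \<kappa>"
  shows "\<exists>A \<Gamma> va vp. step_solution M (F t) (F (Suc t)) (Ha t) (Hp t) (c t) h (dPrel P t) A \<Gamma> va vp"
proof -
  obtain \<kappa> where \<kappa>: "\<And>w. \<bar>h w\<bar> \<le> \<kappa>" using h(2) by blast
  obtain \<rho>' where \<rho>': "AE w in M. norm (dPrel P t w) \<le> \<rho>'" using dPrel_bounded[OF t] by blast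
  define \<rho> where "\<rho> = max \<rho>' 0"
  \<comment> \<open>The returns are bounded almost everywhere only; a version bounded at every point
    meets the requirements of \<open>one_step\<close>, and \<open>step_solution_cong_AE\<close>
    leads back.\<close>
  define dP where "dP w = (if norm (dPrel P t w) \<le> \<rho> then dPrel P t w else 0)" for w
  have [measurable]: "dPrel P t \<in> borel_measurable (F (Suc t))" by (rule dPrel_measurable)
  have dP: "dP \<in> borel_measurable (F (Suc t))" "\<And>w. norm (dP w) \<le> \<rho>" unfolding dP_def by (measurable, simp add: \<rho>_def)
  have eq: "AE w in M. dPrel P t w = dP w" using \<rho>' by eventually_elim (simp add: dP_def \<rho>_def)
  interpret one_step M "F t" "F (Suc t)" "Ha t" "Hp t" "c t" h dP \<kappa> \<rho>
    by (intro one_step.intro one_step_axioms.intro prob_space_axioms subalgebra_Filt subalgebra_Filt_mono Ha Hp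
        c_convex c_superlinear h(1) \<kappa> dP) (use t in auto)
  obtain A \<Gamma> va vp where "step_solution M (F t) (F (Suc t)) (Ha t) (Hp t) (c t) h dP A \<Gamma> va vp"
    using step_solution_exists by blast
  from step_solution_cong_AE[OF this eq] show ?thesis by blast
qed

text \<open>A position known at time t + 1 is left unchanged by all later certainty equivalents, so
  pasting reduces to a single step. A given chain agrees with \<open>X\<close> only almost
  everywhere, hence the appeal to \<open>oce_cong_AE\<close>.\<close>

lemma pasted_iff_oce:
  assumes t: "t < T" and H: "\<And>s. s < T \<Longrightarrow> coercive_loss (H s)" and X: "X \<in> borel_measurable (F (Suc t))"
  shows "pasted M F H T t X Y \<longleftrightarrow> oce M (F t) (H t) X Y"
proof
  assume "pasted M F H T t X Y"
  then obtain V where VT: "V T = X" and V: "\<And>s. t \<le> s \<Longrightarrow> s < T \<Longrightarrow> oce M (F s) (H s) (V (Suc s)) (V s)" and Vt: "V t = Y"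
    unfolding pasted_def by blast
  have VM: "V s \<in> borel_measurable M" if "t < s" "s \<le> T" for s
  proof (cases "s = T")
    case True then show ?thesis using VT Filt_M[OF _ X] t by simp
  next
    case False
    then have "V s \<in> borel_measurable (F s)" using V[of s] that unfolding oce_def by simp
    then show ?thesis by (rule Filt_M[rotated]) (use that in simp)
  qed
  have "Suc t \<le> T" using t by simp
  then have eq: "AE w in M. V (Suc t) w = X w"
  proof (induction rule: inc_induct)
    case base then show ?case using VT by simp
  next
    case (step s)
    note s = step.hyps
    interpret step: one_step_oce M "H s" "F s" by (rule one_step_oce[OF s(2) H[OF s(2)]])
    have Xs: "X \<in> borel_measurable (F s)" by (rule Filt_mono[OF s(1) X])
    have "oce M (F s) (H s) (V (Suc s)) (V s)" by (rule V) (use s in simp_all)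
    moreover have "V (Suc s) \<in> borel_measurable M" by (rule VM) (use s in simp_all)
    ultimately have "oce M (F s) (H s) X (V s)"
      using step.oce_cong_AE[OF _ step.measurable_F_M[OF Xs] step.IH] by blast
    then show ?case by (rule step.oce_F_meas[OF _ Xs])
  qed
  interpret now: one_step_oce M "H t" "F t" by (rule one_step_oce[OF t H[OF t]])
  have VM': "V (Suc t) \<in> borel_measurable M" by (rule VM) (use t in simp_all)
  have XM: "X \<in> borel_measurable M" by (rule Filt_M[OF _ X]) (use t in simp)
  have "oce M (F t) (H t) (V (Suc t)) Y" using V[of t] t Vt by simp
  then show "oce M (F t) (H t) X Y" by (rule now.oce_cong_AE[OF VM' XM eq])
next
  assume Y: "oce M (F t) (H t) X Y"
  show "pasted M F H T t X Y" unfolding pasted_def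
  proof (intro exI[of _ "\<lambda>s. if s = t then Y else X"] conjI allI impI)
    fix s assume s: "t \<le> s \<and> s < T"
    show "oce M (F s) (H s) (if Suc s = t then Y else X) (if s = t then Y else X)"
    proof (cases "s = t")
      case False
      have sT: "s < T" and le: "Suc t \<le> s" using s False by auto
      have "oce M (F s) (H s) X X" by (rule one_step_oce.oce_self[OF one_step_oce[OF sT H[OF sT]] Filt_mono[OF le X]])
      then show ?thesis using False le by simp
    qed (use Y in simp)
  qed (use t in auto)
qed

lemma pasted_exists:
  assumes t: "t < T" and H: "\<And>s. s < T \<Longrightarrow> coercive_loss (H s)" and X: "X \<in> borel_measurable (F (Suc t))"
  shows "\<exists>Y. pasted M F H T t X Y"
proof -
  have "X \<in> borel_measurable M" by (rule Filt_M[OF _ X]) (use t in simp)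
  then obtain Y where "oce M (F t) (H t) X Y" using one_step_oce.oce_exists[OF one_step_oce[OF t H[OF t]]] by blast
  then have "pasted M F H T t X Y" by (subst pasted_iff_oce[OF t _ X]) (auto intro: H)
  then show ?thesis by blast
qed

text \<open>Measurability and boundedness of the value have to be carried along the choice, as they
  are the assumptions of the next step backwards in time.\<close>

lemma recursive_solution:
  "\<exists>h. h T = (\<lambda>w. 0) \<and> (\<forall>t<T. \<exists>A \<Gamma> va vp. h t = (\<lambda>w. va w - c t (A w) + vp w)
     \<and> step_solution M (F t) (F (Suc t)) (Ha t) (Hp t) (c t) (h (Suc t)) (dPrel P t) A \<Gamma> va vp)"
proof -
  define good where "good t h \<longleftrightarrow> h \<in> borel_measurable (F t) \<and> (\<exists>\<kappa>. \<forall>w. \<bar>h w :: real\<bar> \<le> \<kappa>)" for t h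
  define succ where "succ t h h' \<longleftrightarrow> (\<exists>A \<Gamma> va vp. h' = (\<lambda>w. va w - c t (A w) + vp w)
     \<and> step_solution M (F t) (F (Suc t)) (Ha t) (Hp t) (c t) h (dPrel P t) A \<Gamma> va vp)" for t and h h' :: "'a \<Rightarrow> real"
  have good0: "good t (\<lambda>w. 0)" for t unfolding good_def by auto
  have succ: "\<exists>h'. good t h' \<and> succ t h h'" if t: "t < T" and h: "good (Suc t) h" for t h
  proof -
    obtain A \<Gamma> va vp where sol: "step_solution M (F t) (F (Suc t)) (Ha t) (Hp t) (c t) h (dPrel P t) A \<Gamma> va vp"
      using step_solution_exists[OF t, of h] h unfolding good_def by blast
    obtain b where b: "\<forall>w. norm (A w) \<le> b \<and> \<bar>\<Gamma> w\<bar> \<le> b \<and> \<bar>va w\<bar> \<le> b \<and> \<bar>vp w\<bar> \<le> b \<and> \<bar>c t (A w)\<bar> \<le> b"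
      using step_solutionD(5)[OF sol] by blast
    let ?h = "\<lambda>w. va w - c t (A w) + vp w"
    note [measurable] = step_solutionD(1,3,4)[OF sol]
      borel_measurable_continuous_onI[OF convex_on_continuous[OF open_UNIV c_convex[OF t]]]
    have "?h \<in> borel_measurable (F t)" by measurable
    moreover have "\<bar>?h w\<bar> \<le> b + b + b" for w
    proof -
      have "\<bar>?h w\<bar> \<le> \<bar>va w - c t (A w)\<bar> + \<bar>vp w\<bar>" by (rule abs_triangle_ineq)
      also have "\<dots> \<le> \<bar>va w\<bar> + \<bar>c t (A w)\<bar> + \<bar>vp w\<bar>" by (intro add_right_mono abs_triangle_ineq4)
      also have "\<dots> \<le> b + b + b" using b by (intro add_mono) auto
      finally show ?thesis .
    qed
    ultimately have "good t ?h" unfolding good_def by blast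
    moreover have "succ t h ?h" unfolding succ_def using sol by blast
    ultimately show ?thesis by blast
  qed
  \<comment> \<open>Choice runs forward in n = T - t. The clause for \<open>n = 0\<close> pins the
    terminal value, and beyond \<open>T\<close> the sequence is filled with 0.\<close>
  have "\<exists>f. \<forall>n. (good (T - n) (f n) \<and> (n = 0 \<longrightarrow> f n = (\<lambda>w. 0))) \<and> (n < T \<longrightarrow> succ (T - Suc n) (f n) (f (Suc n)))"
  proof (rule dependent_nat_choice)
    show "\<exists>x. good (T - 0) x \<and> (0 = 0 \<longrightarrow> x = (\<lambda>w. 0))" using good0 by blast
  next
    fix x n assume x: "good (T - n) x \<and> (n = 0 \<longrightarrow> x = (\<lambda>w. 0))"
    show "\<exists>y. (good (T - Suc n) y \<and> (Suc n = 0 \<longrightarrow> y = (\<lambda>w. 0))) \<and> (n < T \<longrightarrow> succ (T - Suc n) x y)"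
    proof (cases "n < T")
      case True
      then have "Suc (T - Suc n) = T - n" "T - Suc n < T" by auto
      then show ?thesis using succ[of "T - Suc n" x] x by auto
    qed (use good0 in blast)
  qed
  then obtain f where f: "\<And>n. n = 0 \<longrightarrow> f n = (\<lambda>w. 0)" "\<And>n. n < T \<longrightarrow> succ (T - Suc n) (f n) (f (Suc n))" by blast
  have "succ t (f (T - Suc t)) (f (T - t))" if "t < T" for t
  proof -
    have "T - Suc (T - Suc t) = t" "Suc (T - Suc t) = T - t" "T - Suc t < T" using that by auto
    then show ?thesis using f(2)[of "T - Suc t"] by simp
  qed
  then show ?thesis using f(1)[of 0] unfolding succ_def by (intro exI[of _ "\<lambda>t. f (T - t)"]) simp
qed

end

section \<open>Verification of the recursion and of the contract\<close>

locale solved_contracting = contracting M P T c Ha Hp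
  for M :: "'a measure" and P :: "nat \<Rightarrow> 'a \<Rightarrow> real^'n::finite" and T c Ha Hp +
  fixes h :: "nat \<Rightarrow> 'a \<Rightarrow> real" and A :: "nat \<Rightarrow> 'a \<Rightarrow> real^'n" and \<Gamma> va vp :: "nat \<Rightarrow> 'a \<Rightarrow> real"
  assumes h_T: "h T = (\<lambda>w. 0)"
    and h_step: "\<And>t. t < T \<Longrightarrow> h t = (\<lambda>w. va t w - c t (A t w) + vp t w)"
    and sol: "\<And>t. t < T \<Longrightarrow>
      step_solution M (F t) (F (Suc t)) (Ha t) (Hp t) (c t) (h (Suc t)) (dPrel P t) (A t) (\<Gamma> t) (va t) (vp t)"
begin

lemma c_measurable: "t < T \<Longrightarrow> c t \<in> borel_measurable borel"
  by (rule borel_measurable_continuous_onI[OF convex_on_continuous[OF open_UNIV c_convex]])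

lemma agent_pasted:
  assumes t: "t < T" and X: "X \<in> borel_measurable (F (Suc t))"
  shows "pasted M F Ha T t X Y \<longleftrightarrow> oce M (F t) (Ha t) X Y" and "\<exists>Y. pasted M F Ha T t X Y"
  by (rule pasted_iff_oce[OF t Ha X] pasted_exists[OF t Ha X]; assumption)+

lemma principal_pasted:
  assumes t: "t < T" and X: "X \<in> borel_measurable (F (Suc t))"
  shows "pasted M F Hp T t X Y \<longleftrightarrow> oce M (F t) (Hp t) X Y" and "\<exists>Y. pasted M F Hp T t X Y"
  by (rule pasted_iff_oce[OF t Hp X] pasted_exists[OF t Hp X]; assumption)+

lemmas sol_measurable = step_solutionD(1-4)[OF sol]

lemma A_Suc: "t < T \<Longrightarrow> A t \<in> borel_measurable (F (Suc t))"
  by (rule Filt_mono[OF _ sol_measurable(1)]) simp_all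

lemma h_measurable: assumes t: "t \<le> T" shows "h t \<in> borel_measurable (F t)"
proof (cases "t = T")
  case True then show ?thesis using h_T by simp
next
  case False
  then have t: "t < T" using t by simp
  note [measurable] = sol_measurable[OF t] c_measurable[OF t]
  show ?thesis unfolding h_step[OF t] by measurable
qed

definition principal_position :: "nat \<Rightarrow> 'a \<Rightarrow> real" where
  "principal_position t w = h (Suc t) w + A t w \<bullet> dPrel P t w - \<Gamma> t w"

lemma principal_position_measurable: "t < T \<Longrightarrow> principal_position t \<in> borel_measurable (F (Suc t))"
proof -
  assume t: "t < T"
  have [measurable]: "h (Suc t) \<in> borel_measurable (F (Suc t))" by (rule h_measurable) (use t in simp)
  note [measurable] = A_Suc[OF t] sol_measurable(2)[OF t] dPrel_measurable[of t]
  show ?thesis unfolding principal_position_def[abs_def] by measurable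
qed

text \<open>Incentive compatibility from the joint bound: when \<beta> is 1, a deviation to
  \<open>B\<close> leaves the Principal's position untouched, while the total position is that of
  effort \<open>B\<close>. Subtracting the Principal's value, at least \<open>vp\<close>, from the
  joint bound leaves the bound on the Agent.\<close>

lemma agent_le:
  assumes t: "t < T" and K: "K \<in> borel_measurable (F t)" and B: "B \<in> borel_measurable (F t)"
    and X: "X \<in> borel_measurable (F (Suc t))" "\<And>w. X w = ereal (K w + \<Gamma> t w + (B w - A t w) \<bullet> dPrel P t w)"
    and Y: "oce M (F t) (Ha t) X Y"
  shows "AE w in M. Y w - ereal (c t (B w)) \<le> ereal (K w + va t w - c t (A t w))"
proof -
  let ?Xp = "\<lambda>w. ereal (principal_position t w)"
  have XpF: "?Xp \<in> borel_measurable (F (Suc t))" using principal_position_measurable[OF t] by measurable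
  have XpM: "?Xp \<in> borel_measurable M" by (rule Filt_M[OF _ XpF]) (use t in simp)
  obtain Yp where Yp: "oce M (F t) (Hp t) ?Xp Yp"
    using one_step_oce.oce_exists[OF one_step_oce[OF t Hp[OF t]] XpM] by blast
  have "AE w in M. ereal (vp t w - 0) \<le> Yp w"
    by (rule step_solution_principal_ge[OF sol[OF t], where K = "\<lambda>_. 0" and k = 0, OF _ _ XpM _ Yp])
      (auto simp: principal_position_def)
  moreover have "AE w in M. Y w + Yp w \<le> ereal (K w + c t (B w) + (va t w - c t (A t w) + vp t w))"
    by (rule step_solution_add_le[OF sol[OF t] K B X(1) _ XpF _ _ Y Yp])
      (auto simp: X(2) principal_position_def inner_diff_left)
  ultimately show ?thesis
  proof eventually_elim
    case (elim w) then show ?case by (cases "Y w"; cases "Yp w") auto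
  qed
qed

lemma agent_optimal: assumes t: "t < T" shows "inC M P T Ha c t (\<lambda>w. 1) (A t) (\<Gamma> t)"
  unfolding inC_def
proof (intro conjI ballI allI impI sol_measurable(1,2)[OF t])
  fix B Y1 Y2 assume B: "B \<in> borel_measurable (F t)"
    and Y1: "pasted M F Ha T t (\<lambda>w. ereal (\<Gamma> t w)) Y1"
    and Y2: "pasted M F Ha T t (\<lambda>w. ereal (\<Gamma> t w + 1 * ((B w - A t w) \<bullet> dPrel P t w))) Y2"
  have [measurable]: "B \<in> borel_measurable (F (Suc t))" by (rule Filt_mono[OF _ B]) simp
  note [measurable] = A_Suc[OF t] sol_measurable(2)[OF t] dPrel_measurable[of t]
  have \<Gamma>F: "(\<lambda>w. ereal (\<Gamma> t w)) \<in> borel_measurable (F (Suc t))" by measurable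
  have XF: "(\<lambda>w. ereal (\<Gamma> t w + 1 * ((B w - A t w) \<bullet> dPrel P t w))) \<in> borel_measurable (F (Suc t))" by measurable
  have \<Gamma>M: "(\<lambda>w. ereal (\<Gamma> t w)) \<in> borel_measurable M" by (rule Filt_M[OF _ \<Gamma>F]) (use t in simp)
  have 1: "oce M (F t) (Ha t) (\<lambda>w. ereal (\<Gamma> t w)) Y1" using Y1 unfolding agent_pasted(1)[OF t \<Gamma>F] .
  have 2: "oce M (F t) (Ha t) (\<lambda>w. ereal (\<Gamma> t w + 1 * ((B w - A t w) \<bullet> dPrel P t w))) Y2"
    using Y2 unfolding agent_pasted(1)[OF t XF] .
  have "AE w in M. ereal (0 + va t w) \<le> Y1 w"
    by (rule step_solution_agent_ge[OF sol[OF t], where K = "\<lambda>_. 0" and k = 0, OF _ _ \<Gamma>M _ 1]) auto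
  moreover have "AE w in M. Y2 w - ereal (c t (B w)) \<le> ereal (0 + va t w - c t (A t w))"
    by (rule agent_le[OF t _ B XF _ 2]) auto
  ultimately show "AE w in M. Y2 w - ereal (c t (B w)) \<le> Y1 w - ereal (c t (A t w))"
  proof eventually_elim
    case (elim w)
    have "ereal (va t w - c t (A t w)) \<le> Y1 w - ereal (c t (A t w))" using elim(1) by (cases "Y1 w") auto
    then show ?case using elim(2) by simp
  qed
qed

text \<open>The joint bound with \<open>K = 0\<close>; it treats every effort and transfer alike and
  so covers the contracts for all \<beta> at once.\<close>

lemma principal_value_le:
  assumes t: "t < T" and B: "B \<in> borel_measurable (F t)" and C: "C \<in> borel_measurable (F (Suc t))"
    and V: "prin_val M P T Ha Hp c t (\<lambda>w. ereal (h (Suc t) w)) B C V"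
  shows "AE w in M. V w \<le> ereal (h t w)"
proof -
  obtain Ya Yp where Ya: "pasted M F Ha T t (\<lambda>w. ereal (C w)) Ya"
    and Yp: "pasted M F Hp T t (\<lambda>w. ereal (h (Suc t) w) + ereal (B w \<bullet> dPrel P t w - C w)) Yp"
    and V: "V = (\<lambda>w. Ya w - ereal (c t (B w)) + Yp w)"
    using V unfolding prin_val_def by blast
  have [measurable]: "B \<in> borel_measurable (F (Suc t))" by (rule Filt_mono[OF _ B]) simp
  have [measurable]: "h (Suc t) \<in> borel_measurable (F (Suc t))" by (rule h_measurable) (use t in simp)
  note [measurable] = C dPrel_measurable[of t]
  have XaF: "(\<lambda>w. ereal (C w)) \<in> borel_measurable (F (Suc t))" by measurable
  have XpF: "(\<lambda>w. ereal (h (Suc t) w) + ereal (B w \<bullet> dPrel P t w - C w)) \<in> borel_measurable (F (Suc t))" by measurable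
  have a: "oce M (F t) (Ha t) (\<lambda>w. ereal (C w)) Ya" using Ya unfolding agent_pasted(1)[OF t XaF] .
  have p: "oce M (F t) (Hp t) (\<lambda>w. ereal (h (Suc t) w) + ereal (B w \<bullet> dPrel P t w - C w)) Yp"
    using Yp unfolding principal_pasted(1)[OF t XpF] .
  have "AE w in M. Ya w + Yp w \<le> ereal (0 + c t (B w) + (va t w - c t (A t w) + vp t w))"
    by (rule step_solution_add_le[OF sol[OF t] _ B XaF _ XpF _ _ a p]) auto
  then show ?thesis unfolding V h_step[OF t]
  proof eventually_elim
    case (elim w) then show ?case by (cases "Ya w"; cases "Yp w") auto
  qed
qed

lemma principal_value_attained:
  assumes t: "t < T"
  shows "\<exists>V. prin_val M P T Ha Hp c t (\<lambda>w. ereal (h (Suc t) w)) (A t) (\<Gamma> t) V \<and> (AE w in M. ereal (h t w) = V w)"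
proof -
  have [measurable]: "h (Suc t) \<in> borel_measurable (F (Suc t))" by (rule h_measurable) (use t in simp)
  note [measurable] = A_Suc[OF t] sol_measurable(2)[OF t] dPrel_measurable[of t]
  let ?Xa = "\<lambda>w. ereal (\<Gamma> t w)"
  let ?Xp = "\<lambda>w. ereal (h (Suc t) w) + ereal (A t w \<bullet> dPrel P t w - \<Gamma> t w)"
  have XaF: "?Xa \<in> borel_measurable (F (Suc t))" and XpF: "?Xp \<in> borel_measurable (F (Suc t))" by measurable
  have XaM: "?Xa \<in> borel_measurable M" by (rule Filt_M[OF _ XaF]) (use t in simp)
  have XpM: "?Xp \<in> borel_measurable M" by (rule Filt_M[OF _ XpF]) (use t in simp)
  obtain Ya where Ya: "pasted M F Ha T t ?Xa Ya" using agent_pasted(2)[OF t XaF] by blast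
  obtain Yp where Yp: "pasted M F Hp T t ?Xp Yp" using principal_pasted(2)[OF t XpF] by blast
  have a: "oce M (F t) (Ha t) ?Xa Ya" using Ya unfolding agent_pasted(1)[OF t XaF] .
  have p: "oce M (F t) (Hp t) ?Xp Yp" using Yp unfolding principal_pasted(1)[OF t XpF] .
  let ?V = "\<lambda>w. Ya w - ereal (c t (A t w)) + Yp w"
  have V: "prin_val M P T Ha Hp c t (\<lambda>w. ereal (h (Suc t) w)) (A t) (\<Gamma> t) ?V"
    unfolding prin_val_def using Ya Yp by blast
  have "AE w in M. ereal (0 + va t w) \<le> Ya w"
    by (rule step_solution_agent_ge[OF sol[OF t], where K = "\<lambda>_. 0" and k = 0, OF _ _ XaM _ a]) auto
  moreover have "AE w in M. ereal (vp t w - 0) \<le> Yp w"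
    by (rule step_solution_principal_ge[OF sol[OF t], where K = "\<lambda>_. 0" and k = 0, OF _ _ XpM _ p]) auto
  moreover note principal_value_le[OF t sol_measurable(1)[OF t] sol_measurable(2)[OF t] V]
  ultimately have "AE w in M. ereal (h t w) = ?V w"
  proof eventually_elim
    case (elim w)
    \<comment> \<open>Each party's value is only known from below; the joint upper bound forces
      equality of the sum.\<close>
    have "ereal (h t w) \<le> ?V w" using elim(1,2) unfolding h_step[OF t] by (cases "Ya w"; cases "Yp w") auto
    then show ?case using elim(3) by simp
  qed
  then show ?thesis using V by blast
qed

lemma prin_recursion_h: "prin_recursion M P T Ha Hp c (\<lambda>t w. ereal (h t w))"
  unfolding prin_recursion_def
proof (intro conjI allI impI)
  show "(\<lambda>w. ereal (h T w)) = (\<lambda>w. 0)" using h_T by (simp add: zero_ereal_def)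
  fix t assume t: "t < T"
  obtain V where V: "prin_val M P T Ha Hp c t (\<lambda>w. ereal (h (Suc t) w)) (A t) (\<Gamma> t) V" "AE w in M. ereal (h t w) = V w"
    using principal_value_attained[OF t] by blast
  have Vin: "V \<in> prin_family M P T Ha Hp c t (\<lambda>w. ereal (h (Suc t) w))"
    unfolding prin_family_def using V(1) agent_optimal[OF t] borel_measurable_const by blast
  show "is_ess_sup M (F t) (prin_family M P T Ha Hp c t (\<lambda>w. ereal (h (Suc t) w))) (\<lambda>w. ereal (h t w))"
    unfolding is_ess_sup_def
  proof (intro conjI ballI impI)
    show "(\<lambda>w. ereal (h t w)) \<in> borel_measurable (F t)" using h_measurable[of t] t by simp
    fix W assume "W \<in> prin_family M P T Ha Hp c t (\<lambda>w. ereal (h (Suc t) w))"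
    then show "AE w in M. W w \<le> ereal (h t w)"
      unfolding prin_family_def inC_def using principal_value_le[OF t] by blast
  next
    fix Z assume "\<forall>X\<in>prin_family M P T Ha Hp c t (\<lambda>w. ereal (h (Suc t) w)). AE w in M. X w \<le> Z w"
    then have "AE w in M. V w \<le> Z w" using Vin by blast
    then show "AE w in M. ereal (h t w) \<le> Z w" using V(2) by eventually_elim simp
  qed
qed

text \<open>The Agent's continuation values under the contract: shifting \<open>\<Gamma> t\<close> by an \<open>F t\<close>-measurable amount
  makes the values of consecutive periods fit together.\<close>

primrec continuation :: "real \<Rightarrow> nat \<Rightarrow> 'a \<Rightarrow> real" where
  "continuation R 0 = (\<lambda>w. R)"
| "continuation R (Suc t) = (\<lambda>w. (continuation R t w - va t w + c t (A t w)) + \<Gamma> t w - A t w \<bullet> dPrel P t w)"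

definition shift :: "real \<Rightarrow> nat \<Rightarrow> 'a \<Rightarrow> real" where
  "shift R t w = continuation R t w - va t w + c t (A t w)"

lemma continuation_Suc: "continuation R (Suc t) w = shift R t w + \<Gamma> t w - A t w \<bullet> dPrel P t w"
  by (simp add: shift_def)

lemma continuation_measurable: "t \<le> T \<Longrightarrow> continuation R t \<in> borel_measurable (F t)"
proof (induction t)
  case (Suc t)
  then have t: "t < T" by simp
  have IH: "continuation R t \<in> borel_measurable (F t)" using Suc by simp
  have [measurable]: "continuation R t \<in> borel_measurable (F (Suc t))" "va t \<in> borel_measurable (F (Suc t))"
    using IH sol_measurable(3)[OF t] by (auto intro: Filt_mono[of t "Suc t"])
  note [measurable] = A_Suc[OF t] sol_measurable(2)[OF t] dPrel_measurable[of t] c_measurable[OF t]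
  show ?case by simp
qed simp

lemma shift_measurable: assumes t: "t < T" shows "shift R t \<in> borel_measurable (F t)"
proof -
  have [measurable]: "continuation R t \<in> borel_measurable (F t)" by (rule continuation_measurable) (use t in simp)
  note [measurable] = sol_measurable[OF t] c_measurable[OF t]
  show ?thesis unfolding shift_def[abs_def] by measurable
qed

lemma shift_bounded_if:
  assumes t: "t < T" and k: "AE w in M. \<bar>continuation R t w\<bar> \<le> k"
  shows "\<exists>k'. AE w in M. \<bar>shift R t w\<bar> \<le> k'"
proof -
  obtain b where b: "\<forall>w. norm (A t w) \<le> b \<and> \<bar>\<Gamma> t w\<bar> \<le> b \<and> \<bar>va t w\<bar> \<le> b \<and> \<bar>vp t w\<bar> \<le> b \<and> \<bar>c t (A t w)\<bar> \<le> b"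
    using step_solutionD(5)[OF sol[OF t]] by blast
  have "AE w in M. \<bar>shift R t w\<bar> \<le> k + b + b" using k
  proof eventually_elim
    case (elim w)
    have "\<bar>shift R t w\<bar> \<le> \<bar>continuation R t w - va t w\<bar> + \<bar>c t (A t w)\<bar>" unfolding shift_def by (rule abs_triangle_ineq)
    also have "\<dots> \<le> \<bar>continuation R t w\<bar> + \<bar>va t w\<bar> + \<bar>c t (A t w)\<bar>" by (intro add_right_mono abs_triangle_ineq4)
    also have "\<dots> \<le> k + b + b" using b elim by (intro add_mono) auto
    finally show ?case .
  qed
  then show ?thesis by blast
qed

lemma continuation_bounded: "t \<le> T \<Longrightarrow> \<exists>k. AE w in M. \<bar>continuation R t w\<bar> \<le> k"
proof (induction t)
  case (Suc t)
  then have t: "t < T" by simp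
  obtain k' where k': "AE w in M. \<bar>shift R t w\<bar> \<le> k'" using shift_bounded_if[OF t] Suc by auto
  obtain b where b: "\<forall>w. norm (A t w) \<le> b \<and> \<bar>\<Gamma> t w\<bar> \<le> b \<and> \<bar>va t w\<bar> \<le> b \<and> \<bar>vp t w\<bar> \<le> b \<and> \<bar>c t (A t w)\<bar> \<le> b"
    using step_solutionD(5)[OF sol[OF t]] by blast
  obtain \<rho> where \<rho>: "AE w in M. norm (dPrel P t w) \<le> \<rho>" using dPrel_bounded[OF t] by blast
  have "AE w in M. \<bar>continuation R (Suc t) w\<bar> \<le> k' + b + b * \<rho>" using k' \<rho>
  proof eventually_elim
    case (elim w)
    have "\<bar>A t w \<bullet> dPrel P t w\<bar> \<le> norm (A t w) * norm (dPrel P t w)" by (rule Cauchy_Schwarz_ineq2)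
    also have "\<dots> \<le> b * \<rho>" using b elim(2) by (intro mult_mono) (auto intro: order_trans[OF norm_ge_zero])
    finally have dA: "\<bar>A t w \<bullet> dPrel P t w\<bar> \<le> b * \<rho>" .
    have "\<bar>continuation R (Suc t) w\<bar> \<le> \<bar>shift R t w + \<Gamma> t w\<bar> + \<bar>A t w \<bullet> dPrel P t w\<bar>"
      unfolding continuation_Suc by (rule abs_triangle_ineq4)
    also have "\<dots> \<le> \<bar>shift R t w\<bar> + \<bar>\<Gamma> t w\<bar> + \<bar>A t w \<bullet> dPrel P t w\<bar>" by (intro add_right_mono abs_triangle_ineq)
    also have "\<dots> \<le> k' + b + b * \<rho>" using b elim(1) dA by (intro add_mono) auto
    finally show ?case .
  qed
  then show ?case by blast
qed auto

lemma shift_bounded: "t < T \<Longrightarrow> \<exists>k. AE w in M. \<bar>shift R t w\<bar> \<le> k"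
  using continuation_bounded[of t R] shift_bounded_if by auto

text \<open>Subtracting \<open>A t w \<bullet> dPrel P t w\<close> in the continuation value offsets
  the wealth that the Agent earns and keeps, so only the deviation from \<open>A t\<close>
  remains.\<close>

lemma continuation_effort:
  fixes B :: "'a \<Rightarrow> real^'n"
  shows "ereal (continuation R (Suc t) w) + ereal (1 * (B w \<bullet> dPrel P t w))
    = ereal (shift R t w + \<Gamma> t w + (B w - A t w) \<bullet> dPrel P t w)"
  unfolding continuation_Suc by (simp add: inner_diff_left)

text \<open>The continuation values are the Agent's recursive optima: \<open>agent_le\<close> bounds
  every effort and the one-step lower bound shows that \<open>A t\<close> reaches the bound. The
  participation constraint binds, as the recursion starts from \<open>R\<close>.\<close>

lemma admissible_continuation: "admissible M P T Ha c R (continuation R T) (\<lambda>t w. 1) A"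
  unfolding admissible_def
proof (intro conjI allI impI exI[of _ "\<lambda>t w. ereal (continuation R t w)"])
  show "continuation R T \<in> borel_measurable (F T)" by (rule continuation_measurable) simp
next
  fix t assume t: "t < T"
  show "(\<lambda>w. 1) \<in> borel_measurable (F t)" by simp
  show "A t \<in> borel_measurable (F t)" by (rule sol_measurable(1)[OF t])
  let ?X = "\<lambda>B w. ereal (continuation R (Suc t) w) + ereal (1 * (B w \<bullet> dPrel P t w))"
  have tT: "Suc t \<le> T" using t by simp
  have XF: "?X B \<in> borel_measurable (F (Suc t))" if B: "B \<in> borel_measurable (F t)" for B
  proof -
    note continuation_measurable[OF tT, measurable] dPrel_measurable[measurable]
    have [measurable]: "B \<in> borel_measurable (F (Suc t))" by (rule Filt_mono[OF _ B]) simp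
    show ?thesis by measurable
  qed
  have upper: "AE w in M. Y w - ereal (c t (B w)) \<le> ereal (continuation R t w)"
    if B: "B \<in> borel_measurable (F t)" and Y: "pasted M F Ha T t (?X B) Y" for B Y
  proof -
    have "oce M (F t) (Ha t) (?X B) Y" using Y unfolding agent_pasted(1)[OF t XF[OF B]] .
    then have "AE w in M. Y w - ereal (c t (B w)) \<le> ereal (shift R t w + va t w - c t (A t w))"
      by (rule agent_le[OF t shift_measurable[OF t] B XF[OF B], rotated]) (rule continuation_effort)
    then show ?thesis by (simp add: shift_def)
  qed
  have AF: "A t \<in> borel_measurable (F t)" by (rule sol_measurable(1)[OF t])
  obtain Y where Y: "pasted M F Ha T t (?X (A t)) Y" using agent_pasted(2)[OF t XF[OF AF]] by blast
  obtain k where k: "AE w in M. \<bar>shift R t w\<bar> \<le> k" using shift_bounded[OF t] by blast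
  have "oce M (F t) (Ha t) (?X (A t)) Y" using Y unfolding agent_pasted(1)[OF t XF[OF AF]] .
  then have "AE w in M. ereal (shift R t w + va t w) \<le> Y w"
  proof (rule step_solution_agent_ge[OF sol[OF t] shift_measurable[OF t] k, rotated 2])
    show "?X (A t) \<in> borel_measurable M" by (rule Filt_M[OF tT XF[OF AF]])
    show "AE w in M. ereal (shift R t w + \<Gamma> t w) \<le> ?X (A t) w" unfolding continuation_effort by simp
  qed
  with upper[OF AF Y] have Y_eq: "AE w in M. ereal (continuation R t w) = Y w - ereal (c t (A t w))"
  proof eventually_elim
    case (elim w)
    then show ?case by (cases "Y w") (auto simp: shift_def)
  qed
  show "\<exists>Y. pasted M F Ha T t (?X (A t)) Y \<and> (AE w in M. ereal (continuation R t w) = Y w - ereal (c t (A t w)))"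
    using Y Y_eq by blast
  let ?S = "{V. \<exists>Ab Y. Ab \<in> borel_measurable (F t) \<and> pasted M F Ha T t (?X Ab) Y \<and> V = (\<lambda>w. Y w - ereal (c t (Ab w)))}"
  show "is_ess_sup M (F t) ?S (\<lambda>w. ereal (continuation R t w))"
    unfolding is_ess_sup_def
  proof (intro conjI ballI impI)
    show "(\<lambda>w. ereal (continuation R t w)) \<in> borel_measurable (F t)" using continuation_measurable[of t R] t by simp
    fix V assume "V \<in> ?S"
    then show "AE w in M. V w \<le> ereal (continuation R t w)" using upper by blast
  next
    fix Z assume Z: "\<forall>X\<in>?S. AE w in M. X w \<le> Z w"
    have "(\<lambda>w. Y w - ereal (c t (A t w))) \<in> ?S" using Y AF by blast
    from bspec[OF Z this] have "AE w in M. Y w - ereal (c t (A t w)) \<le> Z w" .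
    then show "AE w in M. ereal (continuation R t w) \<le> Z w" using Y_eq by eventually_elim simp
  qed
qed auto

lemma pasted_chain_measurable:
  assumes V: "\<And>s. s < T \<Longrightarrow> oce M (F s) (H s) (V (Suc s)) (V s)" and VT: "V T \<in> borel_measurable (F T)" and s: "s \<le> T"
  shows "V s \<in> borel_measurable (F s)"
  using V[of s] VT s unfolding oce_def by (cases "s = T") auto

lemma principal_solution_ge:
  assumes Y: "pasted M F Hp T 0 (\<lambda>w. ereal (prin_terminal P T (continuation R T) (\<lambda>t w. 1) A w)) Y"
  shows "AE w in M. ereal (h 0 w - R) \<le> Y w"
proof -
  obtain V where VT: "V T = (\<lambda>w. ereal (prin_terminal P T (continuation R T) (\<lambda>t w. 1) A w))"
    and V: "\<And>s. s < T \<Longrightarrow> oce M (F s) (Hp s) (V (Suc s)) (V s)" and V0: "V 0 = Y"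
    using Y unfolding pasted_def by blast
  \<comment> \<open>The generated wealth cancels because the Agent keeps all of it.\<close>
  have VT': "V T = (\<lambda>w. ereal (- continuation R T w))" unfolding VT prin_terminal_def by simp
  have VTF: "V T \<in> borel_measurable (F T)" unfolding VT' using continuation_measurable[of T R] by simp
  have "AE w in M. ereal (h 0 w - continuation R 0 w) \<le> V 0 w"
  proof (rule inc_induct[of 0 T "\<lambda>t. AE w in M. ereal (h t w - continuation R t w) \<le> V t w"])
    show "AE w in M. ereal (h T w - continuation R T w) \<le> V T w" unfolding VT' h_T by simp
    fix t assume t: "t < T" and IH: "AE w in M. ereal (h (Suc t) w - continuation R (Suc t) w) \<le> V (Suc t) w"
    have tT: "Suc t \<le> T" using t by simp
    obtain k where k: "AE w in M. \<bar>shift R t w\<bar> \<le> k" using shift_bounded[OF t] by blast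
    have "AE w in M. ereal (vp t w - shift R t w) \<le> V t w"
    proof (rule step_solution_principal_ge[OF sol[OF t] shift_measurable[OF t] k _ _ V[OF t]])
      show "V (Suc t) \<in> borel_measurable M" by (rule Filt_M[OF tT pasted_chain_measurable[OF V VTF tT]])
      have eq: "h (Suc t) w + A t w \<bullet> dPrel P t w - \<Gamma> t w - shift R t w = h (Suc t) w - continuation R (Suc t) w" for w
        unfolding continuation_Suc by simp
      show "AE w in M. ereal (h (Suc t) w + A t w \<bullet> dPrel P t w - \<Gamma> t w - shift R t w) \<le> V (Suc t) w"
        unfolding eq by (rule IH)
    qed
    moreover have "vp t w - shift R t w = h t w - continuation R t w" for w
      unfolding shift_def h_step[OF t] by simp
    ultimately show "AE w in M. ereal (h t w - continuation R t w) \<le> V t w" by simp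
  qed simp
  then show ?thesis unfolding V0 by simp
qed

text \<open>Backward induction on the sum of the Agent's and the Principal's values; individual
  rationality at time 0 then isolates the Principal's part.\<close>

lemma principal_admissible_le:
  assumes adm: "admissible M P T Ha c R \<Theta> \<beta> B"
    and Y: "pasted M F Hp T 0 (\<lambda>w. ereal (prin_terminal P T \<Theta> \<beta> B w)) Y"
  shows "AE w in M. Y w \<le> ereal (h 0 w - R)"
proof -
  have \<Theta>: "\<Theta> \<in> borel_measurable (F T)"
    and \<beta>: "\<And>t. t < T \<Longrightarrow> \<beta> t \<in> borel_measurable (F t)" and B: "\<And>t. t < T \<Longrightarrow> B t \<in> borel_measurable (F t)"
    using adm unfolding admissible_def by auto
  have "\<exists>Hs :: nat \<Rightarrow> 'a \<Rightarrow> ereal. Hs T = (\<lambda>w. ereal (\<Theta> w)) \<and>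
        (\<forall>t<T. Hs t \<in> borel_measurable (F t)
         \<and> (\<exists>Y. pasted M F Ha T t (\<lambda>w. Hs (Suc t) w + ereal (\<beta> t w * (B t w \<bullet> dPrel P t w))) Y
               \<and> (AE w in M. Hs t w = Y w - ereal (c t (B t w))))) \<and>
        (AE w in M. ereal R \<le> Hs 0 w)"
    using adm unfolding admissible_def is_ess_sup_def by blast
  then obtain Hs where HT: "Hs T = (\<lambda>w. ereal (\<Theta> w))" and HsF': "\<And>t. t < T \<Longrightarrow> Hs t \<in> borel_measurable (F t)"
    and Hs: "\<And>t. t < T \<Longrightarrow> \<exists>Y. pasted M F Ha T t (\<lambda>w. Hs (Suc t) w + ereal (\<beta> t w * (B t w \<bullet> dPrel P t w))) Y
               \<and> (AE w in M. Hs t w = Y w - ereal (c t (B t w)))"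
    and R: "AE w in M. ereal R \<le> Hs 0 w"
    by blast
  have HsF: "Hs t \<in> borel_measurable (F t)" if "t \<le> T" for t
    using HsF'[of t] HT \<Theta> that by (cases "t = T") auto
  obtain V where VT: "V T = (\<lambda>w. ereal (prin_terminal P T \<Theta> \<beta> B w))"
    and V: "\<And>s. s < T \<Longrightarrow> oce M (F s) (Hp s) (V (Suc s)) (V s)" and V0: "V 0 = Y"
    using Y unfolding pasted_def by blast
  \<comment> \<open>The trading gains that the Principal has retained up to time t. They are known
    then and act as the cash \<open>K\<close>; the next increment \<open>(1 - \<beta>)\<close> and
    the Agent's share \<beta> add up to the full gain of \<open>B\<close>, whatever \<beta>
    is.\<close>
  define G where "G t w = (\<Sum>s<t. (1 - \<beta> s w) * (B s w \<bullet> dPrel P s w))" for t w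
  have GF: "G t \<in> borel_measurable (F t)" if "t \<le> T" for t
    unfolding G_def[abs_def]
  proof (rule borel_measurable_sum)
    fix s assume s: "s \<in> {..<t}"
    have [measurable]: "\<beta> s \<in> borel_measurable (F t)" "B s \<in> borel_measurable (F t)"
      using s that by (auto intro!: Filt_mono[of s t] \<beta> B)
    have [measurable]: "dPrel P s \<in> borel_measurable (F t)"
      by (rule Filt_mono[OF _ dPrel_measurable]) (use s in auto)
    show "(\<lambda>w. (1 - \<beta> s w) * (B s w \<bullet> dPrel P s w)) \<in> borel_measurable (F t)" by measurable
  qed
  have VT': "V T w = ereal (G T w - \<Theta> w)" for w
    unfolding VT G_def prin_terminal_def by (simp add: sum_subtractf left_diff_distrib)
  have VTF: "V T \<in> borel_measurable (F T)"
    unfolding VT'[abs_def] using GF[of T] \<Theta> by simp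
  \<comment> \<open>Finiteness from above is part of the invariant: opposite infinities add up to
    \<infinity>, so terms could not be regrouped otherwise.\<close>
  let ?I = "\<lambda>t. (AE w in M. Hs t w < \<infinity>) \<and> (AE w in M. V t w < \<infinity>) \<and> (AE w in M. Hs t w + V t w \<le> ereal (G t w + h t w))"
  have "?I 0"
  proof (rule inc_induct[of 0 T ?I])
    show "?I T" unfolding VT' HT h_T by simp
    fix t assume t: "t < T" and IH: "?I (Suc t)"
    have tT: "Suc t \<le> T" using t by simp
    let ?X = "\<lambda>w. Hs (Suc t) w + ereal (\<beta> t w * (B t w \<bullet> dPrel P t w))"
    have [measurable]: "\<beta> t \<in> borel_measurable (F (Suc t))" "B t \<in> borel_measurable (F (Suc t))"
      by (rule Filt_mono[OF _ \<beta>[OF t]], simp, rule Filt_mono[OF _ B[OF t]], simp)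
    note HsF[OF tT, measurable] dPrel_measurable[measurable]
    have XF: "?X \<in> borel_measurable (F (Suc t))" by measurable
    have Xfin: "AE w in M. ?X w < \<infinity>" using IH by auto
    have VF: "V (Suc t) \<in> borel_measurable (F (Suc t))" by (rule pasted_chain_measurable[OF V VTF tT])
    obtain Y where "pasted M F Ha T t ?X Y" and Y_eq: "AE w in M. Hs t w = Y w - ereal (c t (B t w))"
      using Hs[OF t] by blast
    then have Y: "oce M (F t) (Ha t) ?X Y" unfolding agent_pasted(1)[OF t XF] by simp
    have Yfin: "AE w in M. Y w < \<infinity>"
      by (rule one_step_oce.oce_finite[OF one_step_oce[OF t Ha[OF t]] Y Filt_M[OF tT XF] Xfin])
    have Vfin: "AE w in M. V t w < \<infinity>"
      by (rule one_step_oce.oce_finite[OF one_step_oce[OF t Hp[OF t]] V[OF t] Filt_M[OF tT VF]]) (use IH in blast)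
    have "AE w in M. ?X w + V (Suc t) w \<le> ereal (G t w + h (Suc t) w + B t w \<bullet> dPrel P t w)"
      using IH[THEN conjunct1] IH[THEN conjunct2, THEN conjunct1] IH[THEN conjunct2, THEN conjunct2]
    proof eventually_elim
      case (elim w)
      then show ?case unfolding G_def by (cases "Hs (Suc t) w"; cases "V (Suc t) w") (auto simp: algebra_simps)
    qed
    then have "AE w in M. Y w + V t w \<le> ereal (G t w + c t (B t w) + (va t w - c t (A t w) + vp t w))"
      by (rule step_solution_add_le[OF sol[OF t] GF[OF less_imp_le[OF t]] B[OF t] XF Xfin VF IH[THEN conjunct2, THEN conjunct1] _ Y V[OF t]])
    then have "AE w in M. Hs t w + V t w \<le> ereal (G t w + h t w)"
      using Y_eq Yfin Vfin
    proof eventually_elim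
      case (elim w)
      then show ?case unfolding h_step[OF t] by (cases "Y w"; cases "V t w") auto
    qed
    moreover have "AE w in M. Hs t w < \<infinity>" using Y_eq Yfin
    proof eventually_elim
      case (elim w) then show ?case by (cases "Y w") auto
    qed
    ultimately show "?I t" using Vfin by blast
  qed simp
  then have 1: "AE w in M. Hs 0 w < \<infinity>" and 2: "AE w in M. V 0 w < \<infinity>" and 3: "AE w in M. Hs 0 w + V 0 w \<le> ereal (G 0 w + h 0 w)"
    by blast+
  show ?thesis using 1 2 3 R
  proof eventually_elim
    case (elim w)
    then show ?case unfolding V0 G_def by (cases "Hs 0 w"; cases "Y w") auto
  qed
qed

lemma PA_solution_continuation: "PA_solution M P T Ha Hp c R (continuation R T) (\<lambda>t w. 1) A"
  unfolding PA_solution_def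
proof (intro conjI allI impI admissible_continuation)
  fix \<Theta>' \<beta>' A' Y Y'
  assume "admissible M P T Ha c R \<Theta>' \<beta>' A'"
    and Y: "pasted M F Hp T 0 (\<lambda>w. ereal (prin_terminal P T (continuation R T) (\<lambda>t w. 1) A w)) Y"
    and "pasted M F Hp T 0 (\<lambda>w. ereal (prin_terminal P T \<Theta>' \<beta>' A' w)) Y'"
  then have "AE w in M. Y' w \<le> ereal (h 0 w - R)" by (intro principal_admissible_le)
  moreover note principal_solution_ge[OF Y]
  ultimately show "AE w in M. Y' w \<le> Y w" by eventually_elim order
qed

end

theorem mainTheorem6:
  fixes M :: "'a measure" and P :: "nat \<Rightarrow> 'a \<Rightarrow> real^'n::finite" and T :: nat
    and c :: "nat \<Rightarrow> real^'n \<Rightarrow> real" and Ha Hp :: "nat \<Rightarrow> real \<Rightarrow> ereal" and R :: real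
  assumes "prob_space M"
    and "T \<ge> 1"
    and "\<forall>t\<le>T. P t \<in> borel_measurable M"
    and "\<forall>t\<le>T. \<forall>\<omega>\<in>space M. \<forall>i. 0 < P t \<omega> $ i"
    and "\<exists>pm pp. 0 < pm \<and> pm \<le> pp \<and> (\<forall>t\<le>T. \<forall>i. AE \<omega> in M. pm \<le> P t \<omega> $ i \<and> P t \<omega> $ i \<le> pp)"
    and "\<forall>t<T. strictly_convex (c t)"
    and "\<forall>t<T. filterlim (\<lambda>a. c t a / norm a) at_top at_infinity"
    and "\<forall>t<T. OCE_loss (Ha t) \<and> OCE_loss (Hp t)"
    and "\<forall>t<T. 1 \<in> interior {x. conjugate (Ha t) x < \<infinity>} \<and> 1 \<in> interior {x. conjugate (Hp t) x < \<infinity>}"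
    and "\<forall>t<T. (\<exists>b. \<forall>s. ereal b \<le> Ha t s) \<and> (\<exists>b. \<forall>s. ereal b \<le> Hp t s)"
  shows "(\<exists>h. prin_recursion M P T Ha Hp c h \<and>
            (\<forall>t<T. \<exists>A \<Gamma> V. inC M P T Ha c t (\<lambda>\<omega>. 1) A \<Gamma> \<and> prin_val M P T Ha Hp c t (h (Suc t)) A \<Gamma> V
                           \<and> (AE \<omega> in M. h t \<omega> = V \<omega>)))
      \<and> (\<exists>\<Theta> A. PA_solution M P T Ha Hp c R \<Theta> (\<lambda>t \<omega>. 1) A)"
proof -
  have loss: "coercive_loss (Ha t)" "coercive_loss (Hp t)" if "t < T" for t
    using assms(8-10) that by (auto intro!: coercive_loss.intro)
  have contracting: "contracting M P T c Ha Hp"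
    by (intro contracting.intro contracting_axioms.intro assms(1,5) loss strictly_convex_imp_convex_on)
      (use assms(3,6,7) in auto)
  then interpret contracting M P T c Ha Hp .
  define next_step where "next_step h t A \<Gamma> va vp \<longleftrightarrow> h t = (\<lambda>\<omega>. va \<omega> - c t (A \<omega>) + vp \<omega>)
     \<and> step_solution M (F t) (F (Suc t)) (Ha t) (Hp t) (c t) (h (Suc t)) (dPrel P t) A \<Gamma> va vp" for h t A \<Gamma> va vp
  obtain h where hT: "h T = (\<lambda>\<omega>. 0)" and "\<forall>t. t < T \<longrightarrow> (\<exists>A \<Gamma> va vp. next_step h t A \<Gamma> va vp)"
    using recursive_solution unfolding next_step_def by blast
  then obtain A \<Gamma> va vp where "\<And>t. t < T \<Longrightarrow> next_step h t (A t) (\<Gamma> t) (va t) (vp t)" by metis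
  then interpret solved_contracting M P T c Ha Hp h A \<Gamma> va vp
    by (intro solved_contracting.intro solved_contracting_axioms.intro contracting hT) (auto simp: next_step_def)
  show ?thesis
  proof (intro conjI exI[of _ "\<lambda>t \<omega>. ereal (h t \<omega>)"] allI impI prin_recursion_h)
    fix t assume t: "t < T"
    show "\<exists>A \<Gamma> V. inC M P T Ha c t (\<lambda>\<omega>. 1) A \<Gamma> \<and> prin_val M P T Ha Hp c t (\<lambda>\<omega>. ereal (h (Suc t) \<omega>)) A \<Gamma> V
                           \<and> (AE \<omega> in M. ereal (h t \<omega>) = V \<omega>)"
      using agent_optimal[OF t] principal_value_attained[OF t] by blast
  next
    show "\<exists>\<Theta> A. PA_solution M P T Ha Hp c R \<Theta> (\<lambda>t \<omega>. 1) A" using PA_solution_continuation by blast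
  qed
qed

end
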